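(* Let $\pi:X\to Y$ be an infinite-to-one factor map given by a $1$-block code from an irreducible shift of finite type $X$ onto a sofic shift $Y$. Let $f\in C(X)$ be a $1$-Dini function and let $\nu\in\mathcal{M}(Y)$ be fully supported. Suppose $\mu\in\mathcal{M}(X)$ is a relative equilibrium state of $f$ over $\nu$. Then $\mu$ is fully supported and has positive relative entropy over $\nu$, i.e. $h(\mu)-h(\nu)>0$. In particular, if $f$ is a compensation function for $(X,Y,\pi)$, then $f$ is an oracle-type compensation function.
   Context: All shifts are two-sided subshifts over finite alphabets with the shift map. A $1$-block code is a map $\pi$ given by $\pi(x)_i=\Pi(x_i)$ for a map $\Pi$ between alphabets; a factor map is a surjective continuous shift-commuting map. $\pi$ is finite-to-one if every $y \in Y$ has finitely many preimages, and infinite-to-one otherwise. $C(X)$ is the set of continuous real-valued functions on $X$; $\mathcal{M}(X)$ is the set of shift-invariant Borel probability measures on $X$ (similarly $\mathcal{M}(Y)$); $h(\cdot)$ is measure-theoretic (Kolmogorov–Sinai) entropy with respect to the shift; $\mathcal{P}_X,\mathcal{P}_Y$ denote topological pressure. A measure is fully supported if every nonempty open set has positive measure. The metric on $X$ is the usual one, $d(x,y)=2^{-\min\{|i|: x_i\neq y_i\}}$ for $x\ne y$. For $f\in C(X)$, $\mathrm{var}_n(f)=\max_{d(x,y)\le 2^{-n}}|f(x)-f(y)|$. The function $f$ is $p$-Dini if $\sum_n(\mathrm{var}_n(f))^p<\infty$; so $1$-Dini means $\sum_n \mathrm{var}_n(f)<\infty$. For $\nu\in\mathcal{M}(Y)$,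 a measure $\mu\in\mathcal{M}(X)$ with $\mu\circ\pi^{-1}=\nu$ is a relative equilibrium state of $f$ over $\nu$ if it attains the supremum $$\sup\Big\{h(\mu')-h(\nu)+\int f\,d\mu' \;:\; \mu'\in\mathcal{M}(X),\ \mu'\circ\pi^{-1}=\nu\Big\}.$$ The relative entropy of $\mu$ over $\nu=\mu\circ\pi^{-1}$ is $h(\mu)-h(\nu)$. A compensation function for $(X,Y,\pi)$ is $f\in C(X)$ such that $\mathcal{P}_X(f+\phi\circ\pi)=\mathcal{P}_Y(\phi)$ for all $\phi\in C(Y)$. A compensation function $f$ is oracle-type if for every fully supported $\nu\in\mathcal{M}(Y)$, the relative equilibrium states of $f$ over $\nu$ are fully supported and have positive relative entropy. *)

theory Defs
  imports "HOL-Probability.Probability" "HOL-Library.Disjoint_Sets"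
begin

section \<open>Two-sided shift spaces\<close>

text \<open>
  Bi-infinite sequences are functions \<open>int \<Rightarrow> 'a\<close> on a type with the discrete topology; the
  function type then carries the product topology, and \<open>borel\<close> is its Borel sigma-algebra.
  A shift space \<open>X\<close> is a subset of this type. A function on \<open>X\<close> is represented by a function on
  the whole type, whose values outside \<open>X\<close> are irrelevant.
\<close>

definition shift :: "(int \<Rightarrow> 'a) \<Rightarrow> int \<Rightarrow> 'a" where
  "shift x = (\<lambda>i. x (i + 1))"

definition block :: "(int \<Rightarrow> 'a) \<Rightarrow> int \<Rightarrow> nat \<Rightarrow> 'a list" where
  "block x i n = map (\<lambda>k. x (i + int k)) [0..<n]"

definition occurs_in :: "'a list \<Rightarrow> (int \<Rightarrow> 'a) \<Rightarrow> bool" where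
  "occurs_in w x \<longleftrightarrow> (\<exists>i. block x i (length w) = w)"

definition language :: "(int \<Rightarrow> 'a) set \<Rightarrow> 'a list set" where
  "language X = {w. \<exists>x\<in>X. occurs_in w x}"

definition shift_of_finite_type :: "(int \<Rightarrow> 'a) set \<Rightarrow> bool" where
  "shift_of_finite_type X \<longleftrightarrow>
     (\<exists>A F. finite A \<and> finite F \<and> X = {x. range x \<subseteq> A \<and> (\<forall>w\<in>F. \<not> occurs_in w x)})"

definition irreducible_shift :: "(int \<Rightarrow> 'a) set \<Rightarrow> bool" where
  "irreducible_shift X \<longleftrightarrow>
     (\<forall>u\<in>language X. \<forall>v\<in>language X. \<exists>w. u @ w @ v \<in> language X)"

definition factor_map ::
  "(int \<Rightarrow> 'a::discrete_topology) set \<Rightarrow> (int \<Rightarrow> 'b::discrete_topology) set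
     \<Rightarrow> ((int \<Rightarrow> 'a) \<Rightarrow> int \<Rightarrow> 'b) \<Rightarrow> bool" where
  "factor_map X Y \<pi> \<longleftrightarrow>
     continuous_on X \<pi> \<and> \<pi> ` X = Y \<and> (\<forall>x\<in>X. \<pi> (shift x) = shift (\<pi> x))"

text \<open>
  A sofic shift is a factor of a shift of finite type. As one cannot quantify over types here,
  the alphabet of the latter is taken to be a finite subset of \<open>nat\<close>.
\<close>

definition sofic_shift :: "(int \<Rightarrow> 'b::discrete_topology) set \<Rightarrow> bool" where
  "sofic_shift Y \<longleftrightarrow>
     (\<exists>(Z :: (int \<Rightarrow> nat) set) \<rho>. shift_of_finite_type Z \<and> factor_map Z Y \<rho>)"

definition one_block_code ::
  "(int \<Rightarrow> 'a) set \<Rightarrow> ((int \<Rightarrow> 'a) \<Rightarrow> int \<Rightarrow> 'b) \<Rightarrow> bool" where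
  "one_block_code X \<pi> \<longleftrightarrow> (\<exists>g. \<forall>x\<in>X. \<forall>i. \<pi> x i = g (x i))"

definition finite_to_one :: "'x set \<Rightarrow> 'y set \<Rightarrow> ('x \<Rightarrow> 'y) \<Rightarrow> bool" where
  "finite_to_one X Y \<pi> \<longleftrightarrow> (\<forall>y\<in>Y. finite {x\<in>X. \<pi> x = y})"


section \<open>Metric and Dini functions\<close>

definition shift_dist :: "(int \<Rightarrow> 'a) \<Rightarrow> (int \<Rightarrow> 'a) \<Rightarrow> real" where
  "shift_dist x y =
     (if x = y then 0 else (1 / 2) ^ (LEAST n. \<exists>i. x i \<noteq> y i \<and> nat \<bar>i\<bar> = n))"

text \<open>
  For \<open>X\<close> compact and \<open>f\<close> continuous on \<open>X\<close> the supremum below is a maximum, since the pairs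
  concerned form a compact set.
\<close>

definition variation :: "(int \<Rightarrow> 'a) set \<Rightarrow> ((int \<Rightarrow> 'a) \<Rightarrow> real) \<Rightarrow> nat \<Rightarrow> real" where
  "variation X f n =
     (SUP (x, y)\<in>{(x, y). x \<in> X \<and> y \<in> X \<and> shift_dist x y \<le> (1 / 2) ^ n}. \<bar>f x - f y\<bar>)"

definition dini :: "real \<Rightarrow> (int \<Rightarrow> 'a) set \<Rightarrow> ((int \<Rightarrow> 'a) \<Rightarrow> real) \<Rightarrow> bool" where
  "dini p X f \<longleftrightarrow> summable (\<lambda>n. variation X f n powr p)"


section \<open>Invariant measures and Kolmogorov--Sinai entropy\<close>

definition invariant_measures ::
  "(int \<Rightarrow> 'a::discrete_topology) set \<Rightarrow> (int \<Rightarrow> 'a) measure set" where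
  "invariant_measures X =
     {\<mu>. prob_space \<mu> \<and> sets \<mu> = sets (restrict_space borel X) \<and> distr \<mu> \<mu> shift = \<mu>}"

definition fully_supported ::
  "(int \<Rightarrow> 'a::discrete_topology) set \<Rightarrow> (int \<Rightarrow> 'a) measure \<Rightarrow> bool" where
  "fully_supported X \<mu> \<longleftrightarrow>
     (\<forall>U. openin (top_of_set X) U \<and> U \<noteq> {} \<longrightarrow> 0 < measure \<mu> U)"

definition finite_partition :: "'x measure \<Rightarrow> 'x set set \<Rightarrow> bool" where
  "finite_partition M P \<longleftrightarrow> finite P \<and> P \<subseteq> sets M \<and> partition_on (space M) P"

definition partition_entropy :: "'x measure \<Rightarrow> 'x set set \<Rightarrow> real" where
  "partition_entropy M P = - (\<Sum>A\<in>P. measure M A * ln (measure M A))"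

definition pullback_partition ::
  "'x measure \<Rightarrow> ('x \<Rightarrow> 'x) \<Rightarrow> 'x set set \<Rightarrow> 'x set set" where
  "pullback_partition M T P = (\<lambda>A. T -` A \<inter> space M) ` P - {{}}"

text \<open>The join of the preimages of \<open>P\<close> under \<open>T ^^ i\<close> for \<open>i < n\<close>.\<close>

definition iterated_partition ::
  "'x measure \<Rightarrow> ('x \<Rightarrow> 'x) \<Rightarrow> 'x set set \<Rightarrow> nat \<Rightarrow> 'x set set" where
  "iterated_partition M T P n =
     common_refinement ((\<lambda>i. pullback_partition M (T ^^ i) P) ` {..<n})"

definition entropy_wrt_partition ::
  "'x measure \<Rightarrow> ('x \<Rightarrow> 'x) \<Rightarrow> 'x set set \<Rightarrow> real" where
  "entropy_wrt_partition M T P =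
     lim (\<lambda>n. partition_entropy M (iterated_partition M T P n) / real n)"

definition ks_entropy :: "'x measure \<Rightarrow> ('x \<Rightarrow> 'x) \<Rightarrow> ereal" where
  "ks_entropy M T = (SUP P\<in>{P. finite_partition M P}. ereal (entropy_wrt_partition M T P))"

abbreviation shift_entropy :: "(int \<Rightarrow> 'a) measure \<Rightarrow> ereal" where
  "shift_entropy \<mu> \<equiv> ks_entropy \<mu> shift"


section \<open>Topological pressure\<close>

text \<open>Bowen's definition, through sets separated by the metric up to time \<open>n\<close>.\<close>

definition separated_sets :: "(int \<Rightarrow> 'a) set \<Rightarrow> nat \<Rightarrow> real \<Rightarrow> (int \<Rightarrow> 'a) set set" where
  "separated_sets X n \<epsilon> =
     {E. finite E \<and> E \<subseteq> X \<and>
        (\<forall>x\<in>E. \<forall>y\<in>E. x \<noteq> y \<longrightarrow> (\<exists>i<n. shift_dist ((shift ^^ i) x) ((shift ^^ i) y) > \<epsilon>))}"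

definition pressure_sum ::
  "(int \<Rightarrow> 'a) set \<Rightarrow> ((int \<Rightarrow> 'a) \<Rightarrow> real) \<Rightarrow> nat \<Rightarrow> real \<Rightarrow> real" where
  "pressure_sum X f n \<epsilon> =
     (SUP E\<in>separated_sets X n \<epsilon>. \<Sum>x\<in>E. exp (\<Sum>i<n. f ((shift ^^ i) x)))"

definition pressure :: "(int \<Rightarrow> 'a) set \<Rightarrow> ((int \<Rightarrow> 'a) \<Rightarrow> real) \<Rightarrow> ereal" where
  "pressure X f =
     Lim (at_right 0) (\<lambda>\<epsilon>. limsup (\<lambda>n. ereal (ln (pressure_sum X f n \<epsilon>) / real n)))"


section \<open>Relative equilibrium states and compensation functions\<close>

text \<open>Since \<open>distr \<mu> \<nu> \<pi>\<close> takes its sigma-algebra from \<open>\<nu>\<close>, the last condition says \<open>\<mu> \<circ> \<pi>\<inverse> = \<nu>\<close>.\<close>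

definition invariant_lifts ::
  "(int \<Rightarrow> 'a::discrete_topology) set \<Rightarrow> ((int \<Rightarrow> 'a) \<Rightarrow> int \<Rightarrow> 'b)
     \<Rightarrow> (int \<Rightarrow> 'b) measure \<Rightarrow> (int \<Rightarrow> 'a) measure set" where
  "invariant_lifts X \<pi> \<nu> = {\<mu> \<in> invariant_measures X. distr \<mu> \<nu> \<pi> = \<nu>}"

definition relative_equilibrium_state ::
  "(int \<Rightarrow> 'a::discrete_topology) set \<Rightarrow> ((int \<Rightarrow> 'a) \<Rightarrow> int \<Rightarrow> 'b) \<Rightarrow> ((int \<Rightarrow> 'a) \<Rightarrow> real)
     \<Rightarrow> (int \<Rightarrow> 'b) measure \<Rightarrow> (int \<Rightarrow> 'a) measure \<Rightarrow> bool" where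
  "relative_equilibrium_state X \<pi> f \<nu> \<mu> \<longleftrightarrow>
     \<mu> \<in> invariant_lifts X \<pi> \<nu> \<and>
     shift_entropy \<mu> - shift_entropy \<nu> + ereal (\<integral>x. f x \<partial>\<mu>) =
       (SUP \<mu>'\<in>invariant_lifts X \<pi> \<nu>.
          shift_entropy \<mu>' - shift_entropy \<nu> + ereal (\<integral>x. f x \<partial>\<mu>'))"

definition compensation_function ::
  "(int \<Rightarrow> 'a::discrete_topology) set \<Rightarrow> (int \<Rightarrow> 'b::discrete_topology) set
     \<Rightarrow> ((int \<Rightarrow> 'a) \<Rightarrow> int \<Rightarrow> 'b) \<Rightarrow> ((int \<Rightarrow> 'a) \<Rightarrow> real) \<Rightarrow> bool" where
  "compensation_function X Y \<pi> f \<longleftrightarrow>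
     continuous_on X f \<and>
     (\<forall>\<phi> :: (int \<Rightarrow> 'b) \<Rightarrow> real. continuous_on Y \<phi> \<longrightarrow>
        pressure X (\<lambda>x. f x + \<phi> (\<pi> x)) = pressure Y \<phi>)"

definition oracle_type ::
  "(int \<Rightarrow> 'a::discrete_topology) set \<Rightarrow> (int \<Rightarrow> 'b::discrete_topology) set
     \<Rightarrow> ((int \<Rightarrow> 'a) \<Rightarrow> int \<Rightarrow> 'b) \<Rightarrow> ((int \<Rightarrow> 'a) \<Rightarrow> real) \<Rightarrow> bool" where
  "oracle_type X Y \<pi> f \<longleftrightarrow>
     compensation_function X Y \<pi> f \<and>
     (\<forall>\<nu> \<in> invariant_measures Y. fully_supported Y \<nu> \<longrightarrow>
        (\<forall>\<mu>. relative_equilibrium_state X \<pi> f \<nu> \<mu> \<longrightarrow>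
           fully_supported X \<mu> \<and> shift_entropy \<mu> - shift_entropy \<nu> > 0))"

end

theory Submission
  imports Defs "HOL-Real_Asymp.Real_Asymp"
begin

text \<open>
  Let \<open>\<mu>\<close> be a relative equilibrium state of \<open>f\<close> over \<open>\<nu>\<close>. Suppose that \<open>u\<close> and \<open>v\<close> are two words of \<open>X\<close> with
  the same image, and that they agree on a prefix and on a suffix at least as long as the memory
  of \<open>X\<close>. Then an occurrence of \<open>u\<close> in a point of \<open>X\<close> can be replaced by \<open>v\<close>, and neither membership
  in \<open>X\<close> nor the image under \<open>\<pi>\<close> changes. Flip a coin of bias \<open>\<epsilon>\<close> at every coordinate and replace the
  occurrences of \<open>u\<close> at which the coin shows heads, provided that no head precedes at a short
  distance. The law of the resulting point is again an invariant lift of \<open>\<nu>\<close>, so it competes with \<open>\<mu>\<close>.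

  The gain and the cost of this perturbation have different orders. The two points differ at a
  given distance from the origin with probability \<open>O(\<epsilon>)\<close>, so that \<open>\<integral> f\<close> changes by at most a constant
  times \<open>\<epsilon> (\<Sum>k. variation X f k)\<close>: this is where the Dini condition enters
  (\<open>perturbed_integral\<close>). The pair formed by the old point and the set of replaced positions has entropy
  larger by about \<open>\<mu>[u] \<epsilon> ln (1 / \<epsilon>)\<close> (\<open>entropy_of_marks\<close>). This gain passes to the new point in two
  situations. If \<open>\<mu>[v] = 0\<close>, every \<open>v\<close> in the new point is near a replacement, hence the set of replaced
  positions, and with it the old point, has conditional entropy only \<open>O(\<epsilon>)\<close> given the new point
  (\<open>rate_bound_if_null\<close>). If \<open>h \<mu> = h \<nu>\<close>, the old point has conditional entropy \<open>0\<close> already given the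
  common image, and old and new point together reveal the replaced positions
  (\<open>rate_bound_relative\<close>). As \<open>\<epsilon> ln (1 / \<epsilon>)\<close> beats \<open>O(\<epsilon>)\<close>, both situations contradict the maximality of
  \<open>\<mu>\<close> as soon as \<open>\<mu>[u] > 0\<close> (\<open>no_profitable_swap\<close>).

  It remains to find the words. For full support, assume \<open>\<mu>[w] = 0\<close>. There is a word \<open>t\<close> of \<open>Y\<close> such
  that every preimage \<open>u\<close> of \<open>t\<close> can be exchanged for a preimage \<open>v\<close> that contains \<open>w\<close>
  (\<open>uniform_preimage_word\<close>); since \<open>\<nu>[t] > 0\<close>, some preimage satisfies \<open>\<mu>[u] > 0\<close>, while
  \<open>\<mu>[v] \<le> \<mu>[w] = 0\<close>. The word \<open>t\<close> comes from a statement on finite monoids of relations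
  (\<open>uniform_word_exists\<close>). For positive relative entropy, a map that is not finite-to-one has a diamond,
  that is, a pair of distinct exchangeable words (\<open>exists_diamond\<close>), and \<open>\<mu>[u] > 0\<close> by full support.

  Kolmogorov--Sinai entropy is accessible to such estimates because it equals the growth rate of the
  Shannon entropy of blocks (\<open>shift_entropy_eq\<close>): the partition by the zeroth coordinate generates.
\<close>

section \<open>Finite monoids of relations\<close>

text \<open>
  The powers of \<open>T\<close> are eventually periodic; a multiple of the period beyond the preperiod is an
  idempotent power.
\<close>

lemma idempotent_relpow:
  fixes T :: "('v \<times> 'v) set"
  assumes "finite V" "T \<subseteq> V \<times> V"
  shows "\<exists>N>0. T ^^ N O T ^^ N = T ^^ N"
proof -
  have sub: "T ^^ Suc n \<subseteq> V \<times> V" for n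
    using assms(2) by (induction n) auto
  have "\<not> inj (\<lambda>n. T ^^ Suc n)"
  proof
    assume "inj (\<lambda>n. T ^^ Suc n)"
    moreover have "finite (range (\<lambda>n. T ^^ Suc n))"
      by (rule finite_subset[of _ "Pow (V \<times> V)"]) (use sub assms(1) in auto)
    ultimately show False
      using finite_imageD infinite_UNIV_nat by blast
  qed
  then obtain i j where "i < j" "T ^^ Suc i = T ^^ Suc j"
    unfolding inj_def by (metis linorder_neqE_nat)
  then obtain a p where a: "a > 0" "p > 0" "T ^^ (a + p) = T ^^ a"
    by (metis add_Suc less_imp_add_positive zero_less_Suc)
  have per: "T ^^ (n + k * p) = T ^^ n" if na: "n \<ge> a" for n k
  proof (induction k)
    case (Suc k)
    obtain d where d: "n = a + d" using le_Suc_ex[OF na] by auto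
    have 1: "n + Suc k * p = (a + p) + (d + k * p)" "n + k * p = a + (d + k * p)"
      unfolding d by simp_all
    have "T ^^ (n + Suc k * p) = T ^^ (a + p) O T ^^ (d + k * p)"
      unfolding 1 by (rule relpow_add)
    also have "\<dots> = T ^^ (n + k * p)"
      unfolding 1 a(3) by (rule relpow_add[symmetric])
    finally show ?case using Suc by simp
  qed simp
  have "T ^^ (a * p) O T ^^ (a * p) = T ^^ (a * p + a * p)" by (rule relpow_add[symmetric])
  also have "\<dots> = T ^^ (a * p)" using a by (intro per) auto
  finally show ?thesis using a by (intro exI[of _ "a * p"]) auto
qed

text \<open>
  Since \<open>U\<close> equals all its powers, \<open>(i, e) \<in> U\<close> is realised by a \<open>U\<close>-path with more steps than
  \<open>V\<close> has elements. A state visited twice by the path is fixed, by transitivity.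
\<close>

lemma idempotent_through_fixed_point:
  fixes U :: "('v \<times> 'v) set"
  assumes "finite V" "U \<subseteq> V \<times> V" "U O U = U" "(i, e) \<in> U"
  obtains m where "(i, m) \<in> U" "(m, m) \<in> U" "(m, e) \<in> U"
proof -
  define n where "n = Suc (card V)"
  have "U ^^ Suc k = U" for k
    by (induction k) (use assms(3) in auto)
  then have "(i, e) \<in> U ^^ n" using assms(4) n_def by metis
  then obtain f where f: "f 0 = i" "f n = e" "\<And>k. k < n \<Longrightarrow> (f k, f (Suc k)) \<in> U"
    unfolding relpow_fun_conv by blast
  have tr: "(f a, f b) \<in> U" if "a < b" "b \<le> n" for a b
    using that
  proof (induction b)
    case (Suc b)
    show ?case
    proof (cases "a = b")
      case False
      then have "(f a, f b) \<in> U" "(f b, f (Suc b)) \<in> U" using Suc f(3) by auto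
      then show ?thesis using assms(3) by auto
    qed (use f(3) Suc in auto)
  qed simp
  have "\<not> inj_on f {1..n}"
  proof
    assume "inj_on f {1..n}"
    moreover have "f ` {1..n} \<subseteq> V"
    proof
      fix z assume "z \<in> f ` {1..n}"
      then obtain b where "b \<in> {1..n}" "z = f b" by auto
      then show "z \<in> V" using tr[of 0 b] assms(2) by auto
    qed
    ultimately have "card {1..n} \<le> card V" using assms(1) by (metis card_inj_on_le)
    then show False by (simp add: n_def)
  qed
  then obtain a b where ab: "a \<in> {1..n}" "b \<in> {1..n}" "a < b" "f a = f b"
    unfolding inj_on_def by (metis linorder_neqE_nat)
  show ?thesis
    using that[of "f a"] tr[of 0 a] tr[of a b] tr[of a n] ab f by auto
qed

lemma word_relation_power:
  fixes R :: "'l list \<Rightarrow> ('v \<times> 'v) set"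
  assumes "\<And>s t. R (s @ t) = R s O R t"
  shows "R (concat (replicate (Suc n) t)) = R t ^^ Suc n"
proof (induction n)
  case (Suc n)
  have "R (concat (replicate (Suc (Suc n)) t)) = R t O R t ^^ Suc n"
    using Suc assms[of t "concat (replicate (Suc n) t)"] by simp
  also have "\<dots> = R t ^^ Suc (Suc n)"
    by (metis relpow.simps(2) relpow_commute)
  finally show ?case .
qed simp

text \<open>
  Here \<open>R t\<close> stands for the pairs of states joined by a path with label \<open>t\<close>, and \<open>W t\<close> for those joined
  by a path with label \<open>t\<close> that has a desired property, inherited by all longer paths. Call \<open>(u, M)\<close>
  routing if \<open>R u\<close> is a nonempty idempotent and each of its pairs factors through a fixed point in \<open>M\<close>,
  and choose \<open>M\<close> as small as possible. If a loop at \<open>m\<^sub>0 \<in> M\<close> is inserted between two copies of \<open>u\<close>, an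
  idempotent power \<open>E\<close> of the result is still routed by those elements of \<open>M\<close> that it fixes; by
  minimality it fixes all of \<open>M\<close>. Hence loops with the desired property can be inserted at the elements
  of \<open>M\<close> one after the other, and none of them gets lost. At the end every pair is joined through some
  \<open>m \<in> M\<close> whose loop is good.
\<close>

lemma uniform_word_exists:
  fixes R W :: "'l list \<Rightarrow> ('v \<times> 'v) set"
  assumes fin: "finite V" "V \<noteq> {}" and sub: "\<And>t. R t \<subseteq> V \<times> V"
    and comp: "\<And>s t. R (s @ t) = R s O R t"
    and WR: "\<And>t. W t \<subseteq> R t"
    and Wr: "\<And>s t. W s O R t \<subseteq> W (s @ t)"
    and rW: "\<And>s t. R s O W t \<subseteq> W (s @ t)"
    and trans: "\<And>i e. i \<in> V \<Longrightarrow> e \<in> V \<Longrightarrow> \<exists>t. (i, e) \<in> W t"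
  shows "\<exists>t. R t \<noteq> {} \<and> R t \<subseteq> W t"
proof -
  define routes where "routes u M \<longleftrightarrow> R u \<noteq> {} \<and> R u O R u = R u \<and> M \<subseteq> {m. (m, m) \<in> R u} \<and>
     (\<forall>(i, e) \<in> R u. \<exists>m\<in>M. (i, m) \<in> R u \<and> (m, e) \<in> R u)" for u M
  have idem: "\<exists>N. R (concat (replicate (Suc N) t)) O R (concat (replicate (Suc N) t))
      = R (concat (replicate (Suc N) t))" for t
    using idempotent_relpow[OF fin(1) sub[of t]]
    unfolding word_relation_power[of R, OF comp] by (metis Suc_pred)
  have fixpow: "(m, m) \<in> R (concat (replicate (Suc N) t))" if "(m, m) \<in> R t" for m N t
    unfolding word_relation_power[of R, OF comp] by (induction N) (use that in auto)
  have fixW: "(m, m) \<in> W (concat (replicate (Suc N) t))" if "(m, m) \<in> W t" for m N t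
  proof (cases N)
    case (Suc k)
    have "(m, m) \<in> R (concat (replicate (Suc k) t))" using that WR fixpow by blast
    then show ?thesis using Wr[of t "concat (replicate (Suc k) t)"] that Suc by auto
  qed (use that in simp)
  have ex: "\<exists>u M. routes u M"
  proof -
    obtain i where "i \<in> V" using fin by blast
    then obtain t where "(i, i) \<in> W t" using trans by blast
    then have "(i, i) \<in> R t" using WR by blast
    obtain N where N: "R (concat (replicate (Suc N) t)) O R (concat (replicate (Suc N) t))
      = R (concat (replicate (Suc N) t))" using idem by blast
    define u where "u = concat (replicate (Suc N) t)"
    have "(i, i) \<in> R u" unfolding u_def using fixpow \<open>(i, i) \<in> R t\<close> by blast
    moreover have "\<exists>m. (m, m) \<in> R u \<and> (a, m) \<in> R u \<and> (m, b) \<in> R u" if ab: "(a, b) \<in> R u" for a b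
      using idempotent_through_fixed_point[OF fin(1) sub N[folded u_def] ab] by blast
    ultimately have "routes u {m. (m, m) \<in> R u}"
      using N unfolding routes_def u_def[symmetric] by auto
    then show ?thesis by blast
  qed
  define k where "k = (LEAST k. \<exists>u M. routes u M \<and> card M = k)"
  have "\<exists>u M. routes u M \<and> card M = k"
    unfolding k_def by (rule LeastI_ex) (use ex in blast)
  then obtain u0 M where u0: "routes u0 M" "card M = k" by blast
  \<comment> \<open>From here on \<open>M\<close> is a routing set of least cardinality.\<close>
  have least: "k \<le> card M'" if "routes u M'" for u M'
    unfolding k_def by (rule Least_le) (use that in blast)
  have finM: "finite M"
    by (rule finite_subset[OF _ fin(1)]) (use u0 sub in \<open>auto simp: routes_def\<close>)
  \<comment> \<open>Good loops are collected for one element of \<open>M\<close> at a time.\<close>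
  have "\<exists>u. routes u M \<and> (\<forall>m\<in>D. (m, m) \<in> W u)" if "D \<subseteq> M" for D
    using finite_subset[OF that finM] that
  proof (induction D rule: finite_induct)
    case empty
    then show ?case using u0 by blast
  next
    case (insert m0 D)
    then obtain u where u: "routes u M" "\<forall>m\<in>D. (m, m) \<in> W u" by blast
    have m0: "(m0, m0) \<in> R u" using u insert.prems unfolding routes_def by blast
    obtain s where s: "(m0, m0) \<in> W s" using trans m0 sub by blast
    define t where "t = u @ s @ u"
    have Wt: "(m0, m0) \<in> W t"
    proof -
      have "(m0, m0) \<in> W (s @ u)" using Wr[of s u] s m0 by blast
      then show ?thesis unfolding t_def using rW[of u "s @ u"] m0 by blast
    qed
    obtain N where N: "R (concat (replicate (Suc N) t)) O R (concat (replicate (Suc N) t))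
      = R (concat (replicate (Suc N) t))" using idem by blast
    define E where "E = concat (replicate (Suc N) t)"
    have m0E: "(m0, m0) \<in> W E" unfolding E_def by (rule fixW[OF Wt])
    have uu: "R u O R u = R u" using u by (simp add: routes_def)
    have tu: "R t O R u = R t" "R u O R t = R t"
      unfolding t_def comp using uu by (simp_all add: O_assoc) (simp add: O_assoc[symmetric])
    have pow: "R t ^^ Suc N = R t O R t ^^ N" "R t ^^ Suc N = R t ^^ N O R t"
      by (simp_all add: relpow_commute)
    have Eu: "R E O R u = R E" "R u O R E = R E"
    proof -
      show "R E O R u = R E" unfolding E_def word_relation_power[of R, OF comp] pow(2)
        by (simp add: O_assoc tu)
      show "R u O R E = R E" unfolding E_def word_relation_power[of R, OF comp] pow(1)
        by (simp add: O_assoc[symmetric] tu)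
    qed
    have EE: "R E O R E = R E" using N E_def by simp
    \<comment> \<open>Route a pair of \<open>R E\<close> through an \<open>E\<close>-fixed point \<open>x\<close>, and the loop at \<open>x\<close> through some \<open>m \<in> M\<close> by
      means of the factor \<open>u\<close>; then \<open>m\<close> is \<open>E\<close>-fixed as well.\<close>
    have "routes E (M \<inter> {m. (m, m) \<in> R E})"
    proof -
      have "\<exists>m\<in>M. (m, m) \<in> R E \<and> (i, m) \<in> R E \<and> (m, e) \<in> R E" if ie: "(i, e) \<in> R E" for i e
      proof -
        obtain x where x: "(i, x) \<in> R E" "(x, x) \<in> R E" "(x, e) \<in> R E"
          using idempotent_through_fixed_point[OF fin(1) sub EE ie] by blast
        have "(x, x) \<in> R E O R u O R E" using x EE Eu by auto
        then obtain a b where "(x, a) \<in> R E" "(a, b) \<in> R u" "(b, x) \<in> R E" by blast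
        moreover then obtain m where m: "m \<in> M" "(a, m) \<in> R u" "(m, b) \<in> R u"
          using u(1) unfolding routes_def by fast
        ultimately have 1: "(x, m) \<in> R E" "(m, x) \<in> R E" using Eu by blast+
        then show ?thesis using m x EE by blast
      qed
      then show ?thesis unfolding routes_def using EE m0E WR by fast
    qed
    from least[OF this] u0(2) have "M \<inter> {m. (m, m) \<in> R E} = M"
      using finM by (metis Int_lower1 card_seteq)
    with \<open>routes E (M \<inter> {m. (m, m) \<in> R E})\<close> have rE: "routes E M" by simp
    define u' where "u' = u @ E"
    have "R u' = R E" unfolding u'_def comp by (rule Eu(2))
    then have "routes u' M" using rE by (simp add: routes_def)
    moreover have "(m, m) \<in> W u'" if "m \<in> D" for m
    proof -
      have "(m, m) \<in> R E" using rE that insert.prems unfolding routes_def by blast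
      then show ?thesis using u(2) that Wr[of u E] unfolding u'_def by blast
    qed
    moreover have "(m0, m0) \<in> W u'" unfolding u'_def using rW[of u E] m0 m0E by blast
    ultimately show ?case by auto
  qed
  then obtain u where u: "routes u M" "\<forall>m\<in>M. (m, m) \<in> W u" by blast
  have "R (u @ u @ u) = R u" unfolding comp using u by (simp add: routes_def)
  moreover have "R u \<subseteq> W (u @ u @ u)"
  proof
    fix p assume p: "p \<in> R u"
    obtain i e where ie: "p = (i, e)" by force
    then obtain m where m: "m \<in> M" "(i, m) \<in> R u" "(m, e) \<in> R u"
      using p u(1) unfolding routes_def by fast
    then have "(m, e) \<in> W (u @ u)" using u(2) Wr[of u u] by blast
    then show "p \<in> W (u @ u @ u)" using m ie rW[of u "u @ u"] by blast
  qed
  ultimately show ?thesis using u(1) unfolding routes_def by metis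
qed

section \<open>Splicing in shifts of finite type\<close>

lemma length_block [simp]: "length (block x i n) = n"
  by (simp add: block_def)

lemma nth_block [simp]: "k < n \<Longrightarrow> block x i n ! k = x (i + int k)"
  by (simp add: block_def)

lemma block_eq_iff: "block x i n = block y j n \<longleftrightarrow> (\<forall>k<n. x (i + int k) = y (j + int k))"
  by (auto simp: list_eq_iff_nth_eq)

lemma block_same_eq_iff: "block x i n = block y i n \<longleftrightarrow> (\<forall>k. i \<le> k \<and> k < i + int n \<longrightarrow> x k = y k)"
proof -
  have "x k = y k" if h: "\<forall>k<n. x (i + int k) = y (i + int k)" "i \<le> k" "k < i + int n" for k
    using h(1)[rule_format, of "nat (k - i)"] h by auto
  then show ?thesis by (auto simp: block_eq_iff)
qed

lemma block_translate: "block (\<lambda>i. x (i + p)) q n = block x (q + p) n"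
  by (simp add: block_eq_iff algebra_simps)

lemma block_append: "block x i (a + b) = block x i a @ block x (i + int a) b"
  by (rule nth_equalityI) (auto simp: nth_append algebra_simps of_nat_diff)

lemma shift_funpow: "(shift ^^ n) x = (\<lambda>i. x (i + int n))"
  by (induction n arbitrary: x) (auto simp: shift_def fun_eq_iff algebra_simps)

locale sft =
  fixes X :: "(int \<Rightarrow> 'a) set" and A :: "'a set" and F :: "'a list set" and m :: nat
  assumes X_eq: "X = {x. range x \<subseteq> A \<and> (\<forall>w\<in>F. \<not> occurs_in w x)}"
    and memory: "\<And>w. w \<in> F \<Longrightarrow> length w \<le> m" and memory_pos: "0 < m"
begin

text \<open>
  Forbidden words have length at most \<open>m\<close>, so a violation is visible in a window of length \<open>m\<close>.
\<close>

lemma mem_if_locally_mem: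
  assumes "\<And>q. \<exists>x\<in>X. \<forall>i. q \<le> i \<and> i < q + int m \<longrightarrow> z i = x i"
  shows "z \<in> X"
proof -
  have "z q \<in> A" for q
  proof -
    obtain x where "x \<in> X" "\<forall>i. q \<le> i \<and> i < q + int m \<longrightarrow> z i = x i" using assms by blast
    then show ?thesis using memory_pos X_eq by auto
  qed
  moreover have "\<not> occurs_in w z" if w: "w \<in> F" for w
  proof
    assume "occurs_in w z"
    then obtain q where q: "block z q (length w) = w" unfolding occurs_in_def by blast
    obtain x where x: "x \<in> X" "\<forall>i. q \<le> i \<and> i < q + int m \<longrightarrow> z i = x i" using assms by blast
    have "block x q (length w) = block z q (length w)"
      unfolding block_same_eq_iff using x memory[OF w] by auto
    then have "occurs_in w x" using q unfolding occurs_in_def by auto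
    then show False using x w X_eq by blast
  qed
  ultimately show ?thesis using X_eq by auto
qed

lemma translate_mem: "x \<in> X \<Longrightarrow> (\<lambda>i. x (i + p)) \<in> X"
  unfolding X_eq occurs_in_def by (auto simp: block_translate)

lemma shift_mem: "x \<in> X \<Longrightarrow> shift x \<in> X"
  unfolding shift_def by (rule translate_mem)

lemma language_at_0: "w \<in> language X \<longleftrightarrow> (\<exists>x\<in>X. block x 0 (length w) = w)"
proof
  assume "w \<in> language X"
  then obtain x i where "x \<in> X" "block x i (length w) = w"
    unfolding language_def occurs_in_def by auto
  then show "\<exists>x\<in>X. block x 0 (length w) = w"
    using translate_mem[of x i] by (auto intro!: bexI[of _ "\<lambda>k. x (k + i)"] simp: block_translate)
qed (auto simp: language_def occurs_in_def)

lemma block_in_language: "x \<in> X \<Longrightarrow> block x i n \<in> language X"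
  unfolding language_def occurs_in_def by auto

lemma splice_mem:
  assumes "x \<in> X" "y \<in> X" "block x p m = block y p m"
  shows "(\<lambda>i. if i < p then x i else y i) \<in> X"
proof (rule mem_if_locally_mem)
  fix q
  show "\<exists>z\<in>X. \<forall>i. q \<le> i \<and> i < q + int m \<longrightarrow> (if i < p then x i else y i) = z i"
    using assms(3) unfolding block_same_eq_iff
    by (cases "q < p") (use assms(1,2) in \<open>force intro: bexI[of _ x] bexI[of _ y]\<close>)+
qed

text \<open>
  The states are the words of length \<open>m\<close>, a word \<open>t\<close> relates the first to the last \<open>m\<close> symbols of its
  preimages, and the good preimages are those containing \<open>w\<close>. Splicing makes \<open>R\<close> multiplicative, and
  irreducibility joins any two states by a path that contains \<open>w\<close>.
\<close>

lemma uniform_preimage_word: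
  assumes irr: "irreducible_shift X" and ne: "X \<noteq> {}" and finA: "finite A" and w: "w \<in> language X"
  shows "\<exists>t. (\<exists>x\<in>X. map g (block x 0 (length t)) = t) \<and>
     (\<forall>x\<in>X. map g (block x 0 (length t)) = t \<longrightarrow>
       (\<exists>y\<in>X. map g (block y 0 (length t)) = t \<and> block y 0 m = block x 0 m \<and>
          block y (int (length t)) m = block x (int (length t)) m \<and>
          (\<exists>q\<ge>0. q + int (length w) \<le> int (length t + m) \<and> block y q (length w) = w)))"
proof -
  define V where "V = {block x 0 m |x. x \<in> X}"
  define P where "P t i e y \<longleftrightarrow> y \<in> X \<and> map g (block y 0 (length t)) = t \<and> block y 0 m = i \<and>
          block y (int (length t)) m = e" for t i e y
  define Q where "Q t y \<longleftrightarrow> (\<exists>q\<ge>0. q + int (length w) \<le> int (length t + m) \<and> block y q (length w) = w)"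
    for t :: "'b list" and y
  define R where "R t = {(i, e). \<exists>y. P t i e y}" for t
  define W where "W t = {(i, e). \<exists>y. P t i e y \<and> Q t y}" for t
  have "V \<subseteq> {l. set l \<subseteq> A \<and> length l = m}"
    unfolding V_def block_def X_eq by (auto simp: image_subset_iff)
  then have finV: "finite V"
    using finite_lists_length_eq[OF finA] finite_subset by blast
  have neV: "V \<noteq> {}" unfolding V_def using ne by blast
  have blockV: "block x i m \<in> V" if "x \<in> X" for x i
    unfolding V_def using translate_mem[OF that, of i] block_translate[of x i 0 m] by force
  have Pcut: "P s i (block y (int (length s)) m) y"
     "P t (block y (int (length s)) m) e (\<lambda>k. y (k + int (length s)))" if "P (s @ t) i e y" for s t i e y
    using that unfolding P_def
    by (auto simp: block_append block_translate translate_mem add_ac)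
  have Pglue: "P (s @ t) i e (\<lambda>k. if k < int (length s) then y k else y' (k - int (length s)))"
    (is "P _ _ _ ?z") if y: "P s i c y" and y': "P t c e y'" for s t i c e y y'
  proof -
    have b: "block y (int (length s)) m = block (\<lambda>k. y' (k - int (length s))) (int (length s)) m"
    proof -
      have "block (\<lambda>k. y' (k - int (length s))) (int (length s)) m = block y' 0 m"
        by (simp add: block_eq_iff)
      then show ?thesis using y y' unfolding P_def by simp
    qed
    have zX: "?z \<in> X"
      using splice_mem[OF _ _ b] y y' translate_mem[of y' "- int (length s)"]
      unfolding P_def by simp
    have 1: "block ?z 0 (length s) = block y 0 (length s)"
      "block ?z (int (length s)) n = block y' 0 n" for n
      by (simp_all add: block_eq_iff)
    have 2: "block ?z 0 m = block y 0 m"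
      unfolding block_same_eq_iff
    proof (intro allI impI)
      fix k assume k: "0 \<le> k \<and> k < 0 + int m"
      show "?z k = y k"
        using b k unfolding block_same_eq_iff by (cases "k < int (length s)") auto
    qed
    have 3: "block ?z (int (length (s @ t))) m = block y' (int (length t)) m"
      by (simp add: block_eq_iff add_ac)
    show ?thesis
      using zX 1 2 3 y y' unfolding P_def by (simp add: block_append)
  qed
  have Qy: "Q (s @ t) (\<lambda>k. if k < int (length s) then y k else y' (k - int (length s)))"
    (is "Q _ ?z") if y: "P s i c y" and y': "P t c e y'" and q: "Q s y" for s t i c e y y'
  proof -
    have b: "block y (int (length s)) m = block (\<lambda>k. y' (k - int (length s))) (int (length s)) m"
    proof -
      have "block (\<lambda>k. y' (k - int (length s))) (int (length s)) m = block y' 0 m"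
        by (simp add: block_eq_iff)
      then show ?thesis using y y' unfolding P_def by simp
    qed
    obtain p where p: "p \<ge> 0" "p + int (length w) \<le> int (length s + m)" "block y p (length w) = w"
      using q unfolding Q_def by blast
    have "block ?z p (length w) = block y p (length w)"
      unfolding block_same_eq_iff
    proof (intro allI impI)
      fix k assume "p \<le> k \<and> k < p + int (length w)"
      then show "?z k = y k"
        using b p unfolding block_same_eq_iff by (cases "k < int (length s)") auto
    qed
    then show ?thesis using p unfolding Q_def by (intro exI[of _ p]) auto
  qed
  have Qy': "Q (s @ t) (\<lambda>k. if k < int (length s) then y k else y' (k - int (length s)))"
    (is "Q _ ?z") if q: "Q t y'" for s t y y'
  proof -
    obtain p where p: "p \<ge> 0" "p + int (length w) \<le> int (length t + m)" "block y' p (length w) = w"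
      using q unfolding Q_def by blast
    have "block ?z (p + int (length s)) (length w) = block y' p (length w)"
      using p(1) by (simp add: block_eq_iff)
    then show ?thesis using p unfolding Q_def by (intro exI[of _ "p + int (length s)"]) auto
  qed
  have "\<exists>t. R t \<noteq> {} \<and> R t \<subseteq> W t"
  proof (rule uniform_word_exists[OF finV neV])
    show "R t \<subseteq> V \<times> V" for t unfolding R_def P_def using blockV by auto
    show "R (s @ t) = R s O R t" for s t
    proof
      show "R (s @ t) \<subseteq> R s O R t" unfolding R_def using Pcut by blast
      show "R s O R t \<subseteq> R (s @ t)" unfolding R_def using Pglue by blast
    qed
    show "W t \<subseteq> R t" for t unfolding R_def W_def by blast
    show "W s O R t \<subseteq> W (s @ t)" for s t
      unfolding R_def W_def using Pglue Qy by blast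
    show "R s O W t \<subseteq> W (s @ t)" for s t
      unfolding R_def W_def using Pglue Qy' by blast
    fix i e assume "i \<in> V" "e \<in> V"
    then have ie: "i \<in> language X" "e \<in> language X" "length i = m" "length e = m"
      unfolding V_def using block_in_language by auto
    obtain a where a: "i @ a @ w \<in> language X" using irr ie w unfolding irreducible_shift_def by blast
    obtain b where "(i @ a @ w) @ b @ e \<in> language X"
      using irr ie a unfolding irreducible_shift_def by blast
    then obtain y where y: "y \<in> X"
       "block y 0 (length ((i @ a @ w) @ b @ e)) = (i @ a @ w) @ b @ e"
      using language_at_0 by blast
    define n where "n = m + length a + length w + length b"
    define t where "t = map g (block y 0 n)"
    have "length ((i @ a @ w) @ b @ e) = n + m" unfolding n_def using ie by simp
    then have full: "block y 0 (n + m) = i @ a @ w @ b @ e" using y(2) by simp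
    have "block y 0 n @ block y (int n) m = (i @ a @ w @ b) @ e"
      using full unfolding block_append by simp
    then have e: "block y (int n) m = e" and iawb: "block y 0 n = i @ a @ w @ b"
      using ie by (metis append_eq_append_conv length_block)+
    have i: "block y 0 m = i"
    proof -
      have "block y 0 m @ block y (int m) n = i @ (a @ w @ b @ e)"
        using full unfolding add.commute[of n m] block_append by simp
      then show ?thesis using ie by (metis append_eq_append_conv length_block)
    qed
    have "block y (int (m + length a)) (length w) = w"
    proof -
      have "block y 0 ((m + length a) + (length w + length b)) = (i @ a) @ (w @ b)"
        using iawb unfolding n_def by (simp add: add_ac)
      then have "block y (int (m + length a)) (length w + length b) = w @ b"
        unfolding block_append using ie by (simp add: append_eq_append_conv)
      then show ?thesis unfolding block_append by simp
    qed
    then have "Q t y" unfolding Q_def t_def n_def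
      by (intro exI[of _ "int (m + length a)"]) auto
    moreover have "P t i e y" unfolding P_def t_def using y i e by simp
    ultimately show "\<exists>t. (i, e) \<in> W t" unfolding W_def by blast
  qed
  then obtain t where t: "R t \<noteq> {}" "R t \<subseteq> W t" by blast
  show ?thesis
  proof (intro exI[of _ t] conjI ballI impI)
    show "\<exists>x\<in>X. map g (block x 0 (length t)) = t" using t(1) unfolding R_def P_def by blast
    fix x assume x: "x \<in> X" "map g (block x 0 (length t)) = t"
    then have "P t (block x 0 m) (block x (int (length t)) m) x" unfolding P_def by blast
    then have "(block x 0 m, block x (int (length t)) m) \<in> W t"
      using t(2) unfolding R_def by blast
    then obtain y where "P t (block x 0 m) (block x (int (length t)) m) y" "Q t y"
      unfolding W_def by blast
    then show "\<exists>y\<in>X. map g (block y 0 (length t)) = t \<and> block y 0 m = block x 0 m \<and>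
          block y (int (length t)) m = block x (int (length t)) m \<and>
          (\<exists>q\<ge>0. q + int (length w) \<le> int (length t + m) \<and> block y q (length w) = w)"
      unfolding P_def Q_def by blast
  qed
qed

text \<open>
  Choose more points in one fibre than there are pairs of words of length \<open>m\<close>, and a window that
  distinguishes them all. Two of these points agree at both margins of the window.
\<close>

lemma exists_diamond:
  assumes finA: "finite A" and inf: "infinite {x\<in>X. (\<lambda>i. g (x i)) = y}"
  shows "\<exists>x\<in>X. \<exists>x'\<in>X. \<exists>n. block x 0 m = block x' 0 m \<and> block x (int n) m = block x' (int n) m \<and>
     map g (block x 0 (n + m)) = map g (block x' 0 (n + m)) \<and> block x 0 (n + m) \<noteq> block x' 0 (n + m)"
proof -
  define V where "V = {l. set l \<subseteq> A \<and> length l = m}"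
  have finV: "finite V" unfolding V_def using finite_lists_length_eq[OF finA] .
  have blockV: "block x i m \<in> V" if "x \<in> X" for x i
    unfolding V_def block_def using that X_eq by auto
  obtain S where S: "finite S" "card S = Suc (card (V \<times> V))" "S \<subseteq> {x\<in>X. (\<lambda>i. g (x i)) = y}"
    using infinite_arbitrarily_large[OF inf, of "Suc (card (V \<times> V))"] by (elim exE conjE)
  obtain dif :: "(int \<Rightarrow> 'a) \<Rightarrow> (int \<Rightarrow> 'a) \<Rightarrow> int"
    where dif: "x \<noteq> x' \<Longrightarrow> x (dif x x') \<noteq> x' (dif x x')" for x x'
  proof (rule that[of "\<lambda>x x'. SOME i. x i \<noteq> x' i"])
    fix x x' :: "int \<Rightarrow> 'a" assume "x \<noteq> x'"
    then have "\<exists>i. x i \<noteq> x' i" by (simp add: fun_eq_iff)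
    then show "x (SOME i. x i \<noteq> x' i) \<noteq> x' (SOME i. x i \<noteq> x' i)" by (rule someI_ex)
  qed
  define N where "N = Suc (Max (insert 0 ((\<lambda>(x, x'). nat \<bar>dif x x'\<bar>) ` (S \<times> S))))"
  have N: "\<exists>i. \<bar>i\<bar> < int N \<and> x i \<noteq> x' i" if h: "x \<in> S" "x' \<in> S" "x \<noteq> x'" for x x'
  proof -
    have "(\<lambda>(x, x'). nat \<bar>dif x x'\<bar>) (x, x') \<in> (\<lambda>(x, x'). nat \<bar>dif x x'\<bar>) ` (S \<times> S)"
      using h by (intro imageI) simp
    then have "nat \<bar>dif x x'\<bar> \<le> Max (insert 0 ((\<lambda>(x, x'). nat \<bar>dif x x'\<bar>) ` (S \<times> S)))"
      using S(1) by (intro Max_ge) simp_all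
    then have "\<bar>dif x x'\<bar> < int N" unfolding N_def by linarith
    then show ?thesis using dif[OF h(3)] by blast
  qed
  define p where "p = - int N - int m"
  define n where "n = 2 * N + m"
  have "\<not> inj_on (\<lambda>x. (block x p m, block x (p + int n) m)) S"
  proof
    assume "inj_on (\<lambda>x. (block x p m, block x (p + int n) m)) S"
    then have "card S \<le> card (V \<times> V)"
      by (rule card_inj_on_le) (use S blockV finV in auto)
    then show False using S by simp
  qed
  then obtain x x' where x: "x \<in> S" "x' \<in> S" "x \<noteq> x'" "block x p m = block x' p m"
      "block x (p + int n) m = block x' (p + int n) m"
    unfolding inj_on_def by auto
  obtain i where i: "\<bar>i\<bar> < int N" "x i \<noteq> x' i" using N x by blast
  define z where "z = (\<lambda>k. x (k + p))"
  define z' where "z' = (\<lambda>k. x' (k + p))"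
  have "z \<in> X" "z' \<in> X" unfolding z_def z'_def using x S translate_mem by auto
  moreover have "block z 0 m = block z' 0 m" "block z (int n) m = block z' (int n) m"
    using x unfolding z_def z'_def block_translate by (simp_all add: add.commute)
  moreover have "g (x k) = g (x' k)" for k
  proof -
    have "(\<lambda>i. g (x i)) = (\<lambda>i. g (x' i))" using x S by auto
    then show ?thesis by metis
  qed
  then have "map g (block z 0 (n + m)) = map g (block z' 0 (n + m))"
    unfolding z_def z'_def by (simp add: block_def)
  moreover have "block z 0 (n + m) \<noteq> block z' 0 (n + m)"
  proof
    assume "block z 0 (n + m) = block z' 0 (n + m)"
    moreover have "0 \<le> i - p \<and> i - p < 0 + int (n + m)"
      using i by (auto simp: p_def n_def)
    ultimately have "z (i - p) = z' (i - p)" unfolding block_same_eq_iff by blast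
    then show False using i by (simp add: z_def z'_def)
  qed
  ultimately show ?thesis by blast
qed

end

section \<open>Exchanging words at marked positions\<close>

text \<open>
  Words that may be exchanged in a point of a shift of memory \<open>m\<close> without leaving the shift or changing the
  image under the code induced by \<open>g\<close>.
\<close>

definition swap_pair :: "nat \<Rightarrow> ('a \<Rightarrow> 'b) \<Rightarrow> 'a list \<Rightarrow> 'a list \<Rightarrow> bool" where
  "swap_pair m g u v \<longleftrightarrow> length u = length v \<and> m \<le> length u \<and> u \<noteq> v \<and> take m u = take m v \<and>
     drop (length u - m) u = drop (length u - m) v \<and> map g u = map g v"

text \<open>
  The factor \<open>2\<close> leaves, after each word of length \<open>l\<close> placed at a marked position, a gap of length at
  least \<open>l\<close> before the next one.
\<close>

definition spaced :: "nat \<Rightarrow> (int \<Rightarrow> bool) \<Rightarrow> bool" where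
  "spaced l s \<longleftrightarrow> (\<forall>i j. s i \<longrightarrow> s j \<longrightarrow> i < j \<longrightarrow> i + 2 * int l \<le> j)"

text \<open>
  Writes \<open>v\<close> at the positions marked by \<open>s\<close>. For spaced marks at most one \<open>k\<close> qualifies, and \<open>LEAST\<close> merely
  selects it.
\<close>

definition switch :: "'a list \<Rightarrow> (int \<Rightarrow> bool) \<Rightarrow> (int \<Rightarrow> 'a) \<Rightarrow> int \<Rightarrow> 'a" where
  "switch v s x i = (if \<exists>k<length v. s (i - int k)
     then v ! (LEAST k. k < length v \<and> s (i - int k)) else x i)"

lemma swap_pairI:
  assumes "block x 0 m = block y 0 m" "block x (int n) m = block y (int n) m"
    "map g (block x 0 (n + m)) = map g (block y 0 (n + m))" "block x 0 (n + m) \<noteq> block y 0 (n + m)"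
  shows "swap_pair m g (block x 0 (n + m)) (block y 0 (n + m))"
proof -
  have t: "take m (block z 0 (n + m)) = block z 0 m" "drop n (block z 0 (n + m)) = block z (int n) m"
    for z :: "int \<Rightarrow> 'a"
    by (simp add: add.commute[of n m] block_append) (simp add: block_append)
  show ?thesis using assms unfolding swap_pair_def by (simp add: t del: map_append)
qed

lemma swap_pair_nth_eq:
  assumes "swap_pair m g u v" "k < m \<or> length u < k + m \<and> k < length u"
  shows "u ! k = v ! k"
proof (cases "k < m")
  case True
  then show ?thesis using assms unfolding swap_pair_def by (metis nth_take)
next
  case False
  define a where "a = length u - m"
  obtain b where b: "k = a + b" 
    using False assms le_Suc_ex[of a k] unfolding a_def by fastforce
  have 0: "drop a u = drop a v" using assms(1) unfolding swap_pair_def a_def by blast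
  have 1: "drop a u = drop a v" "a \<le> length u" "a \<le> length v"
    using 0 assms(1) by (blast, simp_all add: swap_pair_def a_def)
  show ?thesis unfolding b using arg_cong[OF 1(1), of "\<lambda>l. l ! b"] 1(2,3) by simp
qed

lemma switch_unmarked: "(\<And>k. k < length v \<Longrightarrow> \<not> s (i - int k)) \<Longrightarrow> switch v s x i = x i"
  unfolding switch_def by auto

text \<open>
  Marked positions are so far apart that a coordinate is covered by the word placed at one of them only.
\<close>

lemma spaced_unique:
  assumes "spaced l s" "s (i - int k)" "s (i - int k')" "k < l" "k' < l"
  shows "k = k'"
proof (rule ccontr)
  assume "k \<noteq> k'"
  then consider "k < k'" | "k' < k" by linarith
  then show False
  proof cases
    case 1
    then show ?thesis using assms(1)[unfolded spaced_def, rule_format, of "i - int k'" "i - int k"] assms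
      by auto
  next
    case 2
    then show ?thesis using assms(1)[unfolded spaced_def, rule_format, of "i - int k" "i - int k'"] assms
      by auto
  qed
qed

lemma switch_marked:
  assumes "spaced (length v) s" "s (i - int k)" "k < length v"
  shows "switch v s x i = v ! k"
proof -
  have "(LEAST k. k < length v \<and> s (i - int k)) = k"
    by (rule Least_equality) (use assms spaced_unique in \<open>fastforce+\<close>)
  then show ?thesis using assms unfolding switch_def by auto
qed

lemma switch_translate:
  "switch v (\<lambda>i. s (i + p)) (\<lambda>i. x (i + p)) = (\<lambda>i. switch v s x (i + p))"
  unfolding switch_def by (simp only: diff_add_eq)

lemma switch_cong:
  assumes "\<And>k. k < length v \<Longrightarrow> s (i - int k) = s' (i - int k)" "x i = x' i"
  shows "switch v s x i = switch v s' x' i"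
proof -
  have "(\<lambda>k. k < length v \<and> s (i - int k)) = (\<lambda>k. k < length v \<and> s' (i - int k))"
    using assms by auto
  then show ?thesis unfolding switch_def using assms by metis
qed

locale marked =
  fixes m :: nat and g :: "'a \<Rightarrow> 'b" and u v :: "'a list" and s :: "int \<Rightarrow> bool" and x :: "int \<Rightarrow> 'a"
  assumes swap: "swap_pair m g u v" and spaced: "spaced (length u) s"
    and marks: "\<And>j. s j \<Longrightarrow> block x j (length u) = u"
begin

lemma lengths: "length v = length u" "m \<le> length u"
  using swap by (auto simp: swap_pair_def)

lemma at_mark: "s (i - int k) \<Longrightarrow> k < length u \<Longrightarrow> x i = u ! k \<and> switch v s x i = v ! k"
  using marks[of "i - int k"] nth_block[of k "length u" x "i - int k"] switch_marked[of v s i k x] spaced lengths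
  by auto

lemma switch_at_mark: "s j \<Longrightarrow> block (switch v s x) j (length v) = v"
  using at_mark[of "j + int k" k for k] lengths by (intro nth_equalityI) auto

lemma switch_image: "g (switch v s x i) = g (x i)"
proof (cases "\<exists>k<length v. s (i - int k)")
  case True
  then obtain k where k: "k < length v" "s (i - int k)" by blast
  have "map g u ! k = map g v ! k" using swap unfolding swap_pair_def by simp
  then have "g (u ! k) = g (v ! k)" using k lengths by simp
  then show ?thesis using at_mark[OF k(2)] k lengths by simp
qed (simp add: switch_unmarked)

text \<open>
  The original point is recovered from the new one and the marks; this is how the marks become the
  only loss of information in the case \<open>\<mu>[v] = 0\<close>.
\<close>

lemma switch_back: "switch u s (switch v s x) = x"
proof
  fix i
  show "switch u s (switch v s x) i = x i"
  proof (cases "\<exists>k<length v. s (i - int k)")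
    case True
    then obtain k where k: "k < length v" "s (i - int k)" by blast
    then show ?thesis using at_mark[OF k(2)] lengths switch_marked[OF spaced k(2)] by simp
  next
    case False
    then show ?thesis using switch_unmarked[of v s i x] switch_unmarked[of u s i] lengths by auto
  qed
qed

definition first_difference :: nat where
  "first_difference = (LEAST d. u ! d \<noteq> v ! d)"

lemma first_difference:
  "u ! first_difference \<noteq> v ! first_difference" "first_difference < length u"
  "d < first_difference \<Longrightarrow> u ! d = v ! d"
proof -
  obtain d where d: "d < length u" "u ! d \<noteq> v ! d"
    using swap unfolding swap_pair_def by (metis nth_equalityI)
  show "u ! first_difference \<noteq> v ! first_difference"
    unfolding first_difference_def by (rule LeastI) (rule d(2))
  show "first_difference < length u"
    unfolding first_difference_def using Least_le[of "\<lambda>d. u ! d \<noteq> v ! d"] d le_less_trans by blast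
  show "u ! d = v ! d" if "d < first_difference" for d
    using not_less_Least that unfolding first_difference_def by blast
qed

text \<open>
  Marked words are followed by a gap at least as long as the words themselves. Therefore a
  disagreement that is preceded by agreement on \<open>length u\<close> symbols is the first one in a marked word,
  and the marks can be read off locally from the two points.
\<close>

lemma mark_iff:
  "s j \<longleftrightarrow> switch v s x (j + int first_difference) \<noteq> x (j + int first_difference) \<and>
     (\<forall>k\<in>{1..length u}. switch v s x (j + int first_difference - int k) = x (j + int first_difference - int k))"
  (is "?l \<longleftrightarrow> ?r")
proof
  assume j: "s j"
  have "switch v s x (j + int first_difference) \<noteq> x (j + int first_difference)"
    using at_mark[of "j + int first_difference" first_difference] j first_difference by auto
  moreover have "switch v s x (j + int first_difference - int k) = x (j + int first_difference - int k)"
    if k: "k \<in> {1..length u}" for k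
  proof (cases "k \<le> first_difference")
    case True
    then have "s (j + int first_difference - int k - int (first_difference - k))"
      using j by (simp add: of_nat_diff)
    moreover have "u ! (first_difference - k) = v ! (first_difference - k)"
      using k True by (intro first_difference(3)) auto
    ultimately show ?thesis
      using at_mark[of "j + int first_difference - int k" "first_difference - k"] first_difference(2) by auto
  next
    case False
    show ?thesis
    proof (rule switch_unmarked)
      fix k' assume k': "k' < length v"
      show "\<not> s (j + int first_difference - int k - int k')"
      proof
        assume s: "s (j + int first_difference - int k - int k')"
        then have "j + int first_difference - int k - int k' + 2 * int (length u) \<le> j"
          using spaced[unfolded spaced_def, rule_format, OF s j] False by auto
        then show False using k k' lengths by auto
      qed
    qed
  qed
  ultimately show ?r by blast
next
  assume r: ?r
  then obtain k where k: "k < length v" "s (j + int first_difference - int k)"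
    using switch_unmarked by metis
  have ne: "u ! k \<noteq> v ! k" using r at_mark[OF k(2)] k lengths by auto
  have "k = first_difference"
  proof (rule ccontr)
    assume "k \<noteq> first_difference"
    then have k': "k > first_difference" using first_difference(3)[of k] ne by force
    have "s (j + int first_difference - int (k - first_difference) - int first_difference)"
    proof -
      have "j + int first_difference - int (k - first_difference) - int first_difference
          = j + int first_difference - int k"
        using k' by (simp add: of_nat_diff)
      then show ?thesis using k by metis
    qed
    from at_mark[OF this first_difference(2)] first_difference(1)
    have "switch v s x (j + int first_difference - int (k - first_difference)) \<noteq>
      x (j + int first_difference - int (k - first_difference))" by auto
    moreover have "k - first_difference \<in> {1..length u}" using k k' lengths by auto
    ultimately show False using r by blast
  qed
  then show ?l using k by simp
qed

end

text \<open>
  A window of length \<open>m\<close> either lies inside a marked word, where the new point reads a part of \<open>v\<close>, or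
  it meets the marked words only in the prefixes and suffixes on which \<open>u\<close> and \<open>v\<close> agree.
\<close>

lemma (in sft) switch_mem:
  assumes mk: "marked m g u v s x" and x: "x \<in> X" and v: "v \<in> language X"
  shows "switch v s x \<in> X"
proof (rule mem_if_locally_mem)
  interpret marked m g u v s x by (rule mk)
  fix q
  show "\<exists>y\<in>X. \<forall>i. q \<le> i \<and> i < q + int m \<longrightarrow> switch v s x i = y i"
  proof (cases "\<exists>j. s j \<and> j \<le> q \<and> q + int m \<le> j + int (length v)")
    case True
    then obtain j where j: "s j" "j \<le> q" "q + int m \<le> j + int (length v)" by blast
    obtain y where y: "y \<in> X" "block y 0 (length v) = v" using v language_at_0 by blast
    have "switch v s x i = y (i + - j)" if i: "q \<le> i" "i < q + int m" for i
    proof -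
      define k where "k = nat (i - j)"
      have ik: "int k = i - j" unfolding k_def using i j by simp
      then have k: "k < length v" "s (i - int k)" using i j by simp_all
      have "v ! k = y (i - j)" using nth_block[OF k(1), of y 0] unfolding y(2) ik by simp
      moreover have "switch v s x i = v ! k" using at_mark[OF k(2)] k(1) lengths(1) by simp
      ultimately show ?thesis by simp
    qed
    then show ?thesis
      using translate_mem[OF y(1), of "-j"] by (intro bexI[of _ "\<lambda>i. y (i + - j)"]) simp_all
  next
    case False
    have "switch v s x i = x i" if i: "q \<le> i" "i < q + int m" for i
    proof (cases "\<exists>k<length v. s (i - int k)")
      case True
      then obtain k where k: "k < length v" "s (i - int k)" by blast
      then have "k < m \<or> length u < k + m \<and> k < length u"
      proof -
        have "\<not> (s (i - int k) \<and> i - int k \<le> q \<and> q + int m \<le> i - int k + int (length v))"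
          using False by (rule contrapos_nn) (rule exI)
        then have "\<not> (i - int k \<le> q \<and> q + int m \<le> i - int k + int (length v))"
          using k(2) by simp
        then show ?thesis using i lengths(1) k(1) by linarith
      qed
      then have "u ! k = v ! k" by (rule swap_pair_nth_eq[OF swap])
      then show ?thesis using at_mark[OF k(2)] k(1) lengths(1) by simp
    next
      case False
      then show ?thesis by (intro switch_unmarked) blast
    qed
    then show ?thesis using x by blast
  qed
qed

section \<open>Shannon entropy of finite-valued functions\<close>

definition pr :: "'x measure \<Rightarrow> ('x \<Rightarrow> 'c) \<Rightarrow> 'c \<Rightarrow> real" where
  "pr M X a = measure M (X -` {a} \<inter> space M)"

text \<open>
  Shannon entropy in nats. The functions may take values in any type, so that tuples and lists of
  observables need no encoding.
\<close>

definition ent :: "'x measure \<Rightarrow> ('x \<Rightarrow> 'c) \<Rightarrow> real" where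
  "ent M X = - (\<Sum>a\<in>X ` space M. pr M X a * ln (pr M X a))"

definition cond_ent :: "'x measure \<Rightarrow> ('x \<Rightarrow> 'c) \<Rightarrow> ('x \<Rightarrow> 'd) \<Rightarrow> real" where
  "cond_ent M X Y = ent M (\<lambda>\<omega>. (X \<omega>, Y \<omega>)) - ent M Y"

text \<open>
  \<open>X\<close> is a function of \<open>W\<close>, stated without naming the function.
\<close>

definition determines :: "'x measure \<Rightarrow> ('x \<Rightarrow> 'c) \<Rightarrow> ('x \<Rightarrow> 'd) \<Rightarrow> bool" where
  "determines M W X \<longleftrightarrow> (\<forall>\<omega>\<in>space M. \<forall>\<omega>'\<in>space M. W \<omega> = W \<omega>' \<longrightarrow> X \<omega> = X \<omega>')"

lemma pr_nonneg: "0 \<le> pr M X a"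
  by (simp add: pr_def)

lemma determinesI:
  assumes "\<And>\<omega> \<omega>'. \<omega> \<in> space M \<Longrightarrow> \<omega>' \<in> space M \<Longrightarrow> W \<omega> = W \<omega>' \<Longrightarrow> X \<omega> = X \<omega>'"
  shows "determines M W X"
  using assms unfolding determines_def by blast

lemma determinesD:
  "determines M W X \<Longrightarrow> \<omega> \<in> space M \<Longrightarrow> \<omega>' \<in> space M \<Longrightarrow> W \<omega> = W \<omega>' \<Longrightarrow> X \<omega> = X \<omega>'"
  unfolding determines_def by blast

lemma determines_refl: "determines M W W"
  by (rule determinesI)

lemma determines_trans:
  assumes a: "determines M U W" and b: "determines M W X"
  shows "determines M U X"
  by (rule determinesI) (intro determinesD[OF b] determinesD[OF a])

lemma determines_Pair:
  assumes a: "determines M W X" and b: "determines M W Y"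
  shows "determines M W (\<lambda>\<omega>. (X \<omega>, Y \<omega>))"
  by (rule determinesI) (simp only: prod.inject, intro conjI determinesD[OF a] determinesD[OF b])

lemma determines_fst: "determines M (\<lambda>\<omega>. (X \<omega>, Y \<omega>)) X"
  by (rule determinesI) simp

lemma determines_snd: "determines M (\<lambda>\<omega>. (X \<omega>, Y \<omega>)) Y"
  by (rule determinesI) simp

lemma determines_function:
  assumes "determines M W X"
  shows "\<exists>f. \<forall>\<omega>\<in>space M. X \<omega> = f (W \<omega>)"
proof (intro exI ballI)
  fix \<omega> assume w: "\<omega> \<in> space M"
  have "(SOME \<omega>'. \<omega>' \<in> space M \<and> W \<omega>' = W \<omega>) \<in> space M \<and>
     W (SOME \<omega>'. \<omega>' \<in> space M \<and> W \<omega>' = W \<omega>) = W \<omega>"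
    by (rule someI) (use w in simp)
  then show "X \<omega> = (\<lambda>w. X (SOME \<omega>'. \<omega>' \<in> space M \<and> W \<omega>' = w)) (W \<omega>)"
    using assms w unfolding determines_def by metis
qed

lemma simple_function_determined:
  assumes W: "simple_function M W" and det: "determines M W X"
  shows "simple_function M X"
proof -
  obtain f where f: "\<forall>\<omega>\<in>space M. X \<omega> = f (W \<omega>)" using determines_function[OF det] by blast
  have "simple_function M (\<lambda>\<omega>. f (W \<omega>))"
    using simple_function_compose1[OF W] .
  then show ?thesis using simple_function_cong[of M X] f by auto
qed

context prob_space
begin

lemma pr_sum_fibres:
  assumes W: "simple_function M W" and X: "\<forall>\<omega>\<in>space M. X \<omega> = f (W \<omega>)"
  shows "pr M X a = (\<Sum>w\<in>{w\<in>W ` space M. f w = a}. pr M W w)"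
proof -
  have fin: "finite (W ` space M)" using W by (simp add: simple_functionD)
  have "X -` {a} \<inter> space M = (\<Union>w\<in>{w\<in>W ` space M. f w = a}. W -` {w} \<inter> space M)"
    using X by auto
  also have "prob \<dots> = (\<Sum>w\<in>{w\<in>W ` space M. f w = a}. prob (W -` {w} \<inter> space M))"
    by (rule finite_measure_finite_Union)
       (use fin W in \<open>auto simp: disjoint_family_on_def simple_functionD\<close>)
  finally show ?thesis by (simp add: pr_def)
qed

lemma sum_pr:
  assumes W: "simple_function M W"
  shows "(\<Sum>w\<in>W ` space M. pr M W w) = 1"
  using pr_sum_fibres[OF W, of "\<lambda>_. ()" "\<lambda>_. ()" "()"] prob_space by (simp add: pr_def)

lemma pr_pos_imp_mem: "0 < pr M X a \<Longrightarrow> a \<in> X ` space M"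
proof (rule ccontr)
  assume "0 < pr M X a" "a \<notin> X ` space M"
  moreover from this have "X -` {a} \<inter> space M = {}" by auto
  ultimately show False by (simp add: pr_def)
qed

text \<open>
  Writes the entropy of a function of \<open>W\<close> as an expectation over the values of \<open>W\<close>, so that entropies of
  several functions can be compared term by term.
\<close>

lemma ent_sum_fibres:
  assumes W: "simple_function M W" and X: "\<forall>\<omega>\<in>space M. X \<omega> = f (W \<omega>)"
  shows "ent M X = - (\<Sum>w\<in>W ` space M. pr M W w * ln (pr M X (f w)))"
proof -
  have fin: "finite (W ` space M)" using W by (simp add: simple_functionD)
  have XW: "X ` space M = f ` W ` space M" using X by force
  have "(\<Sum>w\<in>W ` space M. pr M W w * ln (pr M X (f w)))
      = (\<Sum>a\<in>X ` space M. \<Sum>w\<in>{w\<in>W ` space M. f w = a}. pr M W w * ln (pr M X (f w)))"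
    using fin unfolding XW by (intro sum.group[symmetric]) auto
  also have "\<dots> = (\<Sum>a\<in>X ` space M. pr M X a * ln (pr M X a))"
  proof (rule sum.cong[OF refl])
    fix a
    have "(\<Sum>w\<in>{w\<in>W ` space M. f w = a}. pr M W w * ln (pr M X (f w)))
      = (\<Sum>w\<in>{w\<in>W ` space M. f w = a}. pr M W w * ln (pr M X a))"
      by (rule sum.cong) auto
    then show "(\<Sum>w\<in>{w\<in>W ` space M. f w = a}. pr M W w * ln (pr M X (f w))) = pr M X a * ln (pr M X a)"
      unfolding pr_sum_fibres[OF W X] by (simp add: sum_distrib_right)
  qed
  finally show ?thesis by (simp add: ent_def)
qed

lemma pr_le_fibre:
  assumes W: "simple_function M W" and X: "\<forall>\<omega>\<in>space M. X \<omega> = f (W \<omega>)"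
  shows "pr M W w \<le> pr M X (f w)"
proof (cases "w \<in> W ` space M")
  case True
  have "finite (W ` space M)" using W by (simp add: simple_functionD)
  then show ?thesis
    unfolding pr_sum_fibres[OF W X] using True
    by (intro member_le_sum) (auto simp: pr_nonneg)
next
  case False
  then have "pr M W w = 0" using pr_pos_imp_mem pr_nonneg by (metis less_eq_real_def)
  then show ?thesis by (simp add: pr_nonneg)
qed

lemma ent_determined_le:
  assumes W: "simple_function M W" and det: "determines M W X"
  shows "ent M X \<le> ent M W"
proof -
  obtain f where f: "\<forall>\<omega>\<in>space M. X \<omega> = f (W \<omega>)" using determines_function[OF det] by blast
  have "pr M W w * ln (pr M W w) \<le> pr M W w * ln (pr M X (f w))" for w
  proof (cases "pr M W w = 0")
    case False
    then have "0 < pr M W w" using pr_nonneg[of M W w] by simp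
    then show ?thesis using pr_le_fibre[OF W f, of w] by (intro mult_left_mono) auto
  qed simp
  then show ?thesis
    unfolding ent_sum_fibres[OF W f] ent_def[of M W] by (simp add: sum_mono)
qed

lemma ent_eq_if_equivalent:
  assumes "simple_function M W" "determines M W X" "determines M X W"
  shows "ent M X = ent M W"
  using ent_determined_le[of W X] ent_determined_le[of X W] assms simple_function_determined
  by (metis order_antisym)

lemma cond_ent_eq_sum:
  assumes X: "simple_function M X" and Y: "simple_function M Y"
  shows "cond_ent M X Y = (\<Sum>w\<in>(\<lambda>\<omega>. (X \<omega>, Y \<omega>)) ` space M.
     pr M (\<lambda>\<omega>. (X \<omega>, Y \<omega>)) w * (ln (pr M Y (snd w)) - ln (pr M (\<lambda>\<omega>. (X \<omega>, Y \<omega>)) w)))"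
proof -
  have XY: "simple_function M (\<lambda>\<omega>. (X \<omega>, Y \<omega>))" by (rule simple_function_Pair[OF X Y])
  have "ent M Y = - (\<Sum>w\<in>(\<lambda>\<omega>. (X \<omega>, Y \<omega>)) ` space M.
     pr M (\<lambda>\<omega>. (X \<omega>, Y \<omega>)) w * ln (pr M Y (snd w)))"
    by (rule ent_sum_fibres[OF XY]) simp
  then show ?thesis
    unfolding cond_ent_def ent_def[of M "\<lambda>\<omega>. (X \<omega>, Y \<omega>)"]
    by (simp add: right_diff_distrib sum_subtractf)
qed

lemma pr_joint_le: "simple_function M X \<Longrightarrow> simple_function M Y \<Longrightarrow>
    pr M (\<lambda>\<omega>. (X \<omega>, Y \<omega>)) w \<le> pr M Y (snd w)"
  by (rule pr_le_fibre[OF simple_function_Pair]) auto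

text \<open>
  Gibbs' inequality for a subprobability kernel \<open>Q\<close>, a consequence of \<open>ln t \<le> t - 1\<close>. Strong
  subadditivity, Fano's inequality and the bound for a rare event arise from suitable choices of \<open>Q\<close>.
\<close>

lemma cond_ent_gibbs:
  assumes X: "simple_function M X" and Y: "simple_function M Y"
    and Q0: "\<And>x y. 0 \<le> Q x y"
    and Q1: "\<And>y. y \<in> Y ` space M \<Longrightarrow> (\<Sum>x\<in>X ` space M. Q x y) \<le> 1"
    and Qpos: "\<And>x y. 0 < pr M (\<lambda>\<omega>. (X \<omega>, Y \<omega>)) (x, y) \<Longrightarrow> 0 < Q x y"
  shows "cond_ent M X Y \<le> - (\<Sum>w\<in>(\<lambda>\<omega>. (X \<omega>, Y \<omega>)) ` space M.
     pr M (\<lambda>\<omega>. (X \<omega>, Y \<omega>)) w * ln (Q (fst w) (snd w)))"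
proof -
  let ?W = "\<lambda>\<omega>. (X \<omega>, Y \<omega>)"
  let ?S = "?W ` space M"
  have XY: "simple_function M ?W" by (rule simple_function_Pair[OF X Y])
  have fX: "finite (X ` space M)" and fY: "finite (Y ` space M)"
    using X Y by (simp_all add: simple_functionD)
  \<comment> \<open>Multiply \<open>ln t \<le> t - 1\<close> for the likelihood ratio \<open>t\<close> by the probability of \<open>w\<close>.\<close>
  have term_le: "pr M ?W w * (ln (pr M Y (snd w)) - ln (pr M ?W w)) + pr M ?W w * ln (Q (fst w) (snd w))
     \<le> Q (fst w) (snd w) * pr M Y (snd w) - pr M ?W w" for w
  proof (cases "pr M ?W w = 0")
    case True
    then show ?thesis using Q0 by (simp add: pr_nonneg)
  next
    case False
    then have p: "0 < pr M ?W w" using pr_nonneg[of M ?W w] by simp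
    then have y: "0 < pr M Y (snd w)" using pr_joint_le[OF X Y, of w] by simp
    have q: "0 < Q (fst w) (snd w)" using p Qpos by simp
    define t where "t = Q (fst w) (snd w) * pr M Y (snd w) / pr M ?W w"
    have "ln t = ln (Q (fst w) (snd w)) + ln (pr M Y (snd w)) - ln (pr M ?W w)"
      unfolding t_def using p y q by (simp add: ln_mult ln_div)
    moreover have "ln t \<le> t - 1" using p y q by (intro ln_le_minus_one) (simp add: t_def)
    ultimately have "pr M ?W w * (ln (Q (fst w) (snd w)) + ln (pr M Y (snd w)) - ln (pr M ?W w))
       \<le> pr M ?W w * (t - 1)" using p by (intro mult_left_mono) auto
    also have "\<dots> = Q (fst w) (snd w) * pr M Y (snd w) - pr M ?W w"
      unfolding t_def using p by (simp add: field_simps)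
    finally show ?thesis by (simp add: algebra_simps)
  qed
  have "cond_ent M X Y + (\<Sum>w\<in>?S. pr M ?W w * ln (Q (fst w) (snd w)))
     \<le> (\<Sum>w\<in>?S. Q (fst w) (snd w) * pr M Y (snd w) - pr M ?W w)"
    unfolding cond_ent_eq_sum[OF X Y] sum.distrib[symmetric] by (rule sum_mono[OF term_le])
  also have "\<dots> = (\<Sum>w\<in>?S. Q (fst w) (snd w) * pr M Y (snd w)) - 1"
    by (simp add: sum_subtractf sum_pr[OF XY])
  also have "(\<Sum>w\<in>?S. Q (fst w) (snd w) * pr M Y (snd w))
      \<le> (\<Sum>w\<in>X ` space M \<times> Y ` space M. Q (fst w) (snd w) * pr M Y (snd w))"
    by (rule sum_mono2) (use fX fY Q0 in \<open>auto simp: pr_nonneg\<close>)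
  also have "\<dots> = (\<Sum>y\<in>Y ` space M. (\<Sum>x\<in>X ` space M. Q x y) * pr M Y y)"
    by (simp add: sum.cartesian_product' sum.swap[of _ "X ` space M"] sum_distrib_right)
  also have "\<dots> \<le> (\<Sum>y\<in>Y ` space M. 1 * pr M Y y)"
    by (intro sum_mono mult_right_mono Q1) (auto simp: pr_nonneg)
  also have "\<dots> = 1" by (simp add: sum_pr[OF Y])
  finally show ?thesis by simp
qed

text \<open>
  Strong subadditivity: use the conditional distribution of \<open>X\<close> given \<open>Y\<close> as the kernel in Gibbs'
  inequality for \<open>X\<close> given \<open>Y'\<close>.
\<close>

lemma cond_ent_condition_mono:
  assumes X: "simple_function M X" and Y': "simple_function M Y'" and det: "determines M Y' Y"
  shows "cond_ent M X Y' \<le> cond_ent M X Y"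
proof -
  have Y: "simple_function M Y" using simple_function_determined[OF Y' det] .
  obtain f where f: "\<forall>\<omega>\<in>space M. Y \<omega> = f (Y' \<omega>)" using determines_function[OF det] by blast
  let ?W = "\<lambda>\<omega>. (X \<omega>, Y' \<omega>)" and ?V = "\<lambda>\<omega>. (X \<omega>, Y \<omega>)"
  define Q where "Q x y' = pr M ?V (x, f y') / pr M Y (f y')" for x y'
  have VW: "\<forall>\<omega>\<in>space M. ?V \<omega> = (\<lambda>(x, y'). (x, f y')) (?W \<omega>)" using f by simp
  have SW: "simple_function M ?W" and SV: "simple_function M ?V"
    using simple_function_Pair X Y Y' by blast+
  have pos: "0 < pr M ?V (x, f y')" "0 < pr M Y (f y')" if p: "0 < pr M ?W (x, y')" for x y'
  proof -
    show 1: "0 < pr M ?V (x, f y')"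
      using pr_le_fibre[OF SW VW, of "(x, y')"] p by simp
    then show "0 < pr M Y (f y')" using pr_joint_le[OF X Y, of "(x, f y')"] by simp
  qed
  have "cond_ent M X Y' \<le> - (\<Sum>w\<in>?W ` space M. pr M ?W w * ln (Q (fst w) (snd w)))"
  proof (rule cond_ent_gibbs[OF X Y'])
    show "0 \<le> Q x y" for x y by (simp add: Q_def pr_nonneg)
    show "0 < Q x y" if "0 < pr M ?W (x, y)" for x y using pos[OF that] by (simp add: Q_def)
    fix y' assume "y' \<in> Y' ` space M"
    have "(\<Sum>x\<in>X ` space M. pr M ?V (x, f y')) \<le> pr M Y (f y')"
    proof -
      have "(\<Sum>x\<in>X ` space M. pr M ?V (x, f y')) = (\<Sum>w\<in>(\<lambda>x. (x, f y')) ` X ` space M. pr M ?V w)"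
        by (subst sum.reindex) (auto simp: inj_on_def)
      also have "\<dots> = (\<Sum>w\<in>{w \<in> ?V ` space M. snd w = f y'}. pr M ?V w)"
      proof (rule sum.mono_neutral_right)
        show "\<forall>w\<in>(\<lambda>x. (x, f y')) ` X ` space M - {w \<in> ?V ` space M. snd w = f y'}. pr M ?V w = 0"
        proof
          fix w assume "w \<in> (\<lambda>x. (x, f y')) ` X ` space M - {w \<in> ?V ` space M. snd w = f y'}"
          then have "w \<notin> ?V ` space M" by auto
          then show "pr M ?V w = 0" using pr_pos_imp_mem[of ?V w] pr_nonneg[of M ?V w] by fastforce
        qed
      qed (use X in \<open>auto simp: simple_functionD\<close>)
      also have "\<dots> = pr M Y (f y')" by (rule pr_sum_fibres[OF SV, symmetric]) simp
      finally show ?thesis by simp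
    qed
    then show "(\<Sum>x\<in>X ` space M. Q x y') \<le> 1"
      unfolding Q_def sum_divide_distrib[symmetric] using pr_nonneg[of M Y "f y'"]
      by (cases "pr M Y (f y') = 0") (auto simp: divide_le_eq_1)
  qed
  also have "\<dots> = - (\<Sum>w\<in>?W ` space M. pr M ?W w * ln (pr M ?V (fst w, f (snd w))))
      + (\<Sum>w\<in>?W ` space M. pr M ?W w * ln (pr M Y (f (snd w))))"
  proof -
    have "pr M ?W w * ln (Q (fst w) (snd w)) = pr M ?W w * ln (pr M ?V (fst w, f (snd w)))
        - pr M ?W w * ln (pr M Y (f (snd w)))" for w
    proof (cases "pr M ?W w = 0")
      case False
      then have "0 < pr M ?W (fst w, snd w)" using pr_nonneg[of M ?W w] by simp
      from pos[OF this] show ?thesis by (simp add: Q_def ln_div right_diff_distrib)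
    qed simp
    then show ?thesis by (simp add: sum_subtractf)
  qed
  also have "\<dots> = ent M ?V - ent M Y"
  proof -
    have "ent M ?V = - (\<Sum>w\<in>?W ` space M. pr M ?W w * ln (pr M ?V (fst w, f (snd w))))"
      using ent_sum_fibres[OF SW VW] by (simp only: case_prod_unfold)
    moreover have "ent M Y = - (\<Sum>w\<in>?W ` space M. pr M ?W w * ln (pr M Y (f (snd w))))"
      by (rule ent_sum_fibres[OF SW]) (use f in simp)
    ultimately show ?thesis by linarith
  qed
  finally show ?thesis by (simp add: cond_ent_def)
qed

lemma cond_ent_determined_le:
  assumes X': "simple_function M X'" and Y: "simple_function M Y"
    and det: "determines M (\<lambda>\<omega>. (X' \<omega>, Y \<omega>)) X"
  shows "cond_ent M X Y \<le> cond_ent M X' Y"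
proof -
  have "determines M (\<lambda>\<omega>. (X' \<omega>, Y \<omega>)) (\<lambda>\<omega>. (X \<omega>, Y \<omega>))"
    by (rule determines_Pair[OF det determines_snd])
  from ent_determined_le[OF simple_function_Pair[OF X' Y] this] show ?thesis
    unfolding cond_ent_def by linarith
qed

lemma cond_ent_zero:
  assumes Y: "simple_function M Y" and det: "determines M Y X"
  shows "cond_ent M X Y = 0"
proof -
  have "determines M Y (\<lambda>\<omega>. (X \<omega>, Y \<omega>))"
    by (rule determines_Pair[OF det determines_refl])
  moreover have "determines M (\<lambda>\<omega>. (X \<omega>, Y \<omega>)) Y"
    by (rule determines_snd)
  ultimately have "ent M (\<lambda>\<omega>. (X \<omega>, Y \<omega>)) = ent M Y"
    by (rule ent_eq_if_equivalent[OF Y])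
  then show ?thesis by (simp add: cond_ent_def)
qed

lemma cond_ent_chain:
  assumes X: "simple_function M X" and X': "simple_function M X'" and Y: "simple_function M Y"
  shows "cond_ent M (\<lambda>\<omega>. (X \<omega>, X' \<omega>)) Y = cond_ent M X (\<lambda>\<omega>. (X' \<omega>, Y \<omega>)) + cond_ent M X' Y"
proof -
  let ?U = "\<lambda>\<omega>. (X \<omega>, X' \<omega>, Y \<omega>)" and ?V = "\<lambda>\<omega>. ((X \<omega>, X' \<omega>), Y \<omega>)"
  have "simple_function M ?U" by (intro simple_function_Pair X X' Y)
  moreover have "determines M ?U ?V" by (rule determinesI) (simp only: prod.inject)
  moreover have "determines M ?V ?U" by (rule determinesI) (simp only: prod.inject)
  ultimately have "ent M ?V = ent M ?U" by (rule ent_eq_if_equivalent)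
  then show ?thesis by (simp add: cond_ent_def)
qed

lemma cond_ent_subadditive:
  assumes X: "simple_function M X" and X': "simple_function M X'" and Y: "simple_function M Y"
  shows "cond_ent M (\<lambda>\<omega>. (X \<omega>, X' \<omega>)) Y \<le> cond_ent M X Y + cond_ent M X' Y"
  unfolding cond_ent_chain[OF assms]
  using cond_ent_condition_mono[OF X simple_function_Pair[OF X' Y], of Y]
    determines_snd[of M X' Y] by simp

lemma simple_function_map:
  assumes "\<And>i. i \<in> set l \<Longrightarrow> simple_function M (s i)"
  shows "simple_function M (\<lambda>\<omega>. map (\<lambda>i. s i \<omega>) l)"
  using assms
proof (induction l)
  case (Cons a l)
  then have "simple_function M (\<lambda>\<omega>. (s a \<omega>, map (\<lambda>i. s i \<omega>) l))"
    by (intro simple_function_Pair) auto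
  then show ?case
  proof (rule simple_function_determined)
    show "determines M (\<lambda>\<omega>. (s a \<omega>, map (\<lambda>i. s i \<omega>) l)) (\<lambda>\<omega>. map (\<lambda>i. s i \<omega>) (a # l))"
      by (rule determinesI) simp
  qed
qed simp

lemma cond_ent_map_le:
  assumes s: "\<And>i. i \<in> set l \<Longrightarrow> simple_function M (s i)" and Y: "simple_function M Y"
  shows "cond_ent M (\<lambda>\<omega>. map (\<lambda>i. s i \<omega>) l) Y \<le> (\<Sum>i\<leftarrow>l. cond_ent M (s i) Y)"
  using s
proof (induction l)
  case Nil
  have "cond_ent M (\<lambda>\<omega>. map (\<lambda>i. s i \<omega>) []) Y = 0"
    by (rule cond_ent_zero[OF Y]) (simp add: determines_def)
  then show ?case by simp
next
  case (Cons a l)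
  have sl: "simple_function M (\<lambda>\<omega>. map (\<lambda>i. s i \<omega>) l)"
    by (rule simple_function_map) (use Cons in auto)
  have "cond_ent M (\<lambda>\<omega>. map (\<lambda>i. s i \<omega>) (a # l)) Y \<le> cond_ent M (\<lambda>\<omega>. (s a \<omega>, map (\<lambda>i. s i \<omega>) l)) Y"
  proof (rule cond_ent_determined_le[OF _ Y])
    show "simple_function M (\<lambda>\<omega>. (s a \<omega>, map (\<lambda>i. s i \<omega>) l))"
      by (rule simple_function_Pair[OF _ sl]) (use Cons in simp)
    show "determines M (\<lambda>\<omega>. ((s a \<omega>, map (\<lambda>i. s i \<omega>) l), Y \<omega>)) (\<lambda>\<omega>. map (\<lambda>i. s i \<omega>) (a # l))"
      by (rule determinesI) simp
  qed
  also have "\<dots> \<le> cond_ent M (s a) Y + cond_ent M (\<lambda>\<omega>. map (\<lambda>i. s i \<omega>) l) Y"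
    by (rule cond_ent_subadditive) (use Cons sl Y in auto)
  finally show ?case using Cons by simp
qed

lemma cond_ent_le_ent:
  assumes X: "simple_function M X" and Y: "simple_function M Y"
  shows "cond_ent M X Y \<le> ent M X"
proof -
  have "cond_ent M X Y \<le> cond_ent M X (\<lambda>_. ())"
    by (rule cond_ent_condition_mono[OF X Y]) (simp add: determines_def)
  also have "\<dots> = ent M X"
  proof -
    have "ent M (\<lambda>\<omega>. (X \<omega>, ())) = ent M X"
    proof (rule ent_eq_if_equivalent[OF X])
      show "determines M X (\<lambda>\<omega>. (X \<omega>, ()))" by (rule determinesI) simp
      show "determines M (\<lambda>\<omega>. (X \<omega>, ())) X" by (rule determines_fst)
    qed
    moreover have "ent M (\<lambda>_::'a. ()) = 0"
      using prob_space subprob_not_empty by (simp add: ent_def pr_def)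
    ultimately show ?thesis by (simp add: cond_ent_def)
  qed
  finally show ?thesis .
qed

lemma ent_le_ent_plus_cond_ent:
  assumes X: "simple_function M X" and Y: "simple_function M Y"
  shows "ent M X \<le> ent M Y + cond_ent M X Y"
  unfolding cond_ent_def using ent_determined_le[OF simple_function_Pair[OF X Y] determines_fst] by linarith

lemma ent_nonneg: 
  assumes X: "simple_function M X"
  shows "0 \<le> ent M X"
proof -
  have "pr M X a * ln (pr M X a) \<le> 0" for a
  proof (cases "pr M X a = 0")
    case False
    then have "0 < pr M X a" using pr_nonneg[of M X a] by linarith
    moreover have "pr M X a \<le> 1" by (simp add: pr_def)
    ultimately show ?thesis
      using ln_le_minus_one[of "pr M X a"] by (intro mult_nonneg_nonpos) auto
  qed simp
  then show ?thesis unfolding ent_def by (simp add: sum_nonpos)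
qed

text \<open>
  The event \<open>s\<close> has conditional probability at most \<open>\<epsilon>\<close>, so each value of the information
  function on it is at least \<open>ln (1 / \<epsilon>)\<close>.
\<close>

lemma cond_ent_ge_min_entropy:
  fixes s :: "'a \<Rightarrow> bool"
  assumes s: "simple_function M s" and V: "simple_function M V" and \<epsilon>: "0 < \<epsilon>"
    and le: "\<And>v. pr M (\<lambda>\<omega>. (s \<omega>, V \<omega>)) (True, v) \<le> \<epsilon> * pr M V v"
  shows "pr M s True * ln (1 / \<epsilon>) \<le> cond_ent M s V"
proof -
  let ?W = "\<lambda>\<omega>. (s \<omega>, V \<omega>)"
  have SW: "simple_function M ?W" by (rule simple_function_Pair[OF s V])
  have fin: "finite (?W ` space M)" using SW by (simp add: simple_functionD)
  have "pr M s True * ln (1 / \<epsilon>) = (\<Sum>w\<in>{w \<in> ?W ` space M. fst w = True}. pr M ?W w * ln (1 / \<epsilon>))"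
    unfolding pr_sum_fibres[OF SW, of s fst True, simplified] by (simp add: sum_distrib_right)
  also have "\<dots> \<le> (\<Sum>w\<in>{w \<in> ?W ` space M. fst w = True}. pr M ?W w * (ln (pr M V (snd w)) - ln (pr M ?W w)))"
  proof (rule sum_mono)
    fix w assume w: "w \<in> {w \<in> ?W ` space M. fst w = True}"
    show "pr M ?W w * ln (1 / \<epsilon>) \<le> pr M ?W w * (ln (pr M V (snd w)) - ln (pr M ?W w))"
    proof (cases "pr M ?W w = 0")
      case False
      then have p: "0 < pr M ?W w" using pr_nonneg[of M ?W w] by simp
      have l: "pr M ?W w \<le> \<epsilon> * pr M V (snd w)" using le[of "snd w"] w by (metis (mono_tags, lifting) mem_Collect_eq prod.collapse)
      then have q: "0 < pr M V (snd w)" using p \<epsilon> by (smt (verit) zero_less_mult_pos)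
      have "ln (pr M ?W w) \<le> ln (\<epsilon> * pr M V (snd w))" using l p by simp
      then have "ln (1 / \<epsilon>) \<le> ln (pr M V (snd w)) - ln (pr M ?W w)"
        using q \<epsilon> by (simp add: ln_mult ln_div)
      then show ?thesis using p by (intro mult_left_mono) auto
    qed simp
  qed
  also have "\<dots> \<le> (\<Sum>w\<in>?W ` space M. pr M ?W w * (ln (pr M V (snd w)) - ln (pr M ?W w)))"
  proof (rule sum_mono2[OF fin])
    fix w
    show "0 \<le> pr M ?W w * (ln (pr M V (snd w)) - ln (pr M ?W w))"
    proof (cases "pr M ?W w = 0")
      case False
      then have p: "0 < pr M ?W w" using pr_nonneg[of M ?W w] by simp
      then show ?thesis using pr_joint_le[OF s V, of w] by simp
    qed simp
  qed auto
  also have "\<dots> = cond_ent M s V" by (rule cond_ent_eq_sum[OF s V, symmetric])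
  finally show ?thesis .
qed

text \<open>
  If \<open>b\<close> is false then so is \<open>s\<close>; otherwise \<open>s\<close> costs at most one bit.
\<close>

lemma cond_ent_bool_le:
  fixes s b :: "'a \<Rightarrow> bool"
  assumes s: "simple_function M s" and b: "simple_function M b"
    and imp: "\<And>\<omega>. \<omega> \<in> space M \<Longrightarrow> s \<omega> \<Longrightarrow> b \<omega>"
  shows "cond_ent M s b \<le> pr M b True * ln 2"
proof -
  let ?W = "\<lambda>\<omega>. (s \<omega>, b \<omega>)"
  have SW: "simple_function M ?W" by (rule simple_function_Pair[OF s b])
  define Q :: "bool \<Rightarrow> bool \<Rightarrow> real" where "Q x y = (if y then 1 / 2 else if x then 0 else 1)" for x y
  have "cond_ent M s b \<le> - (\<Sum>w\<in>?W ` space M. pr M ?W w * ln (Q (fst w) (snd w)))"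
  proof (rule cond_ent_gibbs[OF s b])
    show "0 \<le> Q x y" for x y by (simp add: Q_def)
    show "0 < Q x y" if "0 < pr M ?W (x, y)" for x y
      using pr_pos_imp_mem[OF that] imp by (auto simp: Q_def)
    fix y
    have "(\<Sum>x\<in>s ` space M. Q x y) \<le> (\<Sum>x\<in>UNIV. Q x y)"
      by (rule sum_mono2) (auto simp: Q_def)
    also have "\<dots> = 1" by (simp add: UNIV_bool Q_def)
    finally show "(\<Sum>x\<in>s ` space M. Q x y) \<le> 1" .
  qed
  also have "\<dots> = (\<Sum>w\<in>?W ` space M. pr M ?W w * (if snd w then ln 2 else 0))"
    unfolding sum_negf[symmetric]
  proof (rule sum.cong[OF refl])
    fix w assume "w \<in> ?W ` space M"
    then show "- (pr M ?W w * ln (Q (fst w) (snd w))) = pr M ?W w * (if snd w then ln 2 else 0)"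
      using imp by (auto simp: Q_def ln_div)
  qed
  also have "\<dots> = (\<Sum>w\<in>{w \<in> ?W ` space M. snd w = True}. pr M ?W w * ln 2)"
  proof -
    have "finite (?W ` space M)" using SW by (simp add: simple_functionD)
    then show ?thesis by (subst sum.inter_filter) (auto intro!: sum.cong)
  qed
  also have "\<dots> = pr M b True * ln 2"
    unfolding pr_sum_fibres[OF SW, of b snd True, simplified] by (simp add: sum_distrib_right)
  finally show ?thesis .
qed

text \<open>
  Fano's inequality. The kernel puts mass \<open>1 - \<delta>\<close> on the guess \<open>Y\<close> and spreads the remaining mass evenly.
\<close>

lemma cond_ent_fano:
  fixes X Y :: "'a \<Rightarrow> 'c"
  assumes X: "simple_function M X" and Y: "simple_function M Y" and \<delta>: "0 < \<delta>" "\<delta> < 1"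
    and k: "card (X ` space M) \<le> k" "0 < k"
    and err: "measure M {\<omega>\<in>space M. X \<omega> \<noteq> Y \<omega>} \<le> \<delta>"
  shows "cond_ent M X Y \<le> - ln (1 - \<delta>) + \<delta> * ln (k / \<delta>)"
proof -
  let ?W = "\<lambda>\<omega>. (X \<omega>, Y \<omega>)"
  let ?S = "?W ` space M"
  have SW: "simple_function M ?W" by (rule simple_function_Pair[OF X Y])
  have fin: "finite ?S" "finite (X ` space M)" using SW X by (simp_all add: simple_functionD)
  define Q where "Q x y = (if x = y then 1 - \<delta> else \<delta> / k)" for x y :: 'c
  have lk: "0 \<le> ln (k / \<delta>)" using k \<delta> by (simp add: ln_div)
  have l1: "0 \<le> - ln (1 - \<delta>)" using \<delta> by simp
  have "cond_ent M X Y \<le> - (\<Sum>w\<in>?S. pr M ?W w * ln (Q (fst w) (snd w)))"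
  proof (rule cond_ent_gibbs[OF X Y])
    show "0 \<le> Q x y" for x y using \<delta> by (simp add: Q_def)
    show "0 < Q x y" if "0 < pr M ?W (x, y)" for x y using \<delta> k by (simp add: Q_def)
    fix y
    have "(\<Sum>x\<in>X ` space M. Q x y) \<le> (\<Sum>x\<in>X ` space M. (if x = y then 1 - \<delta> else 0) + \<delta> / k)"
      using \<delta> by (intro sum_mono) (simp add: Q_def)
    also have "\<dots> \<le> (1 - \<delta>) + real (card (X ` space M)) * (\<delta> / k)"
      using \<delta> fin by (simp add: sum.distrib sum.delta)
    also have "\<dots> \<le> (1 - \<delta>) + real k * (\<delta> / k)"
      using k \<delta> by (intro add_left_mono mult_right_mono) auto
    also have "\<dots> = 1" using k by simp
    finally show "(\<Sum>x\<in>X ` space M. Q x y) \<le> 1" .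
  qed
  also have "\<dots> = (\<Sum>w\<in>?S. pr M ?W w * (if fst w = snd w then - ln (1 - \<delta>) else ln (k / \<delta>)))"
    unfolding sum_negf[symmetric]
    by (rule sum.cong) (use \<delta> k in \<open>auto simp: Q_def ln_div right_diff_distrib\<close>)
  also have "\<dots> \<le> (\<Sum>w\<in>?S. pr M ?W w * (- ln (1 - \<delta>)) + (if (fst w \<noteq> snd w) = True then pr M ?W w * ln (k / \<delta>) else 0))"
    using l1 by (intro sum_mono) (auto simp: pr_nonneg mult_le_0_iff)
  also have "\<dots> = - ln (1 - \<delta>) + (\<Sum>w\<in>{w\<in>?S. (fst w \<noteq> snd w) = True}. pr M ?W w * ln (k / \<delta>))"
  proof -
    have "(\<Sum>w\<in>?S. pr M ?W w * (- ln (1 - \<delta>))) = - ln (1 - \<delta>)"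
      by (simp only: sum_distrib_right[symmetric] sum_pr[OF SW] mult_1_left)
    then show ?thesis by (simp only: sum.distrib sum.inter_filter[OF fin(1)])
  qed
  also have "(\<Sum>w\<in>{w\<in>?S. (fst w \<noteq> snd w) = True}. pr M ?W w * ln (k / \<delta>))
     = pr M (\<lambda>\<omega>. X \<omega> \<noteq> Y \<omega>) True * ln (k / \<delta>)"
  proof -
    have "pr M (\<lambda>\<omega>. X \<omega> \<noteq> Y \<omega>) True = (\<Sum>w\<in>{w\<in>?S. (fst w \<noteq> snd w) = True}. pr M ?W w)"
      by (rule pr_sum_fibres[OF SW]) simp
    then show ?thesis by (simp only: sum_distrib_right)
  qed
  also have "\<dots> \<le> \<delta> * ln (k / \<delta>)"
  proof (rule mult_right_mono[OF _ lk])
    have "(\<lambda>\<omega>. X \<omega> \<noteq> Y \<omega>) -` {True} \<inter> space M = {\<omega>\<in>space M. X \<omega> \<noteq> Y \<omega>}" by auto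
    then show "pr M (\<lambda>\<omega>. X \<omega> \<noteq> Y \<omega>) True \<le> \<delta>" using err by (simp add: pr_def)
  qed
  finally show ?thesis by simp
qed

end

section \<open>Entropy rates of measure-preserving systems\<close>

text \<open>
  Fekete's lemma: the quotients converge to their infimum.
\<close>

lemma fekete:
  fixes a :: "nat \<Rightarrow> real"
  assumes sub: "\<And>m n. a (m + n) \<le> a m + a n" and nonneg: "\<And>n. 0 \<le> a n"
  shows "convergent (\<lambda>n. a n / real n)"
proof -
  define L where "L = (INF n\<in>{1..}. a n / real n)"
  have bdd: "bdd_below ((\<lambda>n. a n / real n) ` {1..})"
    by (rule bdd_belowI[of _ 0]) (use nonneg in auto)
  have ge: "L \<le> a n / real n" if "n \<ge> 1" for n
    unfolding L_def by (rule cINF_lower[OF bdd]) (use that in simp)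
  have mult: "a (q * k) \<le> a 0 + real q * a k" for q k
  proof (induction q)
    case (Suc q)
    then show ?case using sub[of k "q * k"] by (simp add: algebra_simps)
  qed simp
  have "(\<lambda>n. a n / real n) \<longlonglongrightarrow> L"
  proof (rule LIMSEQ_I)
    fix \<delta> :: real assume \<delta>: "0 < \<delta>"
    have "\<exists>k\<in>{1..}. a k / real k < L + \<delta> / 2"
      using cINF_less_iff[OF _ bdd, of "L + \<delta> / 2"] \<delta> by (simp add: L_def)
    then obtain k where k: "k \<ge> 1" "a k / real k < L + \<delta> / 2" by auto
    define C where "C = a 0 + (\<Sum>r<k. a r)"
    have C: "0 \<le> C" unfolding C_def using nonneg by (simp add: sum_nonneg)
    obtain N where N: "real N > 2 * C / \<delta>" using reals_Archimedean2 by blast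
    have "norm (a n / real n - L) < \<delta>" if n: "n \<ge> max 1 N" for n
    proof -
      have "a n \<le> a ((n div k) * k) + a (n mod k)"
        using sub[of "n div k * k" "n mod k"] by simp
      also have "a (n mod k) \<le> (\<Sum>r<k. a r)"
        using k nonneg by (intro member_le_sum) auto
      also have "a ((n div k) * k) \<le> a 0 + real (n div k) * a k" by (rule mult)
      finally have 1: "a n \<le> real (n div k) * a k + C" by (simp add: C_def)
      have "real (n div k) * a k = real (n div k * k) * (a k / real k)" using k by simp
      also have "\<dots> \<le> real n * (a k / real k)"
      proof (rule mult_right_mono)
        show "real (n div k * k) \<le> real n" by (simp only: of_nat_le_iff div_times_less_eq_dividend)
      qed (simp add: nonneg)
      finally have "a n \<le> real n * (a k / real k) + C" using 1 by simp
      then have "a n / real n \<le> (real n * (a k / real k) + C) / real n"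
        using n by (intro divide_right_mono) auto
      also have "\<dots> = a k / real k + C / real n" using n by (simp add: add_divide_distrib)
      also have "C / real n < \<delta> / 2"
      proof -
        have "2 * C / \<delta> < real n" using N n by (meson less_le_trans max.boundedE of_nat_le_iff)
        then show ?thesis using \<delta> n by (simp add: field_simps)
      qed
      finally have "a n / real n < L + \<delta>" using k by simp
      moreover have "L \<le> a n / real n" using ge n by simp
      ultimately show ?thesis by simp
    qed
    then show "\<exists>no. \<forall>n\<ge>no. norm (a n / real n - L) < \<delta>" by blast
  qed
  then show ?thesis by (rule convergentI)
qed

definition itinerary :: "('x \<Rightarrow> 'x) \<Rightarrow> ('x \<Rightarrow> 'c) \<Rightarrow> nat \<Rightarrow> 'x \<Rightarrow> 'c list" where
  "itinerary T q n \<omega> = map (\<lambda>i. q ((T ^^ i) \<omega>)) [0..<n]"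

lemma itinerary_eq_iff: "itinerary T q n \<omega> = itinerary T q n \<omega>' \<longleftrightarrow> (\<forall>i<n. q ((T ^^ i) \<omega>) = q ((T ^^ i) \<omega>'))"
  by (auto simp: itinerary_def)

lemma measurable_iterate: "T \<in> measurable M M \<Longrightarrow> T ^^ n \<in> measurable M M"
  by (induction n) (auto simp: measurable_comp)

lemma distr_iterate:
  assumes "T \<in> measurable M M" "distr M M T = M"
  shows "distr M M (T ^^ n) = M"
proof (induction n)
  case 0
  then show ?case by (simp add: id_def distr_id2)
next
  case (Suc n)
  have "distr M M (T \<circ> (T ^^ n)) = distr (distr M M (T ^^ n)) M T"
    by (rule distr_distr[symmetric]) (use assms measurable_iterate in auto)
  then show ?case using Suc assms by (simp add: comp_def)
qed

lemma pr_distr: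
  assumes T: "T \<in> measurable N M" "distr N M T = M" and X: "simple_function M X"
  shows "pr N (\<lambda>\<omega>. X (T \<omega>)) a = pr M X a"
proof -
  have "pr M X a = measure (distr N M T) (X -` {a} \<inter> space M)" using T(2) by (simp add: pr_def)
  also have "\<dots> = measure N (T -` (X -` {a} \<inter> space M) \<inter> space N)"
    by (rule measure_distr[OF T(1)]) (use X in \<open>simp add: simple_functionD\<close>)
  also have "T -` (X -` {a} \<inter> space M) \<inter> space N = (\<lambda>\<omega>. X (T \<omega>)) -` {a} \<inter> space N"
    using measurable_space[OF T(1)] by auto
  finally show ?thesis by (simp add: pr_def)
qed

lemma simple_function_measure_preserving:
  assumes T: "T \<in> measurable N M" and X: "simple_function M X"
  shows "simple_function N (\<lambda>\<omega>. X (T \<omega>))"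
proof -
  have "X \<in> measurable M (count_space UNIV)" "finite (X ` space M)"
    using X by (auto simp: simple_function_eq_measurable)
  moreover have "(\<lambda>\<omega>. X (T \<omega>)) ` space N \<subseteq> X ` space M" using measurable_space[OF T] by auto
  ultimately show ?thesis
    unfolding simple_function_eq_measurable using measurable_compose[OF T] finite_subset by blast
qed

lemma ent_distr:
  assumes T: "T \<in> measurable N M" "distr N M T = M" and X: "simple_function M X"
  shows "ent N (\<lambda>\<omega>. X (T \<omega>)) = ent M X"
proof -
  have "(\<Sum>a\<in>(\<lambda>\<omega>. X (T \<omega>)) ` space N. pr N (\<lambda>\<omega>. X (T \<omega>)) a * ln (pr N (\<lambda>\<omega>. X (T \<omega>)) a))
     = (\<Sum>a\<in>X ` space M. pr N (\<lambda>\<omega>. X (T \<omega>)) a * ln (pr N (\<lambda>\<omega>. X (T \<omega>)) a))"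
  proof (rule sum.mono_neutral_left)
    show "finite (X ` space M)" using X by (simp add: simple_functionD)
    show "(\<lambda>\<omega>. X (T \<omega>)) ` space N \<subseteq> X ` space M" using measurable_space[OF T(1)] by auto
    show "\<forall>a\<in>X ` space M - (\<lambda>\<omega>. X (T \<omega>)) ` space N.
       pr N (\<lambda>\<omega>. X (T \<omega>)) a * ln (pr N (\<lambda>\<omega>. X (T \<omega>)) a) = 0"
    proof
      fix a assume "a \<in> X ` space M - (\<lambda>\<omega>. X (T \<omega>)) ` space N"
      then have "X (T \<omega>) \<noteq> a" if "\<omega> \<in> space N" for \<omega> using that by blast
      then have "(\<lambda>\<omega>. X (T \<omega>)) -` {a} \<inter> space N = {}" by auto
      then show "pr N (\<lambda>\<omega>. X (T \<omega>)) a * ln (pr N (\<lambda>\<omega>. X (T \<omega>)) a) = 0" by (simp add: pr_def)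
    qed
  qed
  then show ?thesis unfolding ent_def using pr_distr[OF assms] by simp
qed

lemma partition_entropy_fibres:
  "partition_entropy M ((\<lambda>a. X -` {a} \<inter> space M) ` X ` space M) = ent M X"
proof -
  have "inj_on (\<lambda>a. X -` {a} \<inter> space M) (X ` space M)" by (rule inj_onI) auto
  then show ?thesis by (simp add: partition_entropy_def ent_def pr_def sum.reindex)
qed

locale measure_preserving_system = prob_space M for M :: "'x measure" +
  fixes T :: "'x \<Rightarrow> 'x"
  assumes T_measurable: "T \<in> measurable M M" and T_distr: "distr M M T = M"
begin

lemma iterate_in_space: "\<omega> \<in> space M \<Longrightarrow> (T ^^ n) \<omega> \<in> space M"
  using measurable_space[OF measurable_iterate[OF T_measurable]] .

lemma simple_function_iterate: "simple_function M q \<Longrightarrow> simple_function M (\<lambda>\<omega>. q ((T ^^ i) \<omega>))"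
  using simple_function_measure_preserving measurable_iterate[OF T_measurable] by blast

lemma simple_function_itinerary: "simple_function M q \<Longrightarrow> simple_function M (itinerary T q n)"
  unfolding itinerary_def by (rule simple_function_map) (rule simple_function_iterate)

lemma ent_iterate: "simple_function M q \<Longrightarrow> ent M (\<lambda>\<omega>. q ((T ^^ i) \<omega>)) = ent M q"
  by (rule ent_distr[OF measurable_iterate[OF T_measurable] distr_iterate[OF T_measurable T_distr]])

lemma cond_ent_iterate:
  assumes "simple_function M p" "simple_function M q"
  shows "cond_ent M (\<lambda>\<omega>. p ((T ^^ i) \<omega>)) (\<lambda>\<omega>. q ((T ^^ i) \<omega>)) = cond_ent M p q"
  unfolding cond_ent_def
  using ent_iterate[OF simple_function_Pair[OF assms], of i] ent_iterate[OF assms(2), of i] by simp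

lemma itinerary_add:
  "itinerary T q (m + n) \<omega> = itinerary T q m \<omega> @ itinerary T q n ((T ^^ m) \<omega>)"
proof -
  have "(T ^^ i) ((T ^^ m) \<omega>) = (T ^^ (m + i)) \<omega>" for i
    by (simp add: funpow_add[symmetric] add.commute flip: comp_apply[of "T ^^ i"])
  then show ?thesis
    by (intro nth_equalityI) (auto simp: itinerary_def nth_append)
qed

lemma ent_itinerary_subadditive:
  assumes q: "simple_function M q"
  shows "ent M (itinerary T q (m + n)) \<le> ent M (itinerary T q m) + ent M (itinerary T q n)"
proof -
  let ?A = "itinerary T q m" and ?B = "\<lambda>\<omega>. itinerary T q n ((T ^^ m) \<omega>)"
  have A: "simple_function M ?A" by (rule simple_function_itinerary[OF q])
  have B: "simple_function M ?B" by (rule simple_function_iterate[OF simple_function_itinerary[OF q]])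
  have "ent M (itinerary T q (m + n)) \<le> ent M (\<lambda>\<omega>. (?B \<omega>, ?A \<omega>))"
    by (rule ent_determined_le[OF simple_function_Pair[OF B A]])
       (rule determinesI, simp add: itinerary_add)
  also have "\<dots> = ent M ?A + cond_ent M ?B ?A" by (simp add: cond_ent_def)
  also have "\<dots> \<le> ent M ?A + ent M ?B" using cond_ent_le_ent[OF B A] by simp
  also have "ent M ?B = ent M (itinerary T q n)" by (rule ent_iterate[OF simple_function_itinerary[OF q]])
  finally show ?thesis .
qed

lemma entropy_rate_convergent:
  assumes q: "simple_function M q"
  shows "convergent (\<lambda>n. ent M (itinerary T q n) / real n)"
  using ent_itinerary_subadditive[OF q] ent_nonneg[OF simple_function_itinerary[OF q]] by (rule fekete)

text \<open>
  Replacing one observable by another costs at most one conditional entropy per unit of time, by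
  subadditivity and stationarity.
\<close>

lemma ent_itinerary_le:
  assumes p: "simple_function M p" and q: "simple_function M q"
  shows "ent M (itinerary T p n) \<le> ent M (itinerary T q n) + real n * cond_ent M p q"
proof -
  have Q: "simple_function M (itinerary T q n)" by (rule simple_function_itinerary[OF q])
  have "ent M (itinerary T p n) \<le> ent M (itinerary T q n) + cond_ent M (itinerary T p n) (itinerary T q n)"
    by (rule ent_le_ent_plus_cond_ent[OF simple_function_itinerary[OF p] Q])
  also have "cond_ent M (itinerary T p n) (itinerary T q n)
     \<le> (\<Sum>i\<leftarrow>[0..<n]. cond_ent M (\<lambda>\<omega>. p ((T ^^ i) \<omega>)) (itinerary T q n))"
    unfolding itinerary_def[of T p, abs_def]
    by (rule cond_ent_map_le[OF simple_function_iterate[OF p] Q])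
  also have "\<dots> \<le> (\<Sum>i\<leftarrow>[0..<n]. cond_ent M p q)"
  proof (rule sum_list_mono)
    fix i assume i: "i \<in> set [0..<n]"
    have "cond_ent M (\<lambda>\<omega>. p ((T ^^ i) \<omega>)) (itinerary T q n) \<le> cond_ent M (\<lambda>\<omega>. p ((T ^^ i) \<omega>)) (\<lambda>\<omega>. q ((T ^^ i) \<omega>))"
    proof (rule cond_ent_condition_mono[OF simple_function_iterate[OF p] Q])
      show "determines M (itinerary T q n) (\<lambda>\<omega>. q ((T ^^ i) \<omega>))"
        by (rule determinesI) (use i in \<open>simp add: itinerary_eq_iff\<close>)
    qed
    also have "\<dots> = cond_ent M p q" by (rule cond_ent_iterate[OF p q])
    finally show "cond_ent M (\<lambda>\<omega>. p ((T ^^ i) \<omega>)) (itinerary T q n) \<le> cond_ent M p q" .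
  qed
  also have "\<dots> = real n * cond_ent M p q" by (simp add: sum_list_triv)
  finally show ?thesis by simp
qed

definition cell_of :: "'x set set \<Rightarrow> 'x \<Rightarrow> 'x set" where
  "cell_of P \<omega> = (THE A. A \<in> P \<and> \<omega> \<in> A)"

lemma cell_of:
  assumes "partition_on (space M) P" "\<omega> \<in> space M"
  shows "cell_of P \<omega> \<in> P" "\<omega> \<in> cell_of P \<omega>"
    and "A \<in> P \<Longrightarrow> \<omega> \<in> A \<longleftrightarrow> A = cell_of P \<omega>"
proof -
  have "\<omega> \<in> \<Union> P" using assms by (simp add: partition_on_def)
  then obtain B where B: "B \<in> P" "\<omega> \<in> B" by (rule UnionE)
  have dis: "A = B" if "A \<in> P" "\<omega> \<in> A" for A
    using partition_onD2[OF assms(1)] B that unfolding disjoint_def by (metis IntI empty_iff)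
  have ex1: "\<exists>!A. A \<in> P \<and> \<omega> \<in> A"
  proof (rule ex1I[of _ B])
    show "B \<in> P \<and> \<omega> \<in> B" using B by simp
    show "A = B" if "A \<in> P \<and> \<omega> \<in> A" for A using that dis[of A] by (elim conjE)
  qed
  then have *: "cell_of P \<omega> \<in> P \<and> \<omega> \<in> cell_of P \<omega>"
    unfolding cell_of_def by (rule theI')
  then show "cell_of P \<omega> \<in> P" "\<omega> \<in> cell_of P \<omega>" by auto
  show "\<omega> \<in> A \<longleftrightarrow> A = cell_of P \<omega>" if A: "A \<in> P"
  proof
    assume "\<omega> \<in> A"
    then have "A = B" by (rule dis[OF A])
    moreover have "cell_of P \<omega> = B" using * by (intro dis) simp_all
    ultimately show "A = cell_of P \<omega>" by simp
  next
    assume "A = cell_of P \<omega>"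
    then show "\<omega> \<in> A" using * by simp
  qed
qed

lemma simple_function_cell_of:
  assumes "finite_partition M P"
  shows "simple_function M (cell_of P)"
proof -
  have P: "finite P" "P \<subseteq> sets M" "partition_on (space M) P"
    using assms by (auto simp: finite_partition_def)
  have im: "cell_of P ` space M \<subseteq> P" by (rule image_subsetI) (rule cell_of(1)[OF P(3)])
  have "cell_of P -` {A} \<inter> space M \<in> sets M" if "A \<in> cell_of P ` space M" for A
  proof -
    have A: "A \<in> P" using im that by (rule subsetD)
    then have "A \<in> sets M" using P(2) by (rule subsetD[rotated])
    then have "A \<subseteq> space M" by (rule sets.sets_into_space)
    moreover have "\<omega> \<in> cell_of P -` {A} \<longleftrightarrow> \<omega> \<in> A" if "\<omega> \<in> space M" for \<omega>
      using cell_of(3)[OF P(3) that A] by (metis vimage_singleton_eq)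
    ultimately have "cell_of P -` {A} \<inter> space M = A" by blast
    then show ?thesis using \<open>A \<in> sets M\<close> by simp
  qed
  moreover have "finite (cell_of P ` space M)" using im P(1) by (rule finite_subset)
  ultimately show ?thesis unfolding simple_function_def by blast
qed

text \<open>
  The cells of the iterated partition are the sets of points with a common itinerary.
\<close>

lemma iterated_partition_eq:
  assumes P: "partition_on (space M) P" and n: "0 < n"
  shows "iterated_partition M T P n =
    (\<lambda>a. itinerary T (cell_of P) n -` {a} \<inter> space M) ` itinerary T (cell_of P) n ` space M" (is "_ = ?R")
proof -
  let ?N = "itinerary T (cell_of P) n"
  let ?Q = "\<lambda>i. pullback_partition M (T ^^ i) P"
  let ?c = "\<lambda>i \<omega>. {\<omega>'\<in>space M. cell_of P ((T ^^ i) \<omega>') = cell_of P ((T ^^ i) \<omega>)}"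
  have cellQ: "B = ?c i \<omega>" if B: "B \<in> ?Q i" "\<omega> \<in> B" for B i \<omega>
  proof -
    obtain A where A: "A \<in> P" "B = (T ^^ i) -` A \<inter> space M"
      using B(1) unfolding pullback_partition_def by auto
    then have "(T ^^ i) \<omega> \<in> A" "\<omega> \<in> space M" using B(2) by auto
    then have "A = cell_of P ((T ^^ i) \<omega>)" using cell_of(3)[OF P iterate_in_space A(1)] by blast
    moreover have "(T ^^ i) \<omega>' \<in> A \<longleftrightarrow> A = cell_of P ((T ^^ i) \<omega>')" if "\<omega>' \<in> space M" for \<omega>'
      using cell_of(3)[OF P iterate_in_space[OF that] A(1)] .
    ultimately show ?thesis using A(2) by auto
  qed
  have cQ: "?c i \<omega> \<in> ?Q i" "\<omega> \<in> ?c i \<omega>" if w: "\<omega> \<in> space M" for i \<omega>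
  proof -
    let ?A = "cell_of P ((T ^^ i) \<omega>)"
    have A: "?A \<in> P" by (rule cell_of(1)[OF P iterate_in_space[OF w]])
    have "(T ^^ i) \<omega>' \<in> ?A \<longleftrightarrow> ?A = cell_of P ((T ^^ i) \<omega>')" if "\<omega>' \<in> space M" for \<omega>'
      using cell_of(3)[OF P iterate_in_space[OF that] A] .
    then have "?c i \<omega> = (T ^^ i) -` ?A \<inter> space M" by auto
    moreover show "\<omega> \<in> ?c i \<omega>" using w by simp
    ultimately show "?c i \<omega> \<in> ?Q i" unfolding pullback_partition_def using A by blast
  qed
  have fib: "?N -` {?N \<omega>} \<inter> space M = (\<Inter>i\<in>{..<n}. ?c i \<omega>)" for \<omega>
    using n by (auto simp: itinerary_eq_iff)
  show ?thesis
  proof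
    show "iterated_partition M T P n \<subseteq> ?R"
    proof
      fix C assume "C \<in> iterated_partition M T P n"
      then obtain f where f: "f \<in> (\<Pi>\<^sub>E Q\<in>?Q ` {..<n}. Q)" "C = \<Inter> (f ` ?Q ` {..<n})" "C \<noteq> {}"
        unfolding iterated_partition_def common_refinement_def by auto
      then obtain \<omega> where w: "\<omega> \<in> C" by blast
      have "f (?Q i) = ?c i \<omega>" if "i < n" for i
      proof (rule cellQ)
        show "f (?Q i) \<in> ?Q i" using f(1) that by (auto simp: PiE_iff)
        show "\<omega> \<in> f (?Q i)" using w f(2) that by auto
      qed
      then have "C = (\<Inter>i\<in>{..<n}. ?c i \<omega>)" unfolding f(2) by simp
      then have C: "C = ?N -` {?N \<omega>} \<inter> space M" using fib by simp
      then have "\<omega> \<in> space M" using w by auto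
      then show "C \<in> ?R" using C by blast
    qed
    show "?R \<subseteq> iterated_partition M T P n"
    proof
      fix C assume "C \<in> ?R"
      then obtain \<omega> where w: "\<omega> \<in> space M" "C = ?N -` {?N \<omega>} \<inter> space M" by blast
      define f where "f = restrict (\<lambda>Q. THE B. B \<in> Q \<and> \<omega> \<in> B) (?Q ` {..<n})"
      have fQ: "f (?Q i) = ?c i \<omega>" if "i < n" for i
      proof -
        have "(THE B. B \<in> ?Q i \<and> \<omega> \<in> B) = ?c i \<omega>"
          by (rule the_equality) (use cQ[OF w(1)] cellQ in blast)+
        then show ?thesis unfolding f_def using that by simp
      qed
      have "f \<in> (\<Pi>\<^sub>E Q\<in>?Q ` {..<n}. Q)"
        unfolding PiE_iff using fQ cQ[OF w(1)] by (auto simp: f_def)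
      moreover have "\<Inter> (f ` ?Q ` {..<n}) = C" unfolding w(2) fib using fQ by simp
      moreover have "C \<noteq> {}" using w by auto
      ultimately show "C \<in> iterated_partition M T P n"
        unfolding iterated_partition_def common_refinement_def by blast
    qed
  qed
qed

lemma entropy_wrt_partition_eq:
  assumes "finite_partition M P"
  shows "entropy_wrt_partition M T P = lim (\<lambda>n. ent M (itinerary T (cell_of P) n) / real n)"
proof -
  have P: "partition_on (space M) P" using assms by (simp add: finite_partition_def)
  have "partition_entropy M (iterated_partition M T P n) / real n = ent M (itinerary T (cell_of P) n) / real n" for n
  proof (cases "n = 0")
    case False
    then show ?thesis
      using iterated_partition_eq[OF P, of n] partition_entropy_fibres[of M "itinerary T (cell_of P) n"]
      by (simp only: neq0_conv)
  qed simp
  then have "(\<lambda>n. partition_entropy M (iterated_partition M T P n) / real n) =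
     (\<lambda>n. ent M (itinerary T (cell_of P) n) / real n)" by (rule ext)
  then show ?thesis unfolding entropy_wrt_partition_def by (rule arg_cong)
qed

end

section \<open>Approximation by finite windows\<close>

lemma open_coordinate: "open {x :: int \<Rightarrow> 'a::discrete_topology. x i \<in> A}"
proof -
  have "open {x :: int \<Rightarrow> 'a. \<forall>j\<in>{i}. x j \<in> A}"
    by (rule product_topology_basis') (simp_all add: discrete_topology_class.open_discrete)
  then show ?thesis by simp
qed

lemma open_window:
  fixes S :: "(int \<Rightarrow> 'a::discrete_topology) set"
  assumes "open S" "x \<in> S"
  shows "\<exists>k::nat. \<forall>y. (\<forall>i. \<bar>i\<bar> \<le> int k \<longrightarrow> y i = x i) \<longrightarrow> y \<in> S"
proof -
  have "openin (product_topology (\<lambda>i. euclidean) UNIV) S" using assms(1) by (simp add: open_fun_def)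
  from product_topology_open_contains_basis[OF this assms(2)]
  obtain U where U: "x \<in> (\<Pi>\<^sub>E i\<in>UNIV. U i)" "finite {i. U i \<noteq> UNIV}" "(\<Pi>\<^sub>E i\<in>UNIV. U i) \<subseteq> S"
    by auto
  define k where "k = Max (insert 0 ((\<lambda>i. nat \<bar>i\<bar>) ` {i. U i \<noteq> UNIV}))"
  have "y \<in> S" if y: "\<forall>i. \<bar>i\<bar> \<le> int k \<longrightarrow> y i = x i" for y
  proof -
    have "y i \<in> U i" for i
    proof (cases "U i = UNIV")
      case False
      then have "nat \<bar>i\<bar> \<le> k" unfolding k_def using U(2) by (intro Max_ge) auto
      then have "y i = x i" using y by auto
      then show ?thesis using U(1) by (auto simp: PiE_iff)
    qed simp
    then show ?thesis using U(3) by (auto simp: PiE_iff)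
  qed
  then show ?thesis by blast
qed

definition window :: "nat \<Rightarrow> (int \<Rightarrow> 'a) \<Rightarrow> 'a list" where
  "window k x = block x (- int k) (2 * k + 1)"

lemma window_eq_iff: "window k x = window k y \<longleftrightarrow> (\<forall>i. \<bar>i\<bar> \<le> int k \<longrightarrow> x i = y i)"
  unfolding window_def block_same_eq_iff by (auto simp: abs_le_iff)

text \<open>
  Open sets of sequences are countable unions of cylinders, because the alphabet is finite.
\<close>

lemma measurable_sequence:
  fixes F :: "'x \<Rightarrow> int \<Rightarrow> 'a::{finite,discrete_topology}"
  assumes sets: "sets M = sets (restrict_space borel X)" and FX: "\<And>\<omega>. \<omega> \<in> space N \<Longrightarrow> F \<omega> \<in> X"
    and coord: "\<And>i a. {\<omega>\<in>space N. F \<omega> i = a} \<in> sets N"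
  shows "F \<in> measurable N M"
proof -
  have "F \<in> borel_measurable N"
  proof (rule borel_measurableI)
    fix S :: "(int \<Rightarrow> 'a) set" assume S: "open S"
    define C where "C k w = {x :: int \<Rightarrow> 'a. window k x = w}" for k w
    have Cmeas: "F -` C k w \<inter> space N \<in> sets N" for k w
    proof -
      have "C k w = {x. length w = 2 * k + 1 \<and> (\<forall>j<2 * k + 1. x (- int k + int j) = w ! j)}"
        unfolding C_def window_def by (auto simp: list_eq_iff_nth_eq)
      then have "F -` C k w \<inter> space N = (if length w = 2 * k + 1
         then space N \<inter> (\<Inter>j\<in>{..<2 * k + 1}. {\<omega>\<in>space N. F \<omega> (- int k + int j) = w ! j}) else {})"
        by auto
      also have "\<dots> \<in> sets N"
        using coord by (auto intro!: sets.Int sets.finite_INT)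
      finally show ?thesis .
    qed
    have "S = (\<Union>(k, w)\<in>{(k, w). C k w \<subseteq> S}. C k w)"
    proof
      show "S \<subseteq> (\<Union>(k, w)\<in>{(k, w). C k w \<subseteq> S}. C k w)"
      proof
        fix x assume x: "x \<in> S"
        then obtain k where "\<forall>y. (\<forall>i. \<bar>i\<bar> \<le> int k \<longrightarrow> y i = x i) \<longrightarrow> y \<in> S" using open_window[OF S] by blast
        then have "C k (window k x) \<subseteq> S" unfolding C_def window_eq_iff by auto
        moreover have "x \<in> C k (window k x)" by (simp add: C_def)
        ultimately show "x \<in> (\<Union>(k, w)\<in>{(k, w). C k w \<subseteq> S}. C k w)" by blast
      qed
    qed auto
    then have "F -` S \<inter> space N = (\<Union>(k, w)\<in>{(k, w). C k w \<subseteq> S}. F -` C k w \<inter> space N)" by blast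
    also have "\<dots> \<in> sets N"
      by (rule sets.countable_UN') (use Cmeas in \<open>auto simp: countable_subset[OF subset_UNIV]\<close>)
    finally show "F -` S \<inter> space N \<in> sets N" .
  qed
  then have "F \<in> measurable N (restrict_space borel X)"
    by (rule measurable_restrict_space2[rotated]) (use FX in auto)
  then show ?thesis unfolding measurable_cong_sets[OF refl sets] .
qed

locale sequence_measure = prob_space M for M :: "(int \<Rightarrow> 'a::{finite,discrete_topology}) measure" +
  fixes X :: "(int \<Rightarrow> 'a) set"
  assumes sets_M: "sets M = sets (restrict_space borel X)"
begin

lemma space_M: "space M = X"
  using sets_eq_imp_space_eq[OF sets_M] by (simp add: space_restrict_space)

lemma coordinate_sets: "{x\<in>X. x i \<in> A} \<in> sets M"
proof -
  have "{x\<in>X. x i \<in> A} = X \<inter> {x. x i \<in> A}" by auto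
  moreover have "X \<inter> {x. x i \<in> A} \<in> sets (restrict_space borel X)"
    unfolding sets_restrict_space using open_coordinate[of i A] by (intro imageI) auto
  ultimately show ?thesis by (simp add: sets_M)
qed

lemma simple_function_coordinate: "simple_function M (\<lambda>x. x i)"
proof -
  have "(\<lambda>x. x i) -` {a} \<inter> space M = {x\<in>X. x i \<in> {a}}" for a by (auto simp: space_M)
  then have "(\<lambda>x. x i) -` {a} \<inter> space M \<in> sets M" for a using coordinate_sets[of i "{a}"] by simp
  then show ?thesis unfolding simple_function_def by simp
qed

lemma simple_function_block: "simple_function M (\<lambda>x. block x i n)"
  unfolding block_def by (rule simple_function_map) (rule simple_function_coordinate)

lemma simple_function_window: "simple_function M (window k)"
  unfolding window_def by (rule simple_function_block)

lemma window_sets: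
  assumes "determines M (window k) (\<lambda>x. x \<in> B)" "B \<subseteq> X"
  shows "B \<in> sets M"
proof -
  have "simple_function M (\<lambda>x. x \<in> B)" by (rule simple_function_determined[OF simple_function_window assms(1)])
  then have "(\<lambda>x. x \<in> B) -` {True} \<inter> space M \<in> sets M" by (rule simple_functionD)
  moreover have "(\<lambda>x. x \<in> B) -` {True} \<inter> space M = B" using assms(2) by (auto simp: space_M)
  ultimately show ?thesis by simp
qed

lemma determines_window_mono: "k \<le> l \<Longrightarrow> determines M (window l) (window k)"
  by (rule determinesI) (auto simp: window_eq_iff)

text \<open>
  The sets that can be approximated by events depending on finitely many coordinates form a
  sigma-algebra containing the coordinate events, so the identity is measurable with respect to it.
\<close>

lemma window_approximation:
  assumes "A \<in> sets M" "0 < \<delta>"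
  shows "\<exists>B k. B \<subseteq> X \<and> determines M (window k) (\<lambda>x. x \<in> B) \<and> measure M ((A - B) \<union> (B - A)) < \<delta>"
proof -
  define ok where "ok A \<delta> \<longleftrightarrow> (\<exists>B k. B \<subseteq> X \<and> determines M (window k) (\<lambda>x. x \<in> B) \<and>
     measure M ((A - B) \<union> (B - A)) < \<delta>)" for A \<delta>
  define \<A> where "\<A> = {A \<in> sets M. \<forall>\<delta>>0. ok A \<delta>}"
  have okI: "ok A \<delta>" if "B \<subseteq> X" "determines M (window k) (\<lambda>x. x \<in> B)" "measure M ((A - B) \<union> (B - A)) < \<delta>"
    for A B k \<delta> using that unfolding ok_def by blast
  have sa: "sigma_algebra X \<A>"
    unfolding sigma_algebra_iff2
  proof (intro conjI ballI allI impI)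
    show "\<A> \<subseteq> Pow X" unfolding \<A>_def using sets.sets_into_space space_M by auto
    have "ok {} \<delta>" if "0 < \<delta>" for \<delta>
    proof (rule okI[of "{}" 0])
      show "determines M (window 0) (\<lambda>x. x \<in> {})" by (rule determinesI) simp
    qed (use that in simp_all)
    then show "{} \<in> \<A>" by (simp add: \<A>_def)
  next
    fix A assume A: "A \<in> \<A>"
    have "ok (X - A) \<delta>" if \<delta>: "0 < \<delta>" for \<delta>
    proof -
      obtain B k where B: "B \<subseteq> X" "determines M (window k) (\<lambda>x. x \<in> B)" "measure M ((A - B) \<union> (B - A)) < \<delta>"
      proof -
        have "ok A \<delta>" using A \<delta> by (simp add: \<A>_def)
        then show thesis unfolding ok_def by (elim exE conjE) (rule that)
      qed
      have "A \<in> sets M" using A by (simp add: \<A>_def)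
      then have "A \<subseteq> X" unfolding space_M[symmetric] by (rule sets.sets_into_space)
      then have "((X - A) - (X - B)) \<union> ((X - B) - (X - A)) = (A - B) \<union> (B - A)" using B(1) by auto
      moreover have "determines M (window k) (\<lambda>x. x \<in> X - B)"
      proof (rule determinesI)
        fix x y assume xy: "x \<in> space M" "y \<in> space M" "window k x = window k y"
        have "(x \<in> B) = (y \<in> B)" using B(2) xy unfolding determines_def by blast
        then show "(x \<in> X - B) = (y \<in> X - B)" using xy by (simp add: space_M)
      qed
      ultimately show ?thesis using B(3) unfolding ok_def
        by (intro exI[of _ "X - B"] exI[of _ k]) simp
    qed
    moreover have "X - A \<in> sets M" using A sets.compl_sets[of A M] by (simp add: \<A>_def space_M)
    ultimately show "X - A \<in> \<A>" by (simp add: \<A>_def)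
  next
    fix A :: "nat \<Rightarrow> (int \<Rightarrow> 'a) set" assume "range A \<subseteq> \<A>"
    then have "A i \<in> \<A>" for i by blast
    then have A: "A i \<in> sets M" "0 < \<delta> \<Longrightarrow> ok (A i) \<delta>" for i \<delta> by (simp_all add: \<A>_def)
    have "ok (\<Union>i. A i) \<delta>" if \<delta>: "0 < \<delta>" for \<delta>
    proof -
      have "(\<lambda>n. measure M (\<Union>i<n. A i)) \<longlonglongrightarrow> measure M (\<Union>n. \<Union>i<n. A i)"
      proof (rule finite_Lim_measure_incseq)
        show "incseq (\<lambda>n. \<Union>i<n. A i)"
          unfolding incseq_def by (intro allI impI UN_mono) auto
      qed (use A(1) in blast)
      moreover have "(\<Union>n. \<Union>i<n. A i) = (\<Union>i. A i)" by auto
      ultimately obtain n where n: "dist (measure M (\<Union>i<n. A i)) (measure M (\<Union>i. A i)) < \<delta> / 2"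
        using \<delta> metric_LIMSEQ_D[of _ "measure M (\<Union>i. A i)" "\<delta> / 2"] by fastforce
      have "0 < \<delta> / (2 * real (Suc n))" using \<delta> by simp
      then have "\<forall>i. \<exists>B k. B \<subseteq> X \<and> determines M (window k) (\<lambda>x. x \<in> B) \<and>
         measure M ((A i - B) \<union> (B - A i)) < \<delta> / (2 * real (Suc n))" using A(2)[unfolded ok_def] by simp
      then obtain B k where B: "\<And>i. B i \<subseteq> X" "\<And>i. determines M (window (k i)) (\<lambda>x. x \<in> B i)"
         "\<And>i. measure M ((A i - B i) \<union> (B i - A i)) < \<delta> / (2 * real (Suc n))" by metis
      have Bs: "B i \<in> sets M" for i by (rule window_sets[OF B(2,1)])
      define l where "l = Max (insert 0 (k ` {..<n}))"
      let ?B = "\<Union>i<n. B i"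
      have "determines M (window l) (\<lambda>x. x \<in> ?B)"
      proof (rule determinesI)
        fix x y assume xy: "x \<in> space M" "y \<in> space M" "window l x = window l y"
        have "x \<in> B i \<longleftrightarrow> y \<in> B i" if i: "i < n" for i
        proof -
          have "k i \<le> l" unfolding l_def using i by (intro Max_ge) auto
          then have "determines M (window l) (\<lambda>x. x \<in> B i)"
            by (rule determines_trans[OF determines_window_mono B(2)])
          then show ?thesis using xy unfolding determines_def by blast
        qed
        then show "(x \<in> ?B) = (y \<in> ?B)" by auto
      qed
      moreover have "measure M (((\<Union>i. A i) - ?B) \<union> (?B - (\<Union>i. A i))) < \<delta>"
      proof -
        let ?D = "\<lambda>i. (A i - B i) \<union> (B i - A i)"
        have "((\<Union>i. A i) - ?B) \<union> (?B - (\<Union>i. A i)) \<subseteq> ((\<Union>i. A i) - (\<Union>i<n. A i)) \<union> (\<Union>i<n. ?D i)" by auto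
        then have "measure M (((\<Union>i. A i) - ?B) \<union> (?B - (\<Union>i. A i)))
            \<le> measure M (((\<Union>i. A i) - (\<Union>i<n. A i)) \<union> (\<Union>i<n. ?D i))"
          by (rule finite_measure_mono) (use A(1) Bs in auto)
        also have "\<dots> \<le> measure M ((\<Union>i. A i) - (\<Union>i<n. A i)) + measure M (\<Union>i<n. ?D i)"
          by (rule measure_Un_le) (use A(1) Bs in auto)
        also have "measure M ((\<Union>i. A i) - (\<Union>i<n. A i)) = measure M (\<Union>i. A i) - measure M (\<Union>i<n. A i)"
          by (rule finite_measure_Diff) (use A(1) in auto)
        also have "\<dots> < \<delta> / 2" using n unfolding dist_real_def by linarith
        also have "measure M (\<Union>i<n. ?D i) \<le> (\<Sum>i<n. measure M (?D i))"
          by (rule finite_measure_subadditive_finite) (use A(1) Bs in auto)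
        also have "\<dots> \<le> (\<Sum>i<n. \<delta> / (2 * real (Suc n)))" by (intro sum_mono less_imp_le B(3))
        also have "\<dots> \<le> \<delta> / 2" using \<delta> by (simp add: field_simps)
        finally show ?thesis by simp
      qed
      moreover have "?B \<subseteq> X" using B(1) by blast
      ultimately show ?thesis unfolding ok_def by blast
    qed
    moreover have "(\<Union>i. A i) \<in> sets M" using A(1) by auto
    ultimately show "(\<Union>i. A i) \<in> \<A>" by (simp add: \<A>_def)
  qed
  interpret sa: sigma_algebra X \<A> by (rule sa)
  define N where "N = measure_of X \<A> (\<lambda>_. 0)"
  have N: "sets N = \<A>" "space N = X" unfolding N_def by (simp_all add: space_measure_of_conv)
  have "(\<lambda>x. x) \<in> measurable N M"
  proof (rule measurable_sequence[OF sets_M])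
    show "x \<in> X" if "x \<in> space N" for x using that N by simp
    fix i a
    have C: "{x\<in>X. x i = a} \<in> sets M" using coordinate_sets[of i "{a}"] by simp
    have "ok {x\<in>X. x i = a} \<delta>" if "0 < \<delta>" for \<delta>
    proof (rule okI[of "{x\<in>X. x i = a}" "nat \<bar>i\<bar>"])
      show "determines M (window (nat \<bar>i\<bar>)) (\<lambda>x. x \<in> {x\<in>X. x i = a})"
        by (rule determinesI) (simp add: window_eq_iff space_M)
    qed (use that in auto)
    then show "{x\<in>space N. x i = a} \<in> sets N" using C N by (simp add: \<A>_def)
  qed
  then have "(\<lambda>x. x) -` A \<inter> space N \<in> sets N" using assms(1) by (rule measurable_sets)
  moreover have "(\<lambda>x. x) -` A \<inter> space N = A"
    using sets.sets_into_space[OF assms(1)] N by (auto simp: space_M)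
  ultimately have "A \<in> \<A>" using N by simp
  then have "ok A \<delta>" using assms(2) by (simp add: \<A>_def)
  then show ?thesis by (simp only: ok_def)
qed

text \<open>
  Approximate the level sets of \<open>p\<close> separately and let \<open>p'\<close> choose a value whose approximating set contains
  the point; the two functions differ only where an approximation fails.
\<close>

lemma simple_function_window_approximation:
  assumes p: "simple_function M p" and \<delta>: "0 < \<delta>"
  shows "\<exists>p' k. determines M (window k) p' \<and> measure M {x\<in>space M. p x \<noteq> p' x} \<le> \<delta>"
proof -
  let ?I = "p ` space M"
  have fin: "finite ?I" using p by (simp add: simple_functionD)
  define n where "n = Suc (card ?I)"
  have pm: "p -` {a} \<inter> space M \<in> sets M" for a using p by (simp add: simple_functionD)
  have "0 < \<delta> / real n" using \<delta> by (simp add: n_def)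
  then have "\<forall>a. \<exists>B k. B \<subseteq> X \<and> determines M (window k) (\<lambda>x. x \<in> B) \<and>
      measure M ((p -` {a} \<inter> space M - B) \<union> (B - p -` {a} \<inter> space M)) < \<delta> / real n"
    using window_approximation[OF pm] by blast
  then obtain B k where B: "\<And>a. B a \<subseteq> X" "\<And>a. determines M (window (k a)) (\<lambda>x. x \<in> B a)"
    "\<And>a. measure M ((p -` {a} \<inter> space M - B a) \<union> (B a - p -` {a} \<inter> space M)) < \<delta> / real n"
    by metis
  have Bs: "B a \<in> sets M" for a by (rule window_sets[OF B(2,1)])
  define l where "l = Max (insert 0 (k ` ?I))"
  define p' where "p' x = (SOME a. a \<in> ?I \<and> x \<in> B a)" for x
  have "determines M (window l) p'"
  proof (rule determinesI)
    fix x y assume xy: "x \<in> space M" "y \<in> space M" "window l x = window l y"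
    have "x \<in> B a \<longleftrightarrow> y \<in> B a" if a: "a \<in> ?I" for a
    proof -
      have "k a \<le> l" unfolding l_def using a fin by (intro Max_ge) auto
      then have "determines M (window l) (\<lambda>x. x \<in> B a)"
        by (rule determines_trans[OF determines_window_mono B(2)])
      then show ?thesis using xy unfolding determines_def by blast
    qed
    then have "(\<lambda>a. a \<in> ?I \<and> x \<in> B a) = (\<lambda>a. a \<in> ?I \<and> y \<in> B a)" by blast
    then show "p' x = p' y" unfolding p'_def by simp
  qed
  moreover have "measure M {x\<in>space M. p x \<noteq> p' x} \<le> \<delta>"
  proof -
    let ?D = "\<lambda>a. (p -` {a} \<inter> space M - B a) \<union> (B a - p -` {a} \<inter> space M)"
    have Dm: "?D a \<in> sets M" for a using pm Bs by auto
    have "{x\<in>space M. p x \<noteq> p' x} \<subseteq> (\<Union>a\<in>?I. ?D a)"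
    proof
      fix x assume x: "x \<in> {x\<in>space M. p x \<noteq> p' x}"
      show "x \<in> (\<Union>a\<in>?I. ?D a)"
      proof (rule ccontr)
        assume c: "x \<notin> (\<Union>a\<in>?I. ?D a)"
        have iff: "x \<in> B a \<longleftrightarrow> p x = a" if "a \<in> ?I" for a using c x that by blast
        then have "p' x = p x" unfolding p'_def using x by (intro some_equality) auto
        then show False using x by simp
      qed
    qed
    then have "measure M {x\<in>space M. p x \<noteq> p' x} \<le> measure M (\<Union>a\<in>?I. ?D a)"
      by (rule finite_measure_mono) (rule sets.finite_UN[OF fin Dm])
    also have "\<dots> \<le> (\<Sum>a\<in>?I. measure M (?D a))"
      by (rule finite_measure_subadditive_finite[OF fin]) (use Dm in blast)
    also have "\<dots> \<le> (\<Sum>a\<in>?I. \<delta> / real n)" by (intro sum_mono less_imp_le B(3))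
    also have "\<dots> \<le> \<delta>" using \<delta> by (simp add: n_def field_simps)
    finally show ?thesis .
  qed
  ultimately show ?thesis by blast
qed

end

section \<open>The entropy of a shift-invariant measure as a block entropy rate\<close>

locale shift_measure = sequence_measure +
  assumes shift_closed: "\<And>x. x \<in> X \<Longrightarrow> shift x \<in> X" and shift_distr: "distr M M shift = M"

lemma (in shift_measure) shift_measurable: "shift \<in> measurable M M"
proof (rule measurable_sequence[OF sets_M])
  show "shift x \<in> X" if "x \<in> space M" for x using that shift_closed by (simp add: space_M)
  show "{x \<in> space M. shift x i = a} \<in> sets M" for i a
    using coordinate_sets[of "i + 1" "{a}"] by (simp add: space_M shift_def)
qed

sublocale shift_measure \<subseteq> measure_preserving_system M shift
  by unfold_locales (rule shift_measurable, rule shift_distr)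

context shift_measure
begin

definition block_entropy :: "nat \<Rightarrow> real" where
  "block_entropy n = ent M (\<lambda>x. block x 0 n)"

definition entropy_rate :: real where
  "entropy_rate = lim (\<lambda>n. block_entropy n / real n)"

lemma itinerary_coordinate: "itinerary shift (\<lambda>x. x 0) n = (\<lambda>x. block x 0 n)"
  by (rule ext) (simp add: itinerary_def block_def shift_funpow)

lemma block_entropy_limit: "(\<lambda>n. block_entropy n / real n) \<longlonglongrightarrow> entropy_rate"
  using entropy_rate_convergent[OF simple_function_coordinate[of 0]]
  unfolding itinerary_coordinate convergent_LIMSEQ_iff block_entropy_def entropy_rate_def .

lemma simple_function_block_image: "simple_function M (\<lambda>x. f (block x i n))"
  using simple_function_compose[OF simple_function_block, of f] by (simp add: comp_def)

lemma
  shows ent_block_image: "ent M (\<lambda>x. f (block x i n)) = ent M (\<lambda>x. f (block x 0 n))"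
    and pr_block_image: "pr M (\<lambda>x. f (block x i n)) a = pr M (\<lambda>x. f (block x 0 n)) a"
proof -
  have shifted: "block ((shift ^^ k) x) j n = block x (j + int k) n" for x :: "int \<Rightarrow> 'a" and k j
    unfolding shift_funpow by (rule block_translate)
  have *: "ent M (\<lambda>x. f (block x (j + int k) n)) = ent M (\<lambda>x. f (block x j n))"
     "pr M (\<lambda>x. f (block x (j + int k) n)) a = pr M (\<lambda>x. f (block x j n)) a" for j k
    using ent_iterate[OF simple_function_block_image[of f j n], of k]
      pr_distr[OF measurable_iterate[OF shift_measurable] distr_iterate[OF shift_measurable shift_distr]
        simple_function_block_image[of f j n], of k a]
    by (simp_all add: shifted)
  show "ent M (\<lambda>x. f (block x i n)) = ent M (\<lambda>x. f (block x 0 n))"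
    "pr M (\<lambda>x. f (block x i n)) a = pr M (\<lambda>x. f (block x 0 n)) a"
    using *(1)[of 0 "nat i"] *(1)[of i "nat (- i)"] *(2)[of 0 "nat i"] *(2)[of i "nat (- i)"]
    by (cases "0 \<le> i"; simp)+
qed

lemma ent_block: "ent M (\<lambda>x. block x i n) = block_entropy n"
  unfolding block_entropy_def by (rule ent_block_image)

lemma block_entropy_offset_limit: "(\<lambda>n. block_entropy (n + k) / real n) \<longlonglongrightarrow> entropy_rate"
proof -
  have "(\<lambda>n. block_entropy (n + k) / real (n + k) * (real (n + k) / real n)) \<longlonglongrightarrow> entropy_rate * 1"
  proof (rule tendsto_mult)
    show "(\<lambda>n. block_entropy (n + k) / real (n + k)) \<longlonglongrightarrow> entropy_rate"
      using LIMSEQ_ignore_initial_segment[OF block_entropy_limit] .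
    show "(\<lambda>n. real (n + k) / real n) \<longlonglongrightarrow> 1" by real_asymp
  qed
  moreover have "\<forall>\<^sub>F n in sequentially. block_entropy (n + k) / real (n + k) * (real (n + k) / real n)
     = block_entropy (n + k) / real n"
    using eventually_gt_at_top[of 0] by eventually_elim simp
  ultimately show ?thesis unfolding mult_1_right by (rule Lim_transform_eventually)
qed

text \<open>
  Approximate \<open>q\<close> by a function of a finite window: its itineraries of length \<open>n\<close> are determined by a
  block of length \<open>n + 2 * k + 1\<close>, and Fano's inequality bounds the error. Then let \<open>\<delta>\<close> tend to \<open>0\<close>.
\<close>

lemma itinerary_rate_le:
  assumes q: "simple_function M q"
  shows "lim (\<lambda>n. ent M (itinerary shift q n) / real n) \<le> entropy_rate"
proof -
  let ?h = "lim (\<lambda>n. ent M (itinerary shift q n) / real n)"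
  define K where "K = Suc (card (q ` space M))"
  let ?\<phi> = "\<lambda>\<delta>. - ln (1 - \<delta>) + \<delta> * ln (real K / \<delta>)"
  have le: "?h \<le> entropy_rate + ?\<phi> \<delta>" if \<delta>: "0 < \<delta>" "\<delta> < 1" for \<delta>
  proof -
    obtain p k where p: "determines M (window k) p" "measure M {x\<in>space M. q x \<noteq> p x} \<le> \<delta>"
      using simple_function_window_approximation[OF q \<delta>(1)] by blast
    have sp: "simple_function M p" by (rule simple_function_determined[OF simple_function_window p(1)])
    have c: "cond_ent M q p \<le> ?\<phi> \<delta>"
      by (rule cond_ent_fano[OF q sp \<delta>]) (use p(2) in \<open>simp_all add: K_def\<close>)
    have "ent M (itinerary shift q n) \<le> block_entropy (n + (2 * k + 1)) + real n * ?\<phi> \<delta>" for n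
    proof -
      have "ent M (itinerary shift p n) \<le> ent M (\<lambda>x. block x (- int k) (n + (2 * k + 1)))"
      proof (rule ent_determined_le[OF simple_function_block], rule determinesI)
        fix x y assume xy: "x \<in> space M" "y \<in> space M"
          "block x (- int k) (n + (2 * k + 1)) = block y (- int k) (n + (2 * k + 1))"
        have "p ((shift ^^ i) x) = p ((shift ^^ i) y)" if i: "i < n" for i
        proof (rule determinesD[OF p(1)])
          show "(shift ^^ i) x \<in> space M" "(shift ^^ i) y \<in> space M" using iterate_in_space xy by auto
          show "window k ((shift ^^ i) x) = window k ((shift ^^ i) y)"
            unfolding window_eq_iff shift_funpow
          proof (intro allI impI)
            fix j assume "\<bar>j\<bar> \<le> int k"
            then show "x (j + int i) = y (j + int i)"
              using xy(3)[unfolded block_same_eq_iff, rule_format, of "j + int i"] i by linarith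
          qed
        qed
        then show "itinerary shift p n x = itinerary shift p n y" by (simp add: itinerary_eq_iff)
      qed
      also have "\<dots> = block_entropy (n + (2 * k + 1))" by (rule ent_block)
      finally have "ent M (itinerary shift q n) \<le> block_entropy (n + (2 * k + 1)) + real n * cond_ent M q p"
        using ent_itinerary_le[OF q sp, of n] by linarith
      also have "real n * cond_ent M q p \<le> real n * ?\<phi> \<delta>" by (rule mult_left_mono[OF c]) simp
      finally show ?thesis by simp
    qed
    then have pos: "ent M (itinerary shift q n) / real n
        \<le> block_entropy (n + (2 * k + 1)) / real n + ?\<phi> \<delta>" if "n > 0" for n
      using that divide_right_mono[of "ent M (itinerary shift q n)" _ "real n"]
      by (simp add: field_simps)
    have "\<forall>\<^sub>F n in sequentially. ent M (itinerary shift q n) / real n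
        \<le> block_entropy (n + (2 * k + 1)) / real n + ?\<phi> \<delta>"
      by (rule eventually_mono[OF eventually_gt_at_top[of 0]]) (rule pos)
    moreover have "(\<lambda>n. block_entropy (n + (2 * k + 1)) / real n + ?\<phi> \<delta>) \<longlonglongrightarrow> entropy_rate + ?\<phi> \<delta>"
      by (intro tendsto_intros block_entropy_offset_limit)
    moreover have "(\<lambda>n. ent M (itinerary shift q n) / real n) \<longlonglongrightarrow> ?h"
      using entropy_rate_convergent[OF q] by (simp only: convergent_LIMSEQ_iff)
    ultimately show ?thesis
      by (intro tendsto_le[of sequentially _ "entropy_rate + ?\<phi> \<delta>"]) auto
  qed
  have "((\<lambda>\<delta>. entropy_rate + ?\<phi> \<delta>) \<longlongrightarrow> entropy_rate) (at_right 0)"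
  proof -
    have K: "real K > 0" by (simp add: K_def)
    then have "(?\<phi> \<longlongrightarrow> 0) (at_right 0)" by real_asymp
    then show ?thesis using tendsto_add[OF tendsto_const[of entropy_rate]] by fastforce
  qed
  moreover have "\<forall>\<^sub>F \<delta> in at_right 0. ?h \<le> entropy_rate + ?\<phi> \<delta>"
    using le by (auto simp: eventually_at_right_field intro!: exI[of _ 1])
  ultimately show ?thesis by (intro tendsto_lowerbound) auto
qed

text \<open>
  The generator theorem of Kolmogorov and Sinai for the partition by the zeroth coordinate.
\<close>

theorem shift_entropy_eq: "shift_entropy M = ereal entropy_rate"
proof (rule antisym)
  show "shift_entropy M \<le> ereal entropy_rate"
    unfolding ks_entropy_def
  proof (rule SUP_least)
    fix P assume "P \<in> {P. finite_partition M P}"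
    then have P: "finite_partition M P" by simp
    show "ereal (entropy_wrt_partition M shift P) \<le> ereal entropy_rate"
      unfolding entropy_wrt_partition_eq[OF P] ereal_less_eq
      by (rule itinerary_rate_le[OF simple_function_cell_of[OF P]])
  qed
  define P where "P = (\<lambda>a. (\<lambda>x. x 0) -` {a} \<inter> space M) ` (\<lambda>x. x 0) ` space M"
  have P: "finite_partition M P"
    unfolding finite_partition_def
  proof (intro conjI)
    show "finite P" unfolding P_def
      using simple_functionD(1)[OF simple_function_coordinate[of 0]] by (rule finite_imageI)
    show "P \<subseteq> sets M"
      unfolding P_def using simple_functionD(2)[OF simple_function_coordinate[of 0]] by auto
    show "partition_on (space M) P"
      unfolding P_def partition_on_def disjoint_def by auto
  qed
  have cell: "cell_of P x = (\<lambda>x. x 0) -` {x 0} \<inter> space M" if x: "x \<in> space M" for x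
  proof -
    have "(\<lambda>x. x 0) -` {x 0} \<inter> space M \<in> P" unfolding P_def using x by blast
    then show ?thesis
      using cell_of(3)[of P x "(\<lambda>x. x 0) -` {x 0} \<inter> space M"] P x
      unfolding finite_partition_def by simp
  qed
  have "ent M (itinerary shift (cell_of P) n) = block_entropy n" for n
  proof -
    have "cell_of P x = cell_of P y \<longleftrightarrow> x 0 = y 0" if "x \<in> space M" "y \<in> space M" for x y
      using cell that by auto
    then have eq: "itinerary shift (cell_of P) n x = itinerary shift (cell_of P) n y
        \<longleftrightarrow> itinerary shift (\<lambda>x. x 0) n x = itinerary shift (\<lambda>x. x 0) n y"
      if "x \<in> space M" "y \<in> space M" for x y
      using that iterate_in_space unfolding itinerary_eq_iff by blast
    have "ent M (itinerary shift (cell_of P) n) = ent M (itinerary shift (\<lambda>x. x 0) n)"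
      by (rule ent_eq_if_equivalent[OF simple_function_itinerary[OF simple_function_coordinate]])
         (rule determinesI, simp add: eq)+
    then show ?thesis unfolding itinerary_coordinate block_entropy_def .
  qed
  then have "entropy_wrt_partition M shift P = entropy_rate"
    unfolding entropy_wrt_partition_eq[OF P] entropy_rate_def by simp
  then show "ereal entropy_rate \<le> shift_entropy M"
    unfolding ks_entropy_def using P by (intro SUP_upper2[of P]) auto
qed

end

section \<open>The random perturbation of an invariant measure\<close>

lemma block_eq_subblock:
  assumes "block x i n = block y i n" "i \<le> j" "j + int k \<le> i + int n"
  shows "block x j k = block y j k"
  unfolding block_same_eq_iff
proof (intro allI impI)
  fix t assume "j \<le> t \<and> t < j + int k"
  then show "x t = y t"
    using assms(1)[unfolded block_same_eq_iff, rule_format, of t] assms(2,3) by linarith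
qed

definition coin_flips :: "real \<Rightarrow> (int \<Rightarrow> bool) measure" where
  "coin_flips \<epsilon> = PiM UNIV (\<lambda>_. measure_pmf (bernoulli_pmf \<epsilon>))"

lemma space_coin_flips [simp]: "space (coin_flips \<epsilon>) = UNIV"
  by (simp add: coin_flips_def space_PiM)

lemma prob_space_coin_flips: "prob_space (coin_flips \<epsilon>)"
  unfolding coin_flips_def by (rule prob_space_PiM) (rule prob_space_measure_pmf)

lemma coin_measurable: "(\<lambda>r. r i) \<in> measurable (coin_flips \<epsilon>) (count_space UNIV)"
proof -
  have "(\<lambda>r. r i) \<in> measurable (coin_flips \<epsilon>) (measure_pmf (bernoulli_pmf \<epsilon>))"
    unfolding coin_flips_def by (rule measurable_component_singleton) simp
  then show ?thesis by simp
qed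

lemma coin_pattern_eq: "{r. \<forall>i\<in>J. r i = b i} = (\<Inter>i\<in>J. (\<lambda>r. r i) -` {b i} \<inter> space (coin_flips \<epsilon>))"
  by auto

lemma coin_pattern_sets: 
  assumes "finite J"
  shows "{r. \<forall>i\<in>J. r i = b i} \<in> sets (coin_flips \<epsilon>)"
proof -
  have coin: "(\<lambda>r. r i) -` {b i} \<inter> space (coin_flips \<epsilon>) \<in> sets (coin_flips \<epsilon>)" for i
    by (rule measurable_sets[OF coin_measurable]) simp
  have "space (coin_flips \<epsilon>) \<inter> (\<Inter>i\<in>J. (\<lambda>r. r i) -` {b i} \<inter> space (coin_flips \<epsilon>)) \<in> sets (coin_flips \<epsilon>)"
  proof (cases "J = {}")
    case True
    then show ?thesis using sets.top[of "coin_flips \<epsilon>"] by simp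
  next
    case False
    have "(\<Inter>i\<in>J. (\<lambda>r. r i) -` {b i} \<inter> space (coin_flips \<epsilon>)) \<in> sets (coin_flips \<epsilon>)"
      by (rule sets.finite_INT[OF assms False]) (rule coin)
    then show ?thesis by (rule sets.Int[OF sets.top])
  qed
  then show ?thesis unfolding coin_pattern_eq[of J b \<epsilon>] by simp
qed

lemma measure_coin_pattern:
  assumes "finite J" "0 \<le> \<epsilon>" "\<epsilon> \<le> 1"
  shows "measure (coin_flips \<epsilon>) {r. \<forall>i\<in>J. r i = b i} = (\<Prod>i\<in>J. if b i then \<epsilon> else 1 - \<epsilon>)"
proof -
  interpret product_prob_space "\<lambda>_::int. measure_pmf (bernoulli_pmf \<epsilon>)" UNIV
    by (rule product_prob_spaceI) (rule prob_space_measure_pmf)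
  have "{r. \<forall>i\<in>J. r i = b i} = prod_emb UNIV (\<lambda>_. measure_pmf (bernoulli_pmf \<epsilon>)) J (\<Pi>\<^sub>E i\<in>J. {b i})"
    unfolding prod_emb_def by (rule set_eqI) (simp add: restrict_PiE_iff Pi_iff)
  then have "measure (coin_flips \<epsilon>) {r. \<forall>i\<in>J. r i = b i}
      = (\<Prod>i\<in>J. measure (measure_pmf (bernoulli_pmf \<epsilon>)) {b i})"
    unfolding coin_flips_def using measure_PiM_emb[of J "\<lambda>i. {b i}"] assms(1) by simp
  also have "\<dots> = (\<Prod>i\<in>J. if b i then \<epsilon> else 1 - \<epsilon>)"
    by (rule prod.cong) (use assms in \<open>auto simp: measure_pmf_single\<close>)
  finally show ?thesis .
qed

lemma coin_shift: "shift \<in> measurable (coin_flips \<epsilon>) (coin_flips \<epsilon>)"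
  "distr (coin_flips \<epsilon>) (coin_flips \<epsilon>) shift = coin_flips \<epsilon>"
proof -
  have sh: "(\<lambda>\<omega>. \<lambda>n\<in>UNIV. \<omega> (n + 1)) = (shift :: (int \<Rightarrow> bool) \<Rightarrow> _)"
    by (simp add: shift_def fun_eq_iff)
  show "shift \<in> measurable (coin_flips \<epsilon>) (coin_flips \<epsilon>)"
    unfolding coin_flips_def sh[symmetric]
    by (rule measurable_restrict) (rule measurable_component_singleton, simp)
  show "distr (coin_flips \<epsilon>) (coin_flips \<epsilon>) shift = coin_flips \<epsilon>"
    unfolding coin_flips_def sh[symmetric]
    using distr_PiM_reindex[of UNIV "\<lambda>_::int. measure_pmf (bernoulli_pmf \<epsilon>)" "\<lambda>n::int. n + 1" UNIV]
    by (simp add: prob_space_measure_pmf)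
qed

locale perturbation = shift_measure M X + sft X A F m
  for M :: "(int \<Rightarrow> 'a::{finite,discrete_topology}) measure" and X A F m +
  fixes g :: "'a \<Rightarrow> 'b" and u v :: "'a list" and \<epsilon> :: real
  assumes swap: "swap_pair m g u v" and v_language: "v \<in> language X" and eps: "0 < \<epsilon>" "\<epsilon> < 1"
begin

abbreviation l :: nat where "l \<equiv> length u"

definition \<Omega> :: "((int \<Rightarrow> 'a) \<times> (int \<Rightarrow> bool)) measure" where
  "\<Omega> = M \<Otimes>\<^sub>M coin_flips \<epsilon>"

text \<open>
  The coins at the \<open>2 * l\<close> preceding positions have to show tails; this makes the marks spaced, while the
  coin at \<open>j\<close> remains independent of everything that decides about earlier marks.
\<close>

definition mark :: "int \<Rightarrow> (int \<Rightarrow> 'a) \<times> (int \<Rightarrow> bool) \<Rightarrow> bool" where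
  "mark j \<omega> \<longleftrightarrow> block (fst \<omega>) j l = u \<and> snd \<omega> j \<and> (\<forall>k\<in>{1..2 * l}. \<not> snd \<omega> (j - int k))"

definition switched :: "(int \<Rightarrow> 'a) \<times> (int \<Rightarrow> bool) \<Rightarrow> int \<Rightarrow> 'a" where
  "switched \<omega> = switch v (\<lambda>j. mark j \<omega>) (fst \<omega>)"

lemma l_pos: "0 < l"
  using swap memory_pos by (auto simp: swap_pair_def)

lemma length_v: "length v = l"
  using swap by (simp add: swap_pair_def)

lemma marked: "marked m g u v (\<lambda>j. mark j \<omega>) (fst \<omega>)"
proof
  show "spaced l (\<lambda>j. mark j \<omega>)"
    unfolding spaced_def
  proof (intro allI impI, rule ccontr)
    fix i j assume ij: "mark i \<omega>" "mark j \<omega>" "i < j" "\<not> i + 2 * int l \<le> j"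
    define k where "k = nat (j - i)"
    have "k \<in> {1..2 * l}" "j - int k = i" using ij by (auto simp: k_def)
    then show False using ij(1,2) unfolding mark_def by metis
  qed
qed (use swap in \<open>auto simp: mark_def\<close>)

sublocale coins: prob_space "coin_flips \<epsilon>" by (rule prob_space_coin_flips)

sublocale P: pair_prob_space M "coin_flips \<epsilon>" ..

sublocale \<Omega>: prob_space \<Omega> unfolding \<Omega>_def by unfold_locales

lemma space_\<Omega>: "space \<Omega> = X \<times> UNIV"
  by (simp add: \<Omega>_def space_pair_measure space_M)

lemma fst_measurable: "fst \<in> measurable \<Omega> M" and fst_distr: "distr \<Omega> M fst = M"
  unfolding \<Omega>_def using coins.distr_pair_fst[of M] by simp_all

lemma switched_mem: "\<omega> \<in> space \<Omega> \<Longrightarrow> switched \<omega> \<in> X"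
  unfolding switched_def by (rule switch_mem[OF marked _ v_language]) (auto simp: space_\<Omega>)

lemma switched_image: "g (switched \<omega> i) = g (fst \<omega> i)"
  unfolding switched_def by (rule marked.switch_image[OF marked])

lemma simple_function_x: "simple_function M p \<Longrightarrow> simple_function \<Omega> (\<lambda>\<omega>. p (fst \<omega>))"
  by (rule simple_function_measure_preserving[OF fst_measurable])

lemma simple_function_coin: "simple_function \<Omega> (\<lambda>\<omega>. snd \<omega> i)"
proof -
  have "(\<lambda>r. r i) \<circ> snd \<in> measurable \<Omega> (count_space UNIV)"
    unfolding \<Omega>_def by (rule measurable_comp[OF measurable_snd coin_measurable])
  then show ?thesis unfolding simple_function_eq_measurable by (simp add: comp_def)
qed

definition joint_block :: "int \<Rightarrow> nat \<Rightarrow> (int \<Rightarrow> 'a) \<times> (int \<Rightarrow> bool) \<Rightarrow> 'a list \<times> bool list" where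
  "joint_block i n \<omega> = (block (fst \<omega>) i n, block (snd \<omega>) i n)"

lemma simple_function_coin_block: "simple_function \<Omega> (\<lambda>\<omega>. block (snd \<omega>) i n)"
  unfolding block_def by (rule \<Omega>.simple_function_map) (rule simple_function_coin)

lemma simple_function_joint_block: "simple_function \<Omega> (joint_block i n)"
  unfolding joint_block_def
  by (rule simple_function_Pair[OF simple_function_x[OF simple_function_block] simple_function_coin_block])

lemma mark_cong:
  assumes "block (fst \<omega>) j l = block (fst \<omega>') j l"
    "block (snd \<omega>) (j - 2 * int l) (2 * l + 1) = block (snd \<omega>') (j - 2 * int l) (2 * l + 1)"
  shows "mark j \<omega> = mark j \<omega>'"
proof -
  have "snd \<omega> (j - int k) = snd \<omega>' (j - int k)" if "k \<le> 2 * l" for k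
    using assms(2)[unfolded block_same_eq_iff, rule_format, of "j - int k"] that by auto
  from this[of 0] this show ?thesis unfolding mark_def using assms(1) by auto
qed

lemma mark_determined:
  assumes "i \<le> j - 2 * int l" "j + int l \<le> i + int n"
  shows "determines \<Omega> (joint_block i n) (mark j)"
proof (rule determinesI)
  fix \<omega> \<omega>' assume "joint_block i n \<omega> = joint_block i n \<omega>'"
  then have eq: "block (fst \<omega>) i n = block (fst \<omega>') i n" "block (snd \<omega>) i n = block (snd \<omega>') i n"
    by (simp_all add: joint_block_def)
  show "mark j \<omega> = mark j \<omega>'"
  proof (rule mark_cong)
    show "block (fst \<omega>) j l = block (fst \<omega>') j l"
      by (rule block_eq_subblock[OF eq(1)]) (use assms in simp_all)
    show "block (snd \<omega>) (j - 2 * int l) (2 * l + 1) = block (snd \<omega>') (j - 2 * int l) (2 * l + 1)"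
      by (rule block_eq_subblock[OF eq(2)]) (use assms l_pos in linarith)+
  qed
qed

lemma simple_function_mark: "simple_function \<Omega> (mark j)"
  by (rule simple_function_determined[OF simple_function_joint_block[of "j - 2 * int l" "3 * l"] mark_determined])
     auto

lemma switched_cong:
  assumes "fst \<omega> i = fst \<omega>' i" "\<And>j. i - int l < j \<Longrightarrow> j \<le> i \<Longrightarrow> mark j \<omega> = mark j \<omega>'"
  shows "switched \<omega> i = switched \<omega>' i"
  unfolding switched_def by (rule switch_cong) (use assms length_v in auto)

lemma simple_function_switched: "simple_function \<Omega> (\<lambda>\<omega>. switched \<omega> i)"
proof (rule simple_function_determined[OF simple_function_joint_block[of "i - 3 * int l" "5 * l"]])
  show "determines \<Omega> (joint_block (i - 3 * int l) (5 * l)) (\<lambda>\<omega>. switched \<omega> i)"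
  proof (rule determinesI)
    fix \<omega> \<omega>' assume w: "\<omega> \<in> space \<Omega>" "\<omega>' \<in> space \<Omega>"
      "joint_block (i - 3 * int l) (5 * l) \<omega> = joint_block (i - 3 * int l) (5 * l) \<omega>'"
    show "switched \<omega> i = switched \<omega>' i"
    proof (rule switched_cong)
      show "fst \<omega> i = fst \<omega>' i"
        using w(3) l_pos unfolding joint_block_def prod.inject block_same_eq_iff by auto
      fix j assume "i - int l < j" "j \<le> i"
      then show "mark j \<omega> = mark j \<omega>'"
        by (intro determinesD[OF mark_determined w]) auto
    qed
  qed
qed

lemma simple_function_switched_block: "simple_function \<Omega> (\<lambda>\<omega>. block (switched \<omega>) i n)"
  unfolding block_def by (rule \<Omega>.simple_function_map) (rule simple_function_switched)

lemma switched_measurable: "switched \<in> measurable \<Omega> M"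
proof (rule measurable_sequence[OF sets_M switched_mem])
  show "{\<omega> \<in> space \<Omega>. switched \<omega> i = a} \<in> sets \<Omega>" for i a
  proof -
    have "(\<lambda>\<omega>. switched \<omega> i) -` {a} \<inter> space \<Omega> \<in> sets \<Omega>" by (rule simple_functionD(2)[OF simple_function_switched])
    moreover have "(\<lambda>\<omega>. switched \<omega> i) -` {a} \<inter> space \<Omega> = {\<omega> \<in> space \<Omega>. switched \<omega> i = a}" by auto
    ultimately show ?thesis by simp
  qed
qed

definition joint_shift :: "(int \<Rightarrow> 'a) \<times> (int \<Rightarrow> bool) \<Rightarrow> (int \<Rightarrow> 'a) \<times> (int \<Rightarrow> bool)" where
  "joint_shift \<omega> = (shift (fst \<omega>), shift (snd \<omega>))"

lemma joint_shift_measurable: "joint_shift \<in> measurable \<Omega> \<Omega>" and joint_shift_distr: "distr \<Omega> \<Omega> joint_shift = \<Omega>"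
proof -
  have joint_shift: "joint_shift = (\<lambda>(x, r). (shift x, shift r))" by (auto simp: joint_shift_def fun_eq_iff)
  show "joint_shift \<in> measurable \<Omega> \<Omega>"
    unfolding joint_shift_def \<Omega>_def using shift_measurable coin_shift(1) by measurable
  have "sigma_finite_measure (distr (coin_flips \<epsilon>) (coin_flips \<epsilon>) shift)"
    unfolding coin_shift(2) by unfold_locales
  from pair_measure_distr[OF shift_measurable coin_shift(1) this]
  show "distr \<Omega> \<Omega> joint_shift = \<Omega>"
    unfolding joint_shift \<Omega>_def shift_distr coin_shift(2) by simp
qed

text \<open>
  The replacement rule commutes with the shift; hence the perturbed measure is invariant.
\<close>

lemma switched_joint_shift: "switched (joint_shift \<omega>) = shift (switched \<omega>)"
proof -
  have "mark j (joint_shift \<omega>) = mark (j + 1) \<omega>" for j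
    unfolding mark_def joint_shift_def shift_def by (simp add: block_translate algebra_simps)
  then have "switched (joint_shift \<omega>) = switch v (\<lambda>j. mark (j + 1) \<omega>) (\<lambda>j. fst \<omega> (j + 1))"
    unfolding switched_def by (simp add: joint_shift_def shift_def)
  also have "\<dots> = shift (switched \<omega>)"
    unfolding shift_def switched_def by (rule switch_translate)
  finally show ?thesis .
qed

definition perturbed :: "(int \<Rightarrow> 'a) measure" where
  "perturbed = distr \<Omega> M switched"

lemma perturbed_system: "shift_measure perturbed X"
proof -
  interpret p: prob_space perturbed unfolding perturbed_def by (rule \<Omega>.prob_space_distr[OF switched_measurable])
  have sh: "shift \<in> measurable perturbed perturbed"
    using shift_measurable by (simp add: perturbed_def)
  have "distr perturbed perturbed shift = distr perturbed M shift"
    by (rule distr_cong) (simp_all add: perturbed_def)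
  also have "\<dots> = distr \<Omega> M (shift \<circ> switched)"
    unfolding perturbed_def by (rule distr_distr[OF shift_measurable switched_measurable])
  also have "\<dots> = distr \<Omega> M (switched \<circ> joint_shift)" by (simp add: comp_def switched_joint_shift)
  also have "\<dots> = distr (distr \<Omega> \<Omega> joint_shift) M switched"
    by (rule distr_distr[OF switched_measurable joint_shift_measurable, symmetric])
  finally have "distr perturbed perturbed shift = perturbed" unfolding joint_shift_distr perturbed_def .
  then show ?thesis
    by unfold_locales (simp_all add: perturbed_def sets_M shift_closed)
qed

sublocale perturbed: shift_measure perturbed X by (rule perturbed_system)

lemma perturbed_block_entropy: "perturbed.block_entropy n = ent \<Omega> (\<lambda>\<omega>. block (switched \<omega>) i n)"
proof -
  have 1: "switched \<in> measurable \<Omega> perturbed" using switched_measurable by (simp add: perturbed_def)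
  have 2: "distr \<Omega> perturbed switched = perturbed"
    unfolding perturbed_def by (rule distr_cong) simp_all
  show ?thesis
    using ent_distr[OF 1 2 perturbed.simple_function_block[of i n]] perturbed.ent_block[of i n] by simp
qed

lemma block_entropy_x: "block_entropy n = ent \<Omega> (\<lambda>\<omega>. block (fst \<omega>) i n)"
  using ent_distr[OF fst_measurable fst_distr simple_function_block[of i n]] ent_block[of i n] by simp

end

section \<open>Entropy created by the marks\<close>

context perturbation
begin

lemma rectangle_eq:
  assumes "E \<in> sets M"
  shows "{\<omega>\<in>space \<Omega>. fst \<omega> \<in> E \<and> (\<forall>i\<in>J. snd \<omega> i = b i)} = E \<times> {r. \<forall>i\<in>J. r i = b i}"
proof -
  have "E \<subseteq> X" using sets.sets_into_space[OF assms] by (simp add: space_M)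
  then show ?thesis by (auto simp: space_\<Omega>)
qed

lemma rectangle_sets:
  assumes "E \<in> sets M" "finite J"
  shows "{\<omega>\<in>space \<Omega>. fst \<omega> \<in> E \<and> (\<forall>i\<in>J. snd \<omega> i = b i)} \<in> sets \<Omega>"
  unfolding rectangle_eq[OF assms(1)] unfolding \<Omega>_def
  by (rule pair_measureI[OF assms(1) coin_pattern_sets[OF assms(2)]])

lemma prob_rectangle:
  assumes E: "E \<in> sets M" and J: "finite J"
  shows "measure \<Omega> {\<omega>\<in>space \<Omega>. fst \<omega> \<in> E \<and> (\<forall>i\<in>J. snd \<omega> i = b i)}
    = measure M E * (\<Prod>i\<in>J. if b i then \<epsilon> else 1 - \<epsilon>)"
proof -
  have "measure \<Omega> {\<omega>\<in>space \<Omega>. fst \<omega> \<in> E \<and> (\<forall>i\<in>J. snd \<omega> i = b i)}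
      = measure M E * measure (coin_flips \<epsilon>) {r. \<forall>i\<in>J. r i = b i}"
    unfolding rectangle_eq[OF E] unfolding \<Omega>_def measure_def
    by (simp add: coins.emeasure_pair_measure_Times[OF E coin_pattern_sets[OF J]] enn2real_mult)
  then show ?thesis using measure_coin_pattern[OF J] eps by simp
qed

lemma pr_rectangle:
  assumes "E \<in> sets M" "finite J" "\<And>\<omega>. \<omega> \<in> space \<Omega> \<Longrightarrow> Y \<omega> = a \<longleftrightarrow> fst \<omega> \<in> E \<and> (\<forall>i\<in>J. snd \<omega> i = b i)"
  shows "pr \<Omega> Y a = measure M E * (\<Prod>i\<in>J. if b i then \<epsilon> else 1 - \<epsilon>)"
proof -
  have "Y -` {a} \<inter> space \<Omega> = {\<omega>\<in>space \<Omega>. fst \<omega> \<in> E \<and> (\<forall>i\<in>J. snd \<omega> i = b i)}"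
    using assms(3) by auto
  then show ?thesis unfolding pr_def by (simp add: prob_rectangle[OF assms(1,2)])
qed

lemma block_event: "{x\<in>X. block x i n = w} \<in> sets M"
  "measure M {x\<in>X. block x i n = w} = pr M (\<lambda>x. block x 0 n) w"
proof -
  have e: "{x\<in>X. block x i n = w} = (\<lambda>x. block x i n) -` {w} \<inter> space M" by (auto simp: space_M)
  show "{x\<in>X. block x i n = w} \<in> sets M"
    unfolding e by (rule simple_functionD(2)[OF simple_function_block])
  show "measure M {x\<in>X. block x i n = w} = pr M (\<lambda>x. block x 0 n) w"
    using pr_block_image[of "\<lambda>w. w" i n w] unfolding e pr_def by simp
qed

text \<open>
  The probability of a mark at a given position.
\<close>

definition \<kappa> :: real where
  "\<kappa> = pr M (\<lambda>x. block x 0 l) u * (\<epsilon> * (1 - \<epsilon>) ^ (2 * l))"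

lemma pr_mark: "pr \<Omega> (mark j) True = \<kappa>"
proof -
  define K where "K = (\<lambda>k. j - int k) ` {1..2 * l}"
  have jK: "j \<notin> K" "finite K" unfolding K_def by auto
  have inj: "inj_on (\<lambda>k. j - int k) {1..2 * l}" by (auto simp: inj_on_def)
  have "pr \<Omega> (mark j) True = measure M {x\<in>X. block x j l = u} * (\<Prod>i\<in>insert j K. if i = j then \<epsilon> else 1 - \<epsilon>)"
    by (rule pr_rectangle[OF block_event(1)]) (use jK in \<open>auto simp: mark_def K_def space_\<Omega>\<close>)
  also have "(\<Prod>i\<in>insert j K. if i = j then \<epsilon> else 1 - \<epsilon>) = \<epsilon> * (\<Prod>i\<in>K. 1 - \<epsilon>)"
  proof -
    have "(\<Prod>i\<in>K. if i = j then \<epsilon> else 1 - \<epsilon>) = (\<Prod>i\<in>K. 1 - \<epsilon>)"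
      by (rule prod.cong) (use jK in auto)
    then show ?thesis using jK by simp
  qed
  also have "(\<Prod>i\<in>K. 1 - \<epsilon>) = (1 - \<epsilon>) ^ (2 * l)"
  proof -
    have "card K = 2 * l" unfolding K_def using card_image[OF inj] by simp
    then show ?thesis by (simp only: prod_constant)
  qed
  finally show ?thesis unfolding block_event(2) \<kappa>_def .
qed

lemma \<kappa>_le: "\<kappa> \<le> \<epsilon>"
proof -
  have "pr M (\<lambda>x. block x 0 l) u \<le> 1" by (simp add: pr_def)
  moreover have "(1 - \<epsilon>) ^ (2 * l) \<le> 1" using eps by (intro power_le_one) auto
  ultimately have "pr M (\<lambda>x. block x 0 l) u * (\<epsilon> * (1 - \<epsilon>) ^ (2 * l)) \<le> 1 * (\<epsilon> * 1)"
    using eps by (intro mult_mono mult_nonneg_nonneg) (auto simp: pr_nonneg)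
  then show ?thesis by (simp add: \<kappa>_def)
qed

text \<open>
  A mark at \<open>j\<close> requires a head at \<open>j\<close>, which is independent of the point and of all earlier coins.
  Marks look at the coins of the past only, so \<open>Y\<close> may contain the earlier marks.
\<close>

lemma cond_ent_mark_past:
  assumes det: "determines \<Omega> (\<lambda>\<omega>. (block (fst \<omega>) 0 N, block (snd \<omega>) a k)) Y" and j: "j = a + int k"
  shows "\<kappa> * ln (1 / \<epsilon>) \<le> cond_ent \<Omega> (mark j) Y"
proof -
  let ?V = "\<lambda>\<omega>. (block (fst \<omega>) 0 N, block (snd \<omega>) a k)"
  have SV: "simple_function \<Omega> ?V"
    by (rule simple_function_Pair[OF simple_function_x[OF simple_function_block] simple_function_coin_block])
  have "pr \<Omega> (mark j) True * ln (1 / \<epsilon>) \<le> cond_ent \<Omega> (mark j) ?V"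
  proof (rule \<Omega>.cond_ent_ge_min_entropy[OF simple_function_mark SV eps(1)])
    fix w :: "'a list \<times> bool list"
    let ?W = "\<lambda>\<omega>. (mark j \<omega>, ?V \<omega>)"
    show "pr \<Omega> ?W (True, w) \<le> \<epsilon> * pr \<Omega> ?V w"
    proof (cases "length (snd w) = k")
      case False
      then have "?W -` {(True, w)} \<inter> space \<Omega> = {}" by auto
      then show ?thesis using eps by (simp add: pr_def)
    next
      case True
      define J where "J = {a..<a + int k}"
      define b where "b i = (if i = j then True else snd w ! nat (i - a))" for i
      have jJ: "j \<notin> J" "finite J" using j by (auto simp: J_def)
      have iff: "block (snd \<omega>) a k = snd w \<longleftrightarrow> (\<forall>i\<in>J. snd \<omega> i = b i)" for \<omega> :: "(int \<Rightarrow> 'a) \<times> (int \<Rightarrow> bool)"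
      proof
        assume h: "block (snd \<omega>) a k = snd w"
        show "\<forall>i\<in>J. snd \<omega> i = b i"
        proof
          fix i assume i: "i \<in> J"
          then have "nat (i - a) < k" "a + int (nat (i - a)) = i" "i \<noteq> j" using j by (auto simp: J_def)
          then show "snd \<omega> i = b i" using nth_block[of "nat (i - a)" k "snd \<omega>" a] h by (simp add: b_def)
        qed
      next
        assume h: "\<forall>i\<in>J. snd \<omega> i = b i"
        show "block (snd \<omega>) a k = snd w"
        proof (rule nth_equalityI)
          fix t assume "t < length (block (snd \<omega>) a k)"
          then have t: "t < k" by simp
          then have "snd \<omega> (a + int t) = b (a + int t)" using h by (simp add: J_def)
          then show "block (snd \<omega>) a k ! t = snd w ! t" using t j by (simp add: b_def)
        qed (use True in simp)
      qed
      let ?E = "{x\<in>X. block x 0 N = fst w}"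
      have V: "pr \<Omega> ?V w = measure M ?E * (\<Prod>i\<in>J. if b i then \<epsilon> else 1 - \<epsilon>)"
        by (rule pr_rectangle[OF block_event(1) jJ(2)]) (simp add: prod_eq_iff iff space_\<Omega> mem_Times_iff)
      have "?W -` {(True, w)} \<inter> space \<Omega> \<subseteq> {\<omega>\<in>space \<Omega>. fst \<omega> \<in> ?E \<and> (\<forall>i\<in>insert j J. snd \<omega> i = b i)}"
      proof
        fix \<omega> assume "\<omega> \<in> ?W -` {(True, w)} \<inter> space \<Omega>"
        then have h: "mark j \<omega>" "block (fst \<omega>) 0 N = fst w" "block (snd \<omega>) a k = snd w" "\<omega> \<in> space \<Omega>"
          by (auto simp: prod_eq_iff)
        then have "snd \<omega> j = b j" by (simp add: mark_def b_def)
        then show "\<omega> \<in> {\<omega>\<in>space \<Omega>. fst \<omega> \<in> ?E \<and> (\<forall>i\<in>insert j J. snd \<omega> i = b i)}"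
          using h iff[of \<omega>] by (simp add: space_\<Omega> mem_Times_iff)
      qed
      then have "pr \<Omega> ?W (True, w) \<le> measure \<Omega> {\<omega>\<in>space \<Omega>. fst \<omega> \<in> ?E \<and> (\<forall>i\<in>insert j J. snd \<omega> i = b i)}"
        unfolding pr_def
        by (rule \<Omega>.finite_measure_mono) (rule rectangle_sets[OF block_event(1)], use jJ in simp)
      also have "\<dots> = measure M ?E * (\<Prod>i\<in>insert j J. if b i then \<epsilon> else 1 - \<epsilon>)"
        by (rule prob_rectangle[OF block_event(1)]) (use jJ in simp)
      also have "\<dots> = \<epsilon> * pr \<Omega> ?V w" unfolding V using jJ by (simp add: b_def)
      finally show ?thesis .
    qed
  qed
  also have "\<dots> \<le> cond_ent \<Omega> (mark j) Y" by (rule \<Omega>.cond_ent_condition_mono[OF simple_function_mark SV det])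
  finally show ?thesis unfolding pr_mark .
qed

definition marks :: "nat \<Rightarrow> (int \<Rightarrow> 'a) \<times> (int \<Rightarrow> bool) \<Rightarrow> bool list" where
  "marks n \<omega> = map (\<lambda>j. mark (int j) \<omega>) [0..<n]"

lemma simple_function_marks: "simple_function \<Omega> (marks n)"
  unfolding marks_def by (rule \<Omega>.simple_function_map) (rule simple_function_mark)

text \<open>
  Chain rule: reveal the marks from left to right and apply \<open>cond_ent_mark_past\<close> to each of them. The
  block has length \<open>n + l\<close> so that it shows the word at each of the positions \<open>0, \<dots>, n - 1\<close>.
\<close>

lemma entropy_of_marks:
  "block_entropy (n + l) + real n * (\<kappa> * ln (1 / \<epsilon>)) \<le> ent \<Omega> (\<lambda>\<omega>. (marks n \<omega>, block (fst \<omega>) 0 (n + l)))"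
proof -
  let ?X = "\<lambda>\<omega>. block (fst \<omega>) 0 (n + l)"
  have SX: "simple_function \<Omega> ?X" by (rule simple_function_x[OF simple_function_block])
  have "block_entropy (n + l) + real k * (\<kappa> * ln (1 / \<epsilon>)) \<le> ent \<Omega> (\<lambda>\<omega>. (marks k \<omega>, ?X \<omega>))" if "k \<le> n" for k
    using that
  proof (induction k)
    case 0
    have "block_entropy (n + l) = ent \<Omega> ?X" by (rule block_entropy_x)
    also have "\<dots> \<le> ent \<Omega> (\<lambda>\<omega>. (marks 0 \<omega>, ?X \<omega>))"
      by (rule \<Omega>.ent_determined_le[OF simple_function_Pair[OF simple_function_marks SX] determines_snd])
    finally show ?case by simp
  next
    case (Suc k)
    let ?Y = "\<lambda>\<omega>. (marks k \<omega>, ?X \<omega>)"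
    have SY: "simple_function \<Omega> ?Y" by (rule simple_function_Pair[OF simple_function_marks SX])
    have "determines \<Omega> (\<lambda>\<omega>. (?X \<omega>, block (snd \<omega>) (- 2 * int l) (2 * l + k))) ?Y"
    proof (rule determinesI)
      fix \<omega> \<omega>' :: "(int \<Rightarrow> 'a) \<times> (int \<Rightarrow> bool)"
      assume h: "(?X \<omega>, block (snd \<omega>) (- 2 * int l) (2 * l + k)) = (?X \<omega>', block (snd \<omega>') (- 2 * int l) (2 * l + k))"
      have "mark (int j) \<omega> = mark (int j) \<omega>'" if "j < k" for j
      proof (rule mark_cong)
        show "block (fst \<omega>) (int j) l = block (fst \<omega>') (int j) l"
          by (rule block_eq_subblock[of _ 0 "n + l"]) (use h that Suc in auto)
        show "block (snd \<omega>) (int j - 2 * int l) (2 * l + 1) = block (snd \<omega>') (int j - 2 * int l) (2 * l + 1)"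
          by (rule block_eq_subblock[of _ "- 2 * int l" "2 * l + k"]) (use h that in auto)
      qed
      then show "?Y \<omega> = ?Y \<omega>'" using h by (simp add: marks_def)
    qed
    then have "\<kappa> * ln (1 / \<epsilon>) \<le> cond_ent \<Omega> (mark (int k)) ?Y"
      by (rule cond_ent_mark_past) simp
    also have "\<dots> = ent \<Omega> (\<lambda>\<omega>. (mark (int k) \<omega>, ?Y \<omega>)) - ent \<Omega> ?Y" by (simp add: cond_ent_def)
    also have "ent \<Omega> (\<lambda>\<omega>. (mark (int k) \<omega>, ?Y \<omega>)) \<le> ent \<Omega> (\<lambda>\<omega>. (marks (Suc k) \<omega>, ?X \<omega>))"
      by (rule \<Omega>.ent_determined_le[OF simple_function_Pair[OF simple_function_marks SX]])
         (rule determinesI, simp add: marks_def)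
    finally show ?case using Suc by (simp add: algebra_simps)
  qed
  then show ?thesis by simp
qed

text \<open>
  Reduces the comparison of entropies to a bound on what is lost when only the new point is seen.
  The error \<open>err n\<close> is measured against a block of the new point that extends the original one by
  margins of total length \<open>2 * l\<close>.
\<close>

lemma perturbed_rate_lower_bound:
  assumes err: "\<And>n. ent \<Omega> (\<lambda>\<omega>. (marks n \<omega>, block (fst \<omega>) 0 (n + l))) \<le> perturbed.block_entropy (n + 3 * l) + err n"
    and lim: "(\<lambda>n. err n / real n) \<longlonglongrightarrow> C"
  shows "entropy_rate + \<kappa> * ln (1 / \<epsilon>) \<le> perturbed.entropy_rate + C"
proof (rule LIMSEQ_le)
  show "(\<lambda>n. block_entropy (n + l) / real n + \<kappa> * ln (1 / \<epsilon>)) \<longlonglongrightarrow> entropy_rate + \<kappa> * ln (1 / \<epsilon>)"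
    by (intro tendsto_intros block_entropy_offset_limit)
  show "(\<lambda>n. perturbed.block_entropy (n + 3 * l) / real n + err n / real n) \<longlonglongrightarrow> perturbed.entropy_rate + C"
    by (intro tendsto_add perturbed.block_entropy_offset_limit lim)
  have "block_entropy (n + l) / real n + \<kappa> * ln (1 / \<epsilon>)
      \<le> perturbed.block_entropy (n + 3 * l) / real n + err n / real n" if n: "n \<ge> 1" for n
  proof -
    have "block_entropy (n + l) + real n * (\<kappa> * ln (1 / \<epsilon>)) \<le> perturbed.block_entropy (n + 3 * l) + err n"
      using entropy_of_marks[of n] err[of n] by linarith
    then have "(block_entropy (n + l) + real n * (\<kappa> * ln (1 / \<epsilon>))) / real n
       \<le> (perturbed.block_entropy (n + 3 * l) + err n) / real n" by (intro divide_right_mono) auto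
    then show ?thesis using n by (simp add: add_divide_distrib)
  qed
  then show "\<exists>N. \<forall>n\<ge>N. block_entropy (n + l) / real n + \<kappa> * ln (1 / \<epsilon>)
      \<le> perturbed.block_entropy (n + 3 * l) / real n + err n / real n" by blast
qed

end

section \<open>Entropy and integral of the perturbed measure\<close>

context perturbation
begin

lemma mark_sets: "{\<omega>\<in>space \<Omega>. mark i \<omega>} \<in> sets \<Omega>"
proof -
  have "{\<omega>\<in>space \<Omega>. mark i \<omega>} = mark i -` {True} \<inter> space \<Omega>" by auto
  then show ?thesis using simple_functionD(2)[OF simple_function_mark] by simp
qed

lemma some_mark_sets:
  assumes "finite I"
  shows "{\<omega>\<in>space \<Omega>. \<exists>i\<in>I. mark i \<omega>} \<in> sets \<Omega>"
proof -
  have "{\<omega>\<in>space \<Omega>. \<exists>i\<in>I. mark i \<omega>} = (\<Union>i\<in>I. {\<omega>\<in>space \<Omega>. mark i \<omega>})" by auto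
  then show ?thesis using assms mark_sets by auto
qed

lemma prob_some_mark:
  assumes "finite I"
  shows "measure \<Omega> {\<omega>\<in>space \<Omega>. \<exists>i\<in>I. mark i \<omega>} \<le> real (card I) * \<epsilon>"
proof -
  have e: "{\<omega>\<in>space \<Omega>. \<exists>i\<in>I. mark i \<omega>} = (\<Union>i\<in>I. {\<omega>\<in>space \<Omega>. mark i \<omega>})" by auto
  have "measure \<Omega> {\<omega>\<in>space \<Omega>. \<exists>i\<in>I. mark i \<omega>} \<le> (\<Sum>i\<in>I. measure \<Omega> {\<omega>\<in>space \<Omega>. mark i \<omega>})"
    unfolding e by (rule \<Omega>.finite_measure_subadditive_finite[OF assms]) (use mark_sets in blast)
  also have "\<dots> \<le> (\<Sum>i\<in>I. \<epsilon>)"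
  proof (rule sum_mono)
    fix i
    have "{\<omega>\<in>space \<Omega>. mark i \<omega>} = mark i -` {True} \<inter> space \<Omega>" by auto
    then show "measure \<Omega> {\<omega>\<in>space \<Omega>. mark i \<omega>} \<le> \<epsilon>"
      using pr_mark[of i] \<kappa>_le by (simp add: pr_def)
  qed
  finally show ?thesis by simp
qed

lemma switched_eq_if_unmarked:
  assumes "\<And>j. i - int l < j \<Longrightarrow> j \<le> i \<Longrightarrow> \<not> mark j \<omega>"
  shows "switched \<omega> i = fst \<omega> i"
  unfolding switched_def by (rule switch_unmarked) (use assms length_v in auto)

text \<open>
  As \<open>v\<close> does not occur in the original point, each occurrence of \<open>v\<close> in the new one overlaps a
  replaced word, and has probability at most \<open>2 l \<epsilon>\<close>. A mark costs at most \<open>ln 2\<close> where \<open>v\<close> occurs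
  in the new point, and nothing elsewhere.
\<close>

lemma rate_bound_if_null:
  assumes null: "pr M (\<lambda>x. block x 0 l) v = 0"
  shows "entropy_rate + \<kappa> * ln (1 / \<epsilon>) \<le> perturbed.entropy_rate + 2 * real l * \<epsilon> * ln 2"
proof -
  define b where "b j \<omega> \<longleftrightarrow> block (switched \<omega>) j l = v" for j \<omega>
  have Sb: "simple_function \<Omega> (b j)" for j
    unfolding b_def using simple_function_compose[OF simple_function_switched_block[of j l], of "\<lambda>w. w = v"]
    by (simp add: comp_def)
  have pb: "pr \<Omega> (b j) True \<le> 2 * real l * \<epsilon>" for j
  proof -
    let ?I = "{j - int l<..<j + int l}"
    let ?N = "{\<omega>\<in>space \<Omega>. fst \<omega> \<in> {x\<in>X. block x j l = v} \<and> (\<forall>i\<in>{}. snd \<omega> i = True)}"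
    let ?B = "{\<omega>\<in>space \<Omega>. \<exists>i\<in>?I. mark i \<omega>}"
    have N: "?N \<in> sets \<Omega>" by (rule rectangle_sets[OF block_event(1)]) simp
    have "b j -` {True} \<inter> space \<Omega> \<subseteq> ?N \<union> ?B"
    proof
      fix \<omega> assume w: "\<omega> \<in> b j -` {True} \<inter> space \<Omega>"
      show "\<omega> \<in> ?N \<union> ?B"
      proof (cases "\<exists>i\<in>?I. mark i \<omega>")
        case False
        have "block (switched \<omega>) j l = block (fst \<omega>) j l"
          unfolding block_same_eq_iff
        proof (intro allI impI)
          fix k assume "j \<le> k \<and> k < j + int l"
          then show "switched \<omega> k = fst \<omega> k" by (intro switched_eq_if_unmarked) (use False in auto)
        qed
        then have "\<omega> \<in> ?N" using w by (auto simp: b_def space_\<Omega>)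
        then show ?thesis by blast
      qed (use w in blast)
    qed
    then have "pr \<Omega> (b j) True \<le> measure \<Omega> (?N \<union> ?B)"
      unfolding pr_def by (rule \<Omega>.finite_measure_mono) (use N some_mark_sets[of ?I] in blast)
    also have "\<dots> \<le> measure \<Omega> ?N + measure \<Omega> ?B"
      by (rule measure_Un_le) (use N some_mark_sets[of ?I] in blast)+
    also have "measure \<Omega> ?N = 0"
      using prob_rectangle[OF block_event(1), of "{}" j l v] null by (simp add: block_event(2))
    also have "measure \<Omega> ?B \<le> real (card ?I) * \<epsilon>" by (rule prob_some_mark) simp
    also have "\<dots> \<le> 2 * real l * \<epsilon>" using eps by (intro mult_right_mono) auto
    finally show ?thesis by simp
  qed
  define c where "c = 2 * real l * \<epsilon> * ln 2"
  define err where "err n = real (n + 2 * l) * c" for n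
  show ?thesis
    unfolding c_def[symmetric]
  proof (rule perturbed_rate_lower_bound)
    show "(\<lambda>n. err n / real n) \<longlonglongrightarrow> c" unfolding err_def by real_asymp
    fix n
    \<comment> \<open>A symbol at \<open>i\<close> is affected by marks in \<open>{i - l<..i}\<close>, and a mark at \<open>j\<close> is tested on \<open>{j..<j + l}\<close>:
      hence the margins.\<close>
    let ?Zb = "\<lambda>\<omega>. block (switched \<omega>) (- int l) (n + 3 * l)"
    let ?S = "\<lambda>\<omega>. map (\<lambda>j. mark (int j - int l) \<omega>) [0..<n + 2 * l]"
    have SZ: "simple_function \<Omega> ?Zb" by (rule simple_function_switched_block)
    have SS: "simple_function \<Omega> ?S" by (rule \<Omega>.simple_function_map) (rule simple_function_mark)
    have "determines \<Omega> (\<lambda>\<omega>. (?S \<omega>, ?Zb \<omega>)) (\<lambda>\<omega>. (marks n \<omega>, block (fst \<omega>) 0 (n + l)))"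
    proof (rule determinesI)
      fix \<omega> \<omega>' :: "(int \<Rightarrow> 'a) \<times> (int \<Rightarrow> bool)"
      assume h: "(?S \<omega>, ?Zb \<omega>) = (?S \<omega>', ?Zb \<omega>')"
      have mk: "mark j \<omega> = mark j \<omega>'" if "- int l \<le> j" "j < int n + int l" for j
      proof -
        have "nat (j + int l) < n + 2 * l" "int (nat (j + int l)) - int l = j" using that by auto
        then show ?thesis using h arg_cong[of "?S \<omega>" "?S \<omega>'" "\<lambda>L. L ! nat (j + int l)"] by simp
      qed
      have "fst \<omega> i = fst \<omega>' i" if i: "0 \<le> i" "i < int n + int l" for i
      proof -
        have "switched \<omega> i = switched \<omega>' i" using h i unfolding prod.inject block_same_eq_iff by auto
        moreover have "fst \<omega>'' i = switch u (\<lambda>j. mark j \<omega>'') (switched \<omega>'') i" for \<omega>''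
          unfolding switched_def by (simp add: marked.switch_back[OF marked])
        moreover have "switch u (\<lambda>j. mark j \<omega>) (switched \<omega>) i = switch u (\<lambda>j. mark j \<omega>') (switched \<omega>') i"
          if "switched \<omega> i = switched \<omega>' i"
        proof (rule switch_cong)
          show "mark (i - int k) \<omega> = mark (i - int k) \<omega>'" if "k < l" for k
            by (rule mk) (use i that in auto)
        qed (rule that)
        ultimately show ?thesis by simp
      qed
      moreover have "marks n \<omega> = marks n \<omega>'" unfolding marks_def using mk by auto
      ultimately show "(marks n \<omega>, block (fst \<omega>) 0 (n + l)) = (marks n \<omega>', block (fst \<omega>') 0 (n + l))"
        by (simp add: block_same_eq_iff)
    qed
    then have "ent \<Omega> (\<lambda>\<omega>. (marks n \<omega>, block (fst \<omega>) 0 (n + l))) \<le> ent \<Omega> (\<lambda>\<omega>. (?S \<omega>, ?Zb \<omega>))"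
      by (rule \<Omega>.ent_determined_le[OF simple_function_Pair[OF SS SZ]])
    also have "\<dots> = ent \<Omega> ?Zb + cond_ent \<Omega> ?S ?Zb" by (simp add: cond_ent_def)
    also have "ent \<Omega> ?Zb = perturbed.block_entropy (n + 3 * l)" by (rule perturbed_block_entropy[symmetric])
    also have "cond_ent \<Omega> ?S ?Zb \<le> (\<Sum>j\<leftarrow>[0..<n + 2 * l]. cond_ent \<Omega> (mark (int j - int l)) ?Zb)"
      by (rule \<Omega>.cond_ent_map_le[OF simple_function_mark SZ])
    also have "\<dots> \<le> (\<Sum>j\<leftarrow>[0..<n + 2 * l]. c)"
    proof (rule sum_list_mono)
      fix j assume j: "j \<in> set [0..<n + 2 * l]"
      have "cond_ent \<Omega> (mark (int j - int l)) ?Zb \<le> cond_ent \<Omega> (mark (int j - int l)) (b (int j - int l))"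
      proof (rule \<Omega>.cond_ent_condition_mono[OF simple_function_mark SZ], rule determinesI)
        fix \<omega> \<omega>' assume h: "?Zb \<omega> = ?Zb \<omega>'"
        have "block (switched \<omega>) (int j - int l) l = block (switched \<omega>') (int j - int l) l"
          by (rule block_eq_subblock[OF h]) (use j in auto)
        then show "b (int j - int l) \<omega> = b (int j - int l) \<omega>'" by (simp add: b_def)
      qed
      also have "\<dots> \<le> pr \<Omega> (b (int j - int l)) True * ln 2"
      proof (rule \<Omega>.cond_ent_bool_le[OF simple_function_mark Sb])
        show "b (int j - int l) \<omega>" if "mark (int j - int l) \<omega>" for \<omega>
          unfolding b_def switched_def using marked.switch_at_mark[OF marked] that length_v by simp
      qed
      also have "\<dots> \<le> c" unfolding c_def by (rule mult_right_mono[OF pb]) simp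
      finally show "cond_ent \<Omega> (mark (int j - int l)) ?Zb \<le> c" .
    qed
    also have "\<dots> = err n" by (simp add: sum_list_triv err_def)
    finally show "ent \<Omega> (\<lambda>\<omega>. (marks n \<omega>, block (fst \<omega>) 0 (n + l))) \<le> perturbed.block_entropy (n + 3 * l) + err n"
      by simp
  qed
qed

text \<open>
  The old point and the new one determine the marks, and the conditional entropy of the old point given
  the new one is at most that given the common image, which has rate \<open>entropy_rate - h\<close>.
\<close>

lemma rate_bound_relative:
  assumes lim: "(\<lambda>n. ent M (\<lambda>x. map g (block x 0 n)) / real n) \<longlonglongrightarrow> h"
  shows "entropy_rate + \<kappa> * ln (1 / \<epsilon>) \<le> perturbed.entropy_rate + (entropy_rate - h)"
proof (rule perturbed_rate_lower_bound)
  define e where "e n = block_entropy n - ent M (\<lambda>x. map g (block x 0 n))" for n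
  have "(\<lambda>n. e n / real n) \<longlonglongrightarrow> entropy_rate - h"
    unfolding e_def diff_divide_distrib by (intro tendsto_diff block_entropy_limit lim)
  then have "(\<lambda>n. e (n + 3 * l) / real (n + 3 * l)) \<longlonglongrightarrow> entropy_rate - h"
    by (rule LIMSEQ_ignore_initial_segment)
  moreover have "(\<lambda>n. real (n + 3 * l) / real n) \<longlonglongrightarrow> 1" by real_asymp
  ultimately have "(\<lambda>n. e (n + 3 * l) / real (n + 3 * l) * (real (n + 3 * l) / real n)) \<longlonglongrightarrow> (entropy_rate - h) * 1"
    by (rule tendsto_mult)
  then show "(\<lambda>n. e (n + 3 * l) / real n) \<longlonglongrightarrow> entropy_rate - h"
    using l_pos by simp
  fix n
  let ?Zb = "\<lambda>\<omega>. block (switched \<omega>) (- int l) (n + 3 * l)" and ?Xb = "\<lambda>\<omega>. block (fst \<omega>) (- int l) (n + 3 * l)"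
  have SZ: "simple_function \<Omega> ?Zb" by (rule simple_function_switched_block)
  have SX: "simple_function \<Omega> ?Xb" by (rule simple_function_x[OF simple_function_block])
  have "determines \<Omega> (\<lambda>\<omega>. (?Xb \<omega>, ?Zb \<omega>)) (\<lambda>\<omega>. (marks n \<omega>, block (fst \<omega>) 0 (n + l)))"
  proof (rule determinesI)
    fix \<omega> \<omega>' :: "(int \<Rightarrow> 'a) \<times> (int \<Rightarrow> bool)"
    assume "(?Xb \<omega>, ?Zb \<omega>) = (?Xb \<omega>', ?Zb \<omega>')"
    then have h: "?Xb \<omega> = ?Xb \<omega>'" "?Zb \<omega> = ?Zb \<omega>'" by simp_all
    interpret mk: marked m g u v "\<lambda>j. mark j \<omega>" "fst \<omega>" by (rule marked)
    interpret mk': marked m g u v "\<lambda>j. mark j \<omega>'" "fst \<omega>'" by (rule marked)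
    have eq: "fst \<omega> i = fst \<omega>' i \<and> switched \<omega> i = switched \<omega>' i" if "- int l \<le> i" "i < int n + 2 * int l" for i
      using h that unfolding block_same_eq_iff by auto
    have "mark (int j) \<omega> = mark (int j) \<omega>'" if j: "j < n" for j
    proof -
      let ?d = "int mk.first_difference"
      have d: "?d < int l" using mk.first_difference(2) by simp
      have "fst \<omega> (int j + ?d) = fst \<omega>' (int j + ?d) \<and> switched \<omega> (int j + ?d) = switched \<omega>' (int j + ?d)"
        by (rule eq) (use j d in auto)
      moreover have "fst \<omega> (int j + ?d - int k) = fst \<omega>' (int j + ?d - int k) \<and>
          switched \<omega> (int j + ?d - int k) = switched \<omega>' (int j + ?d - int k)" if "k \<in> {1..l}" for k
        by (rule eq) (use j d that in auto)
      ultimately show ?thesis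
        using mk.mark_iff[of "int j"] mk'.mark_iff[of "int j"] unfolding switched_def[symmetric] by simp
    qed
    moreover have "block (fst \<omega>) 0 (n + l) = block (fst \<omega>') 0 (n + l)"
      by (rule block_eq_subblock[OF h(1)]) auto
    ultimately show "(marks n \<omega>, block (fst \<omega>) 0 (n + l)) = (marks n \<omega>', block (fst \<omega>') 0 (n + l))"
      by (simp add: marks_def)
  qed
  then have "ent \<Omega> (\<lambda>\<omega>. (marks n \<omega>, block (fst \<omega>) 0 (n + l))) \<le> ent \<Omega> (\<lambda>\<omega>. (?Xb \<omega>, ?Zb \<omega>))"
    by (rule \<Omega>.ent_determined_le[OF simple_function_Pair[OF SX SZ]])
  also have "\<dots> = ent \<Omega> ?Zb + cond_ent \<Omega> ?Xb ?Zb" by (simp add: cond_ent_def)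
  also have "ent \<Omega> ?Zb = perturbed.block_entropy (n + 3 * l)" by (rule perturbed_block_entropy[symmetric])
  also have "cond_ent \<Omega> ?Xb ?Zb \<le> cond_ent \<Omega> ?Xb (\<lambda>\<omega>. map g (?Xb \<omega>))"
  proof (rule \<Omega>.cond_ent_condition_mono[OF SX SZ], rule determinesI)
    fix \<omega> \<omega>' assume h: "?Zb \<omega> = ?Zb \<omega>'"
    have "map g (?Xb \<omega>'') = map g (?Zb \<omega>'')" for \<omega>''
      by (simp add: block_def switched_image)
    then show "map g (?Xb \<omega>) = map g (?Xb \<omega>')" using h by simp
  qed
  also have "\<dots> = e (n + 3 * l)"
  proof -
    have 1: "ent \<Omega> (\<lambda>\<omega>. (?Xb \<omega>, map g (?Xb \<omega>))) = ent \<Omega> ?Xb"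
      by (rule \<Omega>.ent_eq_if_equivalent[OF SX]) (rule determinesI, simp)+
    have "ent \<Omega> (\<lambda>\<omega>. map g (?Xb \<omega>)) = ent M (\<lambda>x. map g (block x (- int l) (n + 3 * l)))"
      by (rule ent_distr[OF fst_measurable fst_distr simple_function_block_image])
    also have "\<dots> = ent M (\<lambda>x. map g (block x 0 (n + 3 * l)))" by (rule ent_block_image)
    finally show ?thesis using 1 block_entropy_x[of "n + 3 * l" "- int l"] by (simp add: cond_ent_def e_def)
  qed
  finally show "ent \<Omega> (\<lambda>\<omega>. (marks n \<omega>, block (fst \<omega>) 0 (n + l)))
      \<le> perturbed.block_entropy (n + 3 * l) + e (n + 3 * l)" by simp
qed

text \<open>
  If the two points first differ at distance \<open>k\<close> from the origin, the values of \<open>f\<close> differ by at most \<open>V k\<close>,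
  and this happens with probability at most \<open>2 l \<epsilon>\<close>, since there must be a mark within reach of \<open>k\<close> or
  \<open>- k\<close>.
\<close>

lemma perturbed_integral:
  fixes f :: "(int \<Rightarrow> 'a) \<Rightarrow> real" and V :: "nat \<Rightarrow> real"
  assumes f: "f \<in> borel_measurable M" and B: "\<And>x. x \<in> X \<Longrightarrow> \<bar>f x\<bar> \<le> B"
    and V: "\<And>x y k. x \<in> X \<Longrightarrow> y \<in> X \<Longrightarrow> (\<And>i. \<bar>i\<bar> < int k \<Longrightarrow> x i = y i) \<Longrightarrow> \<bar>f x - f y\<bar> \<le> V k"
    and V0: "\<And>k. 0 \<le> V k" and sum: "summable V"
  shows "\<bar>(\<integral>x. f x \<partial>perturbed) - (\<integral>x. f x \<partial>M)\<bar> \<le> 2 * real l * \<epsilon> * suminf V"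
proof -
  have iZ: "(\<integral>x. f x \<partial>perturbed) = (\<integral>\<omega>. f (switched \<omega>) \<partial>\<Omega>)"
    unfolding perturbed_def by (rule integral_distr[OF switched_measurable f])
  have ix: "(\<integral>x. f x \<partial>M) = (\<integral>\<omega>. f (fst \<omega>) \<partial>\<Omega>)"
    using integral_distr[OF fst_measurable f] unfolding fst_distr .
  have intZ: "integrable \<Omega> (\<lambda>\<omega>. f (switched \<omega>))"
    by (rule \<Omega>.integrable_const_bound[of _ B])
       (use B switched_mem measurable_compose[OF switched_measurable f] in auto)
  have intx: "integrable \<Omega> (\<lambda>\<omega>. f (fst \<omega>))"
    by (rule \<Omega>.integrable_const_bound[of _ B])
       (use B measurable_compose[OF fst_measurable f] in \<open>auto simp: space_\<Omega>\<close>)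
  define I where "I k = {int k - int l<..int k} \<union> {- int k - int l<..- int k}" for k
  define D where "D k = {\<omega>\<in>space \<Omega>. \<exists>i\<in>I k. mark i \<omega>}" for k
  have D: "D k \<in> sets \<Omega>" for k unfolding D_def by (rule some_mark_sets) (simp add: I_def)
  have pD: "measure \<Omega> (D k) \<le> 2 * real l * \<epsilon>" for k
  proof -
    have "card (I k) \<le> 2 * l"
      unfolding I_def by (rule order_trans[OF card_Un_le]) simp
    moreover have "measure \<Omega> (D k) \<le> real (card (I k)) * \<epsilon>"
      unfolding D_def by (rule prob_some_mark) (simp add: I_def)
    moreover have "real (card (I k)) * \<epsilon> \<le> real (2 * l) * \<epsilon>" if "card (I k) \<le> 2 * l"
      using eps that by (intro mult_right_mono of_nat_mono) simp_all
    ultimately show ?thesis by simp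
  qed
  have le: "\<bar>(\<integral>x. f x \<partial>perturbed) - (\<integral>x. f x \<partial>M)\<bar> \<le> 2 * real l * \<epsilon> * suminf V + V N" for N
  proof -
    \<comment> \<open>The first difference lies at a distance \<open>k < N\<close>, or else the points agree up to distance \<open>N\<close>.\<close>
    let ?U = "\<lambda>\<omega>. (\<Sum>k<N. V k * indicator (D k) \<omega>) + V N"
    have pw: "\<bar>f (switched \<omega>) - f (fst \<omega>)\<bar> \<le> ?U \<omega>" if w: "\<omega> \<in> space \<Omega>" for \<omega>
    proof -
      have m: "switched \<omega> \<in> X" "fst \<omega> \<in> X" using switched_mem[OF w] w by (auto simp: space_\<Omega>)
      have nn: "0 \<le> (\<Sum>k<N. V k * indicator (D k) \<omega>)" using V0 by (intro sum_nonneg) auto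
      show ?thesis
      proof (cases "\<forall>i. \<bar>i\<bar> < int N \<longrightarrow> switched \<omega> i = fst \<omega> i")
        case True
        then have "\<bar>f (switched \<omega>) - f (fst \<omega>)\<bar> \<le> V N" using m by (intro V) auto
        then show ?thesis using nn by linarith
      next
        case False
        then have ex: "\<exists>k<N. \<exists>i. \<bar>i\<bar> = int k \<and> switched \<omega> i \<noteq> fst \<omega> i"
          by (metis abs_ge_zero nonneg_int_cases of_nat_less_iff)
        define k where "k = (LEAST k. \<exists>i. \<bar>i\<bar> = int k \<and> switched \<omega> i \<noteq> fst \<omega> i)"
        have k: "\<exists>i. \<bar>i\<bar> = int k \<and> switched \<omega> i \<noteq> fst \<omega> i"
          unfolding k_def by (rule LeastI_ex) (use ex in blast)
        have kN: "k < N" using ex Least_le unfolding k_def by (metis (mono_tags, lifting) le_less_trans)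
        have "switched \<omega> i = fst \<omega> i" if "\<bar>i\<bar> < int k" for i
        proof (rule ccontr)
          assume "switched \<omega> i \<noteq> fst \<omega> i"
          then have "k \<le> nat \<bar>i\<bar>" unfolding k_def by (intro Least_le) auto
          then show False using that by auto
        qed
        then have 1: "\<bar>f (switched \<omega>) - f (fst \<omega>)\<bar> \<le> V k" using m by (intro V) auto
        obtain i where i: "\<bar>i\<bar> = int k" "switched \<omega> i \<noteq> fst \<omega> i" using k by blast
        then obtain j where j: "i - int l < j" "j \<le> i" "mark j \<omega>" using switched_eq_if_unmarked by blast
        then have "j \<in> I k" using i(1) by (auto simp: I_def abs_if split: if_splits)
        then have "\<omega> \<in> D k" using j w by (auto simp: D_def)
        then have "V k = V k * indicator (D k) \<omega>" by simp
        also have "\<dots> \<le> (\<Sum>k<N. V k * indicator (D k) \<omega>)"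
          by (rule member_le_sum[of k "{..<N}" "\<lambda>k. V k * indicator (D k) \<omega>"]) (use kN V0 in auto)
        finally show ?thesis using 1 V0[of N] by linarith
      qed
    qed
    have iD: "integrable \<Omega> (\<lambda>\<omega>. V k * indicator (D k) \<omega>)" for k
      by (intro integrable_mult_right integrable_real_indicator D) (simp add: \<Omega>.emeasure_finite less_top[symmetric])
    have iU: "integrable \<Omega> ?U"
      by (intro Bochner_Integration.integrable_add Bochner_Integration.integrable_sum iD) simp
    have "\<bar>(\<integral>x. f x \<partial>perturbed) - (\<integral>x. f x \<partial>M)\<bar> = \<bar>\<integral>\<omega>. f (switched \<omega>) - f (fst \<omega>) \<partial>\<Omega>\<bar>"
      unfolding iZ ix by (simp add: Bochner_Integration.integral_diff[OF intZ intx])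
    also have "\<dots> \<le> (\<integral>\<omega>. \<bar>f (switched \<omega>) - f (fst \<omega>)\<bar> \<partial>\<Omega>)"
      by (rule integral_abs_bound)
    also have "\<dots> \<le> (\<integral>\<omega>. ?U \<omega> \<partial>\<Omega>)"
      by (rule integral_mono[OF _ iU pw]) (use intZ intx in auto)
    also have "\<dots> = (\<Sum>k<N. V k * measure \<Omega> (D k)) + V N"
    proof -
      have "(\<integral>\<omega>. ?U \<omega> \<partial>\<Omega>) = (\<integral>\<omega>. (\<Sum>k<N. V k * indicator (D k) \<omega>) \<partial>\<Omega>) + (\<integral>\<omega>. V N \<partial>\<Omega>)"
        by (rule Bochner_Integration.integral_add) (intro Bochner_Integration.integrable_sum iD, simp)
      also have "(\<integral>\<omega>. (\<Sum>k<N. V k * indicator (D k) \<omega>) \<partial>\<Omega>) = (\<Sum>k<N. \<integral>\<omega>. V k * indicator (D k) \<omega> \<partial>\<Omega>)"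
        by (rule Bochner_Integration.integral_sum) (rule iD)
      also have "\<dots> = (\<Sum>k<N. V k * measure \<Omega> (D k))"
        using D by (intro sum.cong) auto
      finally show ?thesis by (simp add: \<Omega>.prob_space)
    qed
    also have "(\<Sum>k<N. V k * measure \<Omega> (D k)) \<le> (\<Sum>k<N. V k * (2 * real l * \<epsilon>))"
      by (intro sum_mono mult_left_mono pD V0)
    also have "\<dots> = 2 * real l * \<epsilon> * (\<Sum>k<N. V k)" unfolding sum_distrib_right[symmetric] by (rule mult.commute)
    also have "\<dots> \<le> 2 * real l * \<epsilon> * suminf V"
      using eps sum V0 by (intro mult_left_mono sum_le_suminf) auto
    finally show ?thesis by simp
  qed
  have "(\<lambda>N. 2 * real l * \<epsilon> * suminf V + V N) \<longlonglongrightarrow> 2 * real l * \<epsilon> * suminf V + 0"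
    by (intro tendsto_intros summable_LIMSEQ_zero sum)
  then show ?thesis using le by (intro LIMSEQ_le_const[where X = "\<lambda>N. 2 * real l * \<epsilon> * suminf V + V N"]) auto
qed

end

section \<open>Exchangeable words of positive measure\<close>

lemma compact_UNIV_sequences: "compact (UNIV :: (int \<Rightarrow> 'a::{finite,discrete_topology}) set)"
proof -
  have "compact_space (euclidean :: 'a topology)"
    unfolding compact_space_def by (rule finite_imp_compactin) auto
  then have "compact_space (product_topology (\<lambda>_::int. euclidean :: 'a topology) UNIV)"
    by (simp add: compact_space_product_topology)
  then show ?thesis
    unfolding euclidean_product_topology compact_space_def by simp
qed

lemma shift_dist_le:
  assumes "\<And>i. \<bar>i\<bar> < int k \<Longrightarrow> x i = y i"
  shows "shift_dist x y \<le> (1 / 2) ^ k"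
proof (cases "x = y")
  case False
  then obtain i where i: "x i \<noteq> y i" by auto
  define n where "n = (LEAST n. \<exists>i. x i \<noteq> y i \<and> nat \<bar>i\<bar> = n)"
  have "\<exists>j. x j \<noteq> y j \<and> nat \<bar>j\<bar> = n"
    unfolding n_def by (rule LeastI[of _ "nat \<bar>i\<bar>"]) (use i in blast)
  then obtain j where j: "x j \<noteq> y j" "nat \<bar>j\<bar> = n" by blast
  then have "k \<le> n" using assms[of j] by linarith
  then have "(1 / 2 :: real) ^ n \<le> (1 / 2) ^ k" by (intro power_decreasing) auto
  then show ?thesis using False unfolding shift_dist_def n_def by simp
qed (simp add: shift_dist_def)

lemma variation_bound:
  assumes B: "\<And>x. x \<in> X \<Longrightarrow> \<bar>f x\<bar> \<le> B" and xy: "x \<in> X" "y \<in> X"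
    and agree: "\<And>i. \<bar>i\<bar> < int k \<Longrightarrow> x i = y i"
  shows "\<bar>f x - f y\<bar> \<le> variation X f k"
proof -
  let ?S = "{(x, y). x \<in> X \<and> y \<in> X \<and> shift_dist x y \<le> (1 / 2) ^ k}"
  have "bdd_above ((\<lambda>(x, y). \<bar>f x - f y\<bar>) ` ?S)"
  proof (rule bdd_aboveI)
    fix t assume "t \<in> (\<lambda>(x, y). \<bar>f x - f y\<bar>) ` ?S"
    then obtain a b where ab: "a \<in> X" "b \<in> X" "t = \<bar>f a - f b\<bar>" by auto
    then show "t \<le> B + B" using B[OF ab(1)] B[OF ab(2)] by linarith
  qed
  then have "(\<lambda>(x, y). \<bar>f x - f y\<bar>) (x, y) \<le> variation X f k"
    unfolding variation_def by (rule cSUP_upper[rotated]) (use xy shift_dist_le[OF agree] in simp)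
  then show ?thesis by simp
qed

lemma open_block: "open {x :: int \<Rightarrow> 'a::discrete_topology. block x i n = w}"
proof (cases "length w = n")
  case True
  have "open {x :: int \<Rightarrow> 'a. \<forall>k\<in>{..<n}. x (i + int k) \<in> {w ! k}}"
    by (rule product_topology_basis') (simp_all add: discrete_topology_class.open_discrete)
  moreover have "{x :: int \<Rightarrow> 'a. \<forall>k\<in>{..<n}. x (i + int k) \<in> {w ! k}} = {x. block x i n = w}"
    using True by (auto simp: list_eq_iff_nth_eq)
  ultimately show ?thesis by simp
next
  case False
  then have "{x :: int \<Rightarrow> 'a. block x i n = w} = {}" by auto
  then show ?thesis by (metis open_empty)
qed

lemma closed_sft:
  fixes X :: "(int \<Rightarrow> 'a::discrete_topology) set"
  assumes "sft X A F m"
  shows "closed X"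
proof -
  interpret sft X A F m by (rule assms)
  have "- X = (\<Union>i. {x. x i \<in> - A}) \<union> (\<Union>w\<in>F. \<Union>i. {x. block x i (length w) = w})"
    unfolding X_eq occurs_in_def by auto
  moreover have "open ((\<Union>i. {x :: int \<Rightarrow> 'a. x i \<in> - A}) \<union> (\<Union>w\<in>F. \<Union>i. {x. block x i (length w) = w}))"
    by (intro open_Un open_UN ballI open_coordinate open_block)
  ultimately show ?thesis by (simp add: closed_def)
qed

lemma sft_exists:
  assumes "shift_of_finite_type X"
  shows "\<exists>A F m. sft X A F m \<and> finite A"
proof -
  obtain A F where AF: "finite A" "finite F" "X = {x. range x \<subseteq> A \<and> (\<forall>w\<in>F. \<not> occurs_in w x)}"
    using assms unfolding shift_of_finite_type_def by blast
  have "sft X A F (Suc (Max (insert 0 (length ` F))))"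
  proof
    show "X = {x. range x \<subseteq> A \<and> (\<forall>w\<in>F. \<not> occurs_in w x)}" by (rule AF(3))
    fix w assume "w \<in> F"
    then have "length w \<le> Max (insert 0 (length ` F))" using AF(2) by (intro Max_ge) auto
    then show "length w \<le> Suc (Max (insert 0 (length ` F)))" by simp
  qed simp
  then show ?thesis using AF(1) by blast
qed

lemma shift_measureI:
  assumes "\<mu> \<in> invariant_measures X" "\<And>x. x \<in> X \<Longrightarrow> shift x \<in> X"
  shows "shift_measure \<mu> X"
proof -
  interpret prob_space \<mu> using assms(1) by (simp add: invariant_measures_def)
  show ?thesis
    by unfold_locales (use assms in \<open>auto simp: invariant_measures_def\<close>)
qed

lemma (in shift_measure) pr_block_pos_if_fully_supported:
  assumes full: "fully_supported X M" and x: "x \<in> X"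
  shows "0 < pr M (\<lambda>x. block x 0 n) (block x i n)"
proof -
  let ?U = "{y\<in>X. block y i n = block x i n}"
  have "openin (top_of_set X) ?U"
    unfolding openin_open using open_block[of i n "block x i n"] by (intro exI[of _ "{y. block y i n = block x i n}"]) auto
  then have "0 < measure M ?U" using full x unfolding fully_supported_def by blast
  also have "?U = (\<lambda>y. block y i n) -` {block x i n} \<inter> space M" by (auto simp: space_M)
  finally show ?thesis
    using pr_block_image[of "\<lambda>w. w" i n "block x i n"] unfolding pr_def by simp
qed

text \<open>
  Exchanging \<open>u\<close> for \<open>v\<close> does not change the image point.
\<close>

lemma (in perturbation) perturbed_lift:
  assumes \<pi>: "\<pi> \<in> measurable M \<nu>" "distr M \<nu> \<pi> = \<nu>" "\<And>x. x \<in> X \<Longrightarrow> \<pi> x = (\<lambda>i. g (x i))"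
  shows "perturbed \<in> invariant_lifts X \<pi> \<nu>"
proof -
  have "distr perturbed \<nu> \<pi> = distr \<Omega> \<nu> (\<pi> \<circ> switched)"
    unfolding perturbed_def by (rule distr_distr[OF \<pi>(1) switched_measurable])
  also have "\<dots> = distr \<Omega> \<nu> (\<pi> \<circ> fst)"
  proof (rule distr_cong)
    fix \<omega> assume w: "\<omega> \<in> space \<Omega>"
    then have "fst \<omega> \<in> X" by (auto simp: space_\<Omega>)
    then show "(\<pi> \<circ> switched) \<omega> = (\<pi> \<circ> fst) \<omega>" using switched_mem[OF w] \<pi>(3) by (simp add: switched_image)
  qed simp_all
  also have "\<dots> = distr (distr \<Omega> M fst) \<nu> \<pi>"
    by (rule distr_distr[OF \<pi>(1) fst_measurable, symmetric])
  finally have "distr perturbed \<nu> \<pi> = \<nu>" unfolding fst_distr \<pi>(2) .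
  then show ?thesis
    using perturbed.prob_space_axioms perturbed.sets_M perturbed.shift_distr
    by (simp add: invariant_lifts_def invariant_measures_def)
qed

text \<open>
  For small \<open>\<epsilon>\<close> the factor \<open>ln (1 / \<epsilon>)\<close> exceeds every constant, while \<open>(1 - \<epsilon>) ^ n\<close> stays bounded away
  from \<open>0\<close>.
\<close>

lemma entropy_beats_linear:
  assumes c: "0 < (c::real)" and le: "\<And>\<epsilon>. 0 < \<epsilon> \<Longrightarrow> \<epsilon> < 1 \<Longrightarrow> c * (\<epsilon> * (1 - \<epsilon>) ^ n) * ln (1 / \<epsilon>) \<le> K * \<epsilon>"
  shows False
proof -
  define d where "d = c * (1 / 2) ^ n"
  have d: "0 < d" using c by (simp add: d_def)
  define L where "L = \<bar>K\<bar> / d + 1"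
  \<comment> \<open>Then \<open>ln (1 / \<epsilon>) \<ge> L\<close>, and \<open>L\<close> is chosen so that \<open>d * L\<close> exceeds \<open>K\<close>.\<close>
  define \<epsilon> where "\<epsilon> = min (1 / 2) (exp (- L))"
  have e: "0 < \<epsilon>" "\<epsilon> \<le> 1 / 2" "\<epsilon> \<le> exp (- L)" by (auto simp: \<epsilon>_def)
  have "ln \<epsilon> \<le> - L" using e ln_le_cancel_iff[of \<epsilon> "exp (- L)"] by simp
  then have L: "L \<le> ln (1 / \<epsilon>)" using e by (simp add: ln_div)
  have "0 \<le> L" using d by (simp add: L_def)
  have "(1 / 2) ^ n \<le> (1 - \<epsilon>) ^ n" using e by (intro power_mono) auto
  then have "d * L \<le> (c * (1 - \<epsilon>) ^ n) * ln (1 / \<epsilon>)"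
    unfolding d_def using c L \<open>0 \<le> L\<close> e by (intro mult_mono) auto
  also have "\<dots> \<le> K"
  proof -
    have "(c * (1 - \<epsilon>) ^ n * ln (1 / \<epsilon>)) * \<epsilon> \<le> K * \<epsilon>" using le[of \<epsilon>] e by (simp add: mult_ac)
    then show ?thesis using e by simp
  qed
  finally have "d * L \<le> K" .
  moreover have "d * L = \<bar>K\<bar> + d" using d by (simp add: L_def field_simps)
  ultimately show False using d by linarith
qed

text \<open>
  The perturbation argument for one pair of exchangeable words. In the application \<open>M\<close> is the relative
  equilibrium state and \<open>h\<close> is the entropy of \<open>\<nu>\<close>.
\<close>

lemma no_profitable_swap:
  fixes X :: "(int \<Rightarrow> 'a::{finite,discrete_topology}) set" and \<nu> :: "(int \<Rightarrow> 'b) measure"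
  assumes sft: "sft X A F m" and M: "shift_measure M X"
    and \<pi>: "\<pi> \<in> measurable M \<nu>" "distr M \<nu> \<pi> = \<nu>" "\<And>x. x \<in> X \<Longrightarrow> \<pi> x = (\<lambda>i. g (x i))"
    and max: "\<And>M'. M' \<in> invariant_lifts X \<pi> \<nu> \<Longrightarrow> shift_measure M' X \<Longrightarrow>
       shift_measure.entropy_rate M' + (\<integral>x. f x \<partial>M') \<le> shift_measure.entropy_rate M + (\<integral>x. f x \<partial>M)"
    and f: "continuous_on X f" "dini 1 X f"
    and rate: "(\<lambda>n. ent M (\<lambda>x. map g (block x 0 n)) / real n) \<longlonglongrightarrow> h"
    and uv: "swap_pair m g u v" "v \<in> language X"
    and u_pos: "0 < pr M (\<lambda>x. block x 0 (length u)) u"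
  shows "0 < pr M (\<lambda>x. block x 0 (length u)) v" and "h < shift_measure.entropy_rate M"
proof -
  interpret M: shift_measure M X by (rule M)
  interpret S: sft X A F m by (rule sft)
  have ne: "X \<noteq> {}" using M.subprob_not_empty M.space_M by simp
  have "compact X"
    using compact_Int_closed[OF compact_UNIV_sequences closed_sft[OF sft]] by simp
  then have "bounded (f ` X)" using compact_continuous_image[OF f(1)] compact_imp_bounded by blast
  then obtain B where B: "\<And>x. x \<in> X \<Longrightarrow> \<bar>f x\<bar> \<le> B"
    unfolding bounded_iff by auto
  have fM: "f \<in> borel_measurable M"
    using borel_measurable_continuous_on_restrict[OF f(1)] measurable_cong_sets[OF M.sets_M refl] by blast
  let ?V = "variation X f"
  have V: "\<bar>f x - f y\<bar> \<le> ?V k" if "x \<in> X" "y \<in> X" "\<And>i. \<bar>i\<bar> < int k \<Longrightarrow> x i = y i" for x y k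
    by (rule variation_bound[OF B that])
  have V0: "0 \<le> ?V k" for k using V ne by fastforce
  have sum: "summable ?V" using f(2) V0 by (simp add: dini_def)
  define p where "p = pr M (\<lambda>x. block x 0 (length u)) u"
  \<comment> \<open>\<open>K * \<epsilon>\<close> bounds the entropy lost and the change of the integral together.\<close>
  define K where "K = 2 * real (length u) * (ln 2 + suminf ?V)"
  have key: False if bad: "pr M (\<lambda>x. block x 0 (length u)) v = 0 \<or> M.entropy_rate \<le> h"
  proof (rule entropy_beats_linear[where n = "2 * length u" and K = K])
    show "0 < p" using u_pos by (simp add: p_def)
    fix \<epsilon> :: real assume e: "0 < \<epsilon>" "\<epsilon> < 1"
    interpret P: perturbation M X A F m g u v \<epsilon>
      by unfold_locales (use uv e in auto)
    have "M.entropy_rate + P.\<kappa> * ln (1 / \<epsilon>) \<le> P.perturbed.entropy_rate + 2 * real (length u) * \<epsilon> * ln 2"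
      using bad
    proof
      assume "pr M (\<lambda>x. block x 0 (length u)) v = 0"
      then show ?thesis by (rule P.rate_bound_if_null)
    next
      assume "M.entropy_rate \<le> h"
      moreover have "0 \<le> 2 * real (length u) * \<epsilon> * ln 2" using e by simp
      ultimately show ?thesis using P.rate_bound_relative[OF rate] by linarith
    qed
    moreover have "P.perturbed.entropy_rate + (\<integral>x. f x \<partial>P.perturbed) \<le> M.entropy_rate + (\<integral>x. f x \<partial>M)"
      by (rule max[OF P.perturbed_lift[OF \<pi>] P.perturbed_system])
    moreover have "\<bar>(\<integral>x. f x \<partial>P.perturbed) - (\<integral>x. f x \<partial>M)\<bar> \<le> 2 * real (length u) * \<epsilon> * suminf ?V"
      by (rule P.perturbed_integral[OF fM B V V0 sum])
    ultimately have "P.\<kappa> * ln (1 / \<epsilon>) \<le> 2 * real (length u) * \<epsilon> * ln 2 + 2 * real (length u) * \<epsilon> * suminf ?V"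
      by linarith
    then show "p * (\<epsilon> * (1 - \<epsilon>) ^ (2 * length u)) * ln (1 / \<epsilon>) \<le> K * \<epsilon>"
      unfolding P.\<kappa>_def p_def[symmetric] K_def by (simp add: algebra_simps)
  qed
  show "0 < pr M (\<lambda>x. block x 0 (length u)) v" using key pr_nonneg[of M _ v] by (metis less_eq_real_def)
  show "h < M.entropy_rate" using key by (metis not_le)
qed

section \<open>Relative equilibrium states\<close>

lemma (in shift_measure) pr_block_le:
  assumes "\<And>x. x \<in> X \<Longrightarrow> block x i n = w \<Longrightarrow> block x j k = w'"
  shows "pr M (\<lambda>x. block x 0 n) w \<le> pr M (\<lambda>x. block x 0 k) w'"
proof -
  have "measure M ((\<lambda>x. block x i n) -` {w} \<inter> space M) \<le> measure M ((\<lambda>x. block x j k) -` {w'} \<inter> space M)"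
  proof (rule finite_measure_mono)
    show "(\<lambda>x. block x j k) -` {w'} \<inter> space M \<in> sets M"
      by (rule simple_functionD(2)[OF simple_function_block])
  qed (use assms in \<open>auto simp: space_M\<close>)
  then show ?thesis
    using pr_block_image[of "\<lambda>w. w" i n w] pr_block_image[of "\<lambda>w. w" j k w'] unfolding pr_def by simp
qed

lemma relative_equilibrium_states:
  fixes X :: "(int \<Rightarrow> 'a::{finite,discrete_topology}) set"
    and Y :: "(int \<Rightarrow> 'b::{finite,discrete_topology}) set"
  assumes X: "shift_of_finite_type X" "irreducible_shift X"
    and \<pi>: "factor_map X Y \<pi>" "one_block_code X \<pi>" "\<not> finite_to_one X Y \<pi>"
    and f: "continuous_on X f" "dini 1 X f"
    and \<nu>: "\<nu> \<in> invariant_measures Y" "fully_supported Y \<nu>"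
    and \<mu>: "relative_equilibrium_state X \<pi> f \<nu> \<mu>"
  shows "fully_supported X \<mu>" and "shift_entropy \<mu> - shift_entropy \<nu> > 0"
proof -
  obtain A F m where sft: "sft X A F m" and A: "finite A" using sft_exists[OF X(1)] by blast
  interpret S: sft X A F m by (rule sft)
  obtain g where "\<And>x i. x \<in> X \<Longrightarrow> \<pi> x i = g (x i)" using \<pi>(2) unfolding one_block_code_def by blast
  then have g: "\<pi> x = (\<lambda>i. g (x i))" if "x \<in> X" for x using that by auto
  have \<pi>Y: "\<pi> x \<in> Y" if "x \<in> X" for x using \<pi>(1) that unfolding factor_map_def by blast
  have Y_shift: "shift y \<in> Y" if y: "y \<in> Y" for y
  proof -
    obtain x where x: "x \<in> X" "y = \<pi> x" using \<pi>(1) y unfolding factor_map_def by blast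
    then have "shift y = \<pi> (shift x)" using \<pi>(1) unfolding factor_map_def by simp
    then show ?thesis using \<pi>Y[OF S.shift_mem[OF x(1)]] by simp
  qed
  have lift: "\<mu> \<in> invariant_measures X" "distr \<mu> \<nu> \<pi> = \<nu>"
    using \<mu> unfolding relative_equilibrium_state_def invariant_lifts_def by auto
  interpret M: shift_measure \<mu> X by (rule shift_measureI[OF lift(1) S.shift_mem])
  interpret N: shift_measure \<nu> Y by (rule shift_measureI[OF \<nu>(1) Y_shift])
  have \<pi>_meas: "\<pi> \<in> measurable \<mu> \<nu>"
  proof (rule measurable_sequence[OF N.sets_M])
    show "\<pi> x \<in> Y" if "x \<in> space \<mu>" for x using that \<pi>Y by (simp add: M.space_M)
    fix i b
    have "{x \<in> space \<mu>. \<pi> x i = b} = {x\<in>X. x i \<in> g -` {b}}" by (auto simp: M.space_M g)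
    then show "{x \<in> space \<mu>. \<pi> x i = b} \<in> sets \<mu>" by (simp only: M.coordinate_sets)
  qed
  have image_block: "block (\<pi> x) i n = map g (block x i n)" if "x \<in> X" for x i n
    by (simp add: block_def g[OF that])
  have "N.block_entropy n = ent \<mu> (\<lambda>x. map g (block x 0 n))" for n
  proof -
    have "N.block_entropy n = ent \<mu> (\<lambda>x. block (\<pi> x) 0 n)"
      unfolding N.block_entropy_def
      by (rule ent_distr[OF \<pi>_meas lift(2) N.simple_function_block, symmetric])
    also have "\<dots> = ent \<mu> (\<lambda>x. map g (block x 0 n))"
      by (rule M.ent_eq_if_equivalent[OF M.simple_function_block_image])
         (rule determinesI, simp add: image_block M.space_M)+
    finally show ?thesis .
  qed
  then have rate: "(\<lambda>n. ent \<mu> (\<lambda>x. map g (block x 0 n)) / real n) \<longlonglongrightarrow> N.entropy_rate"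
    using N.block_entropy_limit by simp
  have max: "shift_measure.entropy_rate M' + (\<integral>x. f x \<partial>M') \<le> M.entropy_rate + (\<integral>x. f x \<partial>\<mu>)"
    if M': "M' \<in> invariant_lifts X \<pi> \<nu>" "shift_measure M' X" for M'
  proof -
    have "shift_entropy M' - shift_entropy \<nu> + ereal (\<integral>x. f x \<partial>M')
       \<le> shift_entropy \<mu> - shift_entropy \<nu> + ereal (\<integral>x. f x \<partial>\<mu>)"
      using \<mu> unfolding relative_equilibrium_state_def by (metis (no_types, lifting) M'(1) SUP_upper)
    then show ?thesis
      unfolding M.shift_entropy_eq N.shift_entropy_eq shift_measure.shift_entropy_eq[OF M'(2)] by simp
  qed
  note swap = no_profitable_swap[OF sft M.shift_measure_axioms \<pi>_meas lift(2) g max f rate]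
  show full: "fully_supported X \<mu>"
    unfolding fully_supported_def
  proof (intro allI impI, elim conjE)
    fix U assume U: "openin (top_of_set X) U" "U \<noteq> {}"
    then obtain T x where T: "open T" "U = X \<inter> T" and x: "x \<in> X" "x \<in> T" unfolding openin_open by blast
    obtain k where k: "\<forall>y. (\<forall>i. \<bar>i\<bar> \<le> int k \<longrightarrow> y i = x i) \<longrightarrow> y \<in> T" using open_window[OF T(1) x(2)] by blast
    define w where "w = window k x"
    have w: "w \<in> language X" "length w = 2 * k + 1"
      unfolding w_def window_def by (rule S.block_in_language[OF x(1)]) simp
    have "pr \<mu> (\<lambda>x. block x 0 (2 * k + 1)) w \<noteq> 0"
    proof
      assume null: "pr \<mu> (\<lambda>x. block x 0 (2 * k + 1)) w = 0"
      have ne: "X \<noteq> {}" using x by blast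
      obtain t where t: "\<exists>x\<in>X. map g (block x 0 (length t)) = t"
        "\<forall>x\<in>X. map g (block x 0 (length t)) = t \<longrightarrow>
          (\<exists>y\<in>X. map g (block y 0 (length t)) = t \<and> block y 0 m = block x 0 m \<and>
          block y (int (length t)) m = block x (int (length t)) m \<and>
          (\<exists>q\<ge>0. q + int (length w) \<le> int (length t + m) \<and> block y q (length w) = w))"
        using S.uniform_preimage_word[OF X(2) ne A w(1)] by blast
      obtain x0 where x0: "x0 \<in> X" "map g (block x0 0 (length t)) = t" using t(1) by blast
      \<comment> \<open>The measure of \<open>t\<close> is the sum of the measures of its preimages, extended by \<open>m\<close> symbols.\<close>
      have "0 < pr \<nu> (\<lambda>y. block y 0 (length t)) (block (\<pi> x0) 0 (length t))"
        by (rule N.pr_block_pos_if_fully_supported[OF \<nu>(2) \<pi>Y[OF x0(1)]])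
      also have "\<dots> = pr \<mu> (\<lambda>x. block (\<pi> x) 0 (length t)) t"
        using pr_distr[OF \<pi>_meas lift(2) N.simple_function_block] image_block[OF x0(1)] x0(2) by simp
      also have "\<dots> = (\<Sum>w'\<in>{w'\<in>(\<lambda>x. block x 0 (length t + m)) ` space \<mu>. map g (take (length t) w') = t}.
          pr \<mu> (\<lambda>x. block x 0 (length t + m)) w')"
        by (rule M.pr_sum_fibres[OF M.simple_function_block])
           (simp add: image_block M.space_M block_append)
      finally obtain w' where w': "w' \<in> (\<lambda>x. block x 0 (length t + m)) ` space \<mu>"
         "map g (take (length t) w') = t" "pr \<mu> (\<lambda>x. block x 0 (length t + m)) w' \<noteq> 0"
        by (metis (mono_tags, lifting) less_irrefl mem_Collect_eq sum.neutral)
      then obtain x1 where x1: "x1 \<in> X" "w' = block x1 0 (length t + m)" by (auto simp: M.space_M)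
      then have x1t: "map g (block x1 0 (length t)) = t" using w'(2) by (simp add: block_append)
      then obtain y q where y: "y \<in> X" "map g (block y 0 (length t)) = t" "block y 0 m = block x1 0 m"
          "block y (int (length t)) m = block x1 (int (length t)) m"
        and q: "q \<ge> 0" "q + int (length w) \<le> int (length t + m)" "block y q (length w) = w"
        using t(2) x1(1) by blast
      let ?v = "block y 0 (length t + m)"
      have "pr \<mu> (\<lambda>x. block x 0 (length t + m)) ?v \<le> pr \<mu> (\<lambda>x. block x 0 (length w)) w"
      proof (rule M.pr_block_le)
        fix z assume "block z 0 (length t + m) = ?v"
        then have "block z q (length w) = block y q (length w)"
          by (rule block_eq_subblock) (use q in auto)
        then show "block z q (length w) = w" using q by simp
      qed
      then have v0: "pr \<mu> (\<lambda>x. block x 0 (length t + m)) ?v = 0"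
        using null w(2) pr_nonneg[of \<mu> _ ?v] by (metis antisym)
      then have "w' \<noteq> ?v" using w'(3) by auto
      then have "swap_pair m g w' ?v"
        unfolding x1(2) by (intro swap_pairI) (use y x1t in \<open>simp_all add: block_append\<close>)
      moreover have "0 < pr \<mu> (\<lambda>x. block x 0 (length w')) w'"
        using w'(3) pr_nonneg[of \<mu> _ w'] x1(2) by (simp add: less_le)
      ultimately have "0 < pr \<mu> (\<lambda>x. block x 0 (length w')) ?v"
        using swap(1) S.block_in_language[OF y(1)] by blast
      then show False using v0 x1(2) by simp
    qed
    then have "0 < pr \<mu> (\<lambda>x. block x 0 (2 * k + 1)) w" using pr_nonneg[of \<mu> _ w] by (simp add: less_le)
    also have "\<dots> = measure \<mu> (window k -` {w} \<inter> space \<mu>)"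
      using M.pr_block_image[of "\<lambda>w. w" "- int k" "2 * k + 1" w] unfolding pr_def window_def[abs_def] by simp
    also have "\<dots> \<le> measure \<mu> U"
    proof (rule M.finite_measure_mono)
      show "window k -` {w} \<inter> space \<mu> \<subseteq> U"
        using k unfolding T(2) w_def M.space_M by (auto simp: window_eq_iff)
      show "U \<in> sets \<mu>"
        unfolding M.sets_M sets_restrict_space T(2) using T(1) by (intro imageI) simp
    qed
    finally show "0 < measure \<mu> U" .
  qed
  obtain y where "infinite {x\<in>X. \<pi> x = y}" using \<pi>(3) unfolding finite_to_one_def by blast
  moreover have "{x\<in>X. \<pi> x = y} = {x\<in>X. (\<lambda>i. g (x i)) = y}" using g by auto
  ultimately have inf: "infinite {x\<in>X. (\<lambda>i. g (x i)) = y}" by simp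
  obtain a b n where ab: "a \<in> X" "b \<in> X" "block a 0 m = block b 0 m"
     "block a (int n) m = block b (int n) m" "map g (block a 0 (n + m)) = map g (block b 0 (n + m))"
     "block a 0 (n + m) \<noteq> block b 0 (n + m)"
    using S.exists_diamond[OF A inf] by blast
  have "swap_pair m g (block a 0 (n + m)) (block b 0 (n + m))" by (rule swap_pairI[OF ab(3-6)])
  moreover have "0 < pr \<mu> (\<lambda>x. block x 0 (length (block a 0 (n + m)))) (block a 0 (n + m))"
    using M.pr_block_pos_if_fully_supported[OF full ab(1)] by simp
  ultimately have "N.entropy_rate < M.entropy_rate"
    using swap(2) S.block_in_language[OF ab(2)] by blast
  then show "shift_entropy \<mu> - shift_entropy \<nu> > 0"
    unfolding M.shift_entropy_eq N.shift_entropy_eq by simp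
qed

theorem theorem3p1:
  fixes X :: "(int \<Rightarrow> 'a::{finite,discrete_topology}) set"
    and Y :: "(int \<Rightarrow> 'b::{finite,discrete_topology}) set"
    and \<pi> :: "(int \<Rightarrow> 'a) \<Rightarrow> int \<Rightarrow> 'b"
    and f :: "(int \<Rightarrow> 'a) \<Rightarrow> real"
  assumes "shift_of_finite_type X" and "irreducible_shift X"
    and "sofic_shift Y"
    and "factor_map X Y \<pi>" and "one_block_code X \<pi>" and "\<not> finite_to_one X Y \<pi>"
    and "continuous_on X f" and "dini 1 X f"
  shows "(\<forall>\<nu> \<mu>. \<nu> \<in> invariant_measures Y \<longrightarrow> fully_supported Y \<nu> \<longrightarrow>
             relative_equilibrium_state X \<pi> f \<nu> \<mu> \<longrightarrow>
             fully_supported X \<mu> \<and> shift_entropy \<mu> - shift_entropy \<nu> > 0)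
       \<and> (compensation_function X Y \<pi> f \<longrightarrow> oracle_type X Y \<pi> f)"
proof -
  note main = relative_equilibrium_states[OF assms(1,2,4,5,6,7,8)]
  then show ?thesis unfolding oracle_type_def by blast
qed

end
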